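(* Let $\alpha,\tau,T>0$, $\Omega=(0,1)^d$ with $d\in\{1,2,3\}$. Let $\boldsymbol m_e:\bar\Omega\times[0,T]\to\mathbb S^2$ be an exact solution of the inertial Landau-Lifshitz-Gilbert problem $$\partial_t\boldsymbol m=-\boldsymbol m\times\Delta\boldsymbol m+\alpha\,\boldsymbol m\times(\partial_t\boldsymbol m+\tau\,\partial_{tt}\boldsymbol m)\ \text{ in }\Omega\times(0,T),$$ $$\boldsymbol m(\cdot,0)=\boldsymbol m(0),\quad \partial_t\boldsymbol m(\cdot,0)=0\ \text{ in }\Omega,\qquad \partial_\nu\boldsymbol m=0\ \text{ on }\partial\Omega\times[0,T],$$ and assume the regularity $$\boldsymbol m_e\in C^3([0,T];[C^0(\bar\Omega)]^3)\cap C^2([0,T];[C^2(\bar\Omega)]^3)\cap L^\infty([0,T];[C^4(\bar\Omega)]^3).$$ For mesh size $h$ and time step $k$, put $t_n=nk$, and let $\boldsymbol m_h^n$ ($n\ge 0$) be grid functions with starting values $\boldsymbol m_h^0,\boldsymbol m_h^1,\boldsymbol m_h^2$ and, for all further steps ($n\ge2$, $t_{n+1}\le T$), satisfying the implicit scheme $$\frac{\boldsymbol m_h^{n+1}-\boldsymbol m_h^{n-1}}{2k}-\alpha\,\frac{\boldsymbol m_h^{n+1}+\boldsymbol m_h^{n-1}}2\times\Big(\frac{\boldsymbol m_h^{n+1}-\boldsymbol m_h^{n-1}}{2k}+\tau\,\frac{\boldsymbol m_h^{n+1}-2\boldsymbol m_h^n+\boldsymbol m_h^{n-1}}{k^2}\Big)=-\frac{\boldsymbol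 m_h^{n+1}+\boldsymbol m_h^{n-1}}2\times\Delta_h\Big(\frac{\boldsymbol m_h^{n+1}+\boldsymbol m_h^{n-1}}2\Big)$$ at every grid point. Let $\boldsymbol e_h^p=\mathcal P_h\boldsymbol m_e(\cdot,t_p)-\boldsymbol m_h^p$ and assume that the initial errors satisfy $$\|\boldsymbol e_h^p\|_2+\|\nabla_h\boldsymbol e_h^p\|_2=\mathcal O(k^2+h^2)\ (p=0,1,2),\qquad \Big\|\frac{\boldsymbol e_h^{q+1}-\boldsymbol e_h^q}{k}\Big\|_2=\mathcal O(k^2+h^2)\ (q=0,1).$$ Then there is a constant $\mathcal C>0$ independent of $k$ and $h$ such that, as $h,k\to0^+$ (i.e. for all sufficiently small $h,k$), for all $2\le n\le\lfloor T/k\rfloor$, $$\|\mathcal P_h\boldsymbol m_e(\cdot,t_n)-\boldsymbol m_h^n\|_2+\|\nabla_h(\mathcal P_h\boldsymbol m_e(\cdot,t_n)-\boldsymbol m_h^n)\|_2\le\mathcal C(k^2+h^2).$$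
   Context: Grid: $\Omega=(0,1)^d$ is divided into $N^d$ uniform cells, $h=1/N$; grid points are the cell centers, e.g. for $d=3$ $\boldsymbol x_{i,j,l}=((i-\tfrac12)h,(j-\tfrac12)h,(l-\tfrac12)h)$ with $1\le i,j,l\le N$. A grid function assigns a vector in $\mathbb R^3$ to each grid point and is extended to ghost points (an index equal to $0$ or $N+1$) by the homogeneous Neumann extrapolation: the value at index $0$ equals the value at index $1$, and the value at index $N+1$ equals the value at index $N$, in each direction. $\Delta_h$ is the standard $(2d+1)$-point (seven-point for $d=3$) discrete Laplacian using these ghost values. $\nabla_h$ is the compact central-difference gradient, with values $(\boldsymbol f_{i+1}-\boldsymbol f_i)/h$ located at the faces between neighbouring cells in each coordinate direction (it vanishes on boundary faces), so that $\langle-\Delta_h\boldsymbol f,\boldsymbol g\rangle=\langle\nabla_h\boldsymbol f,\nabla_h\boldsymbol g\rangle$. Discrete inner product and norm: $\langle\boldsymbol f,\boldsymbol g\rangle=h^d\sum_{\boldsymbol x_l}\boldsymbol f(\boldsymbol x_l)\cdot\boldsymbol g(\boldsymbol x_l)$ over all grid points, $\|\boldsymbol f\|_2^2=\langle\boldsymbol f,\boldsymbol f\rangle$; $\|\nabla_h\boldsymbol f\|_2^2$ is $h^d$ times the sum of the squares of all face differences. $\mathcal P_h$ is a nodal interpolation operator; in the discrete norms $\mathcal P_h\boldsymbol m_e(\cdot,t_n)$ is the grid function of values of $\boldsymbol m_e(\cdot,t_n)$ at the grid points. $\times$ is the cross product in $\mathbb R^3$, $\nu$ the outward unit normal. The $\mathcal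 O(k^2+h^2)$ hypotheses mean bounds by a constant independent of $k,h$ times $k^2+h^2$. *)

theory Defs
  imports "HOL-Analysis.Analysis"
begin

text \<open>The dimension \<open>d\<close> is the cardinality of the index type \<open>'d\<close>. A time-dependent field is a
  function \<open>u\<close> with \<open>u t x\<close> its value at time \<open>t\<close> and position \<open>x\<close>; only \<open>t \<in> {0..T}\<close> and
  \<open>x \<in> Omega_bar\<close> matter.\<close>

abbreviation Omega :: "(real ^ 'd) set" where
  "Omega \<equiv> box 0 1"

abbreviation Omega_bar :: "(real ^ 'd) set" where
  "Omega_bar \<equiv> cbox 0 1"

text \<open>The set of admissible increments at \<open>x \<in> Omega_bar\<close> is a nondegenerate interval containing 0,
  so the partial derivative below is the ordinary one in the interior and the one-sided one on a
  face orthogonal to the direction of differentiation. It depends on \<open>f\<close> only through the values on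
  \<open>Omega_bar\<close>.\<close>

definition increments :: "'d \<Rightarrow> real ^ 'd \<Rightarrow> real set" where
  "increments i x = {s. x + s *\<^sub>R axis i 1 \<in> Omega_bar}"

definition pd :: "'d \<Rightarrow> (real ^ 'd \<Rightarrow> real ^ 3) \<Rightarrow> real ^ 'd \<Rightarrow> real ^ 3" where
  "pd i f x = vector_derivative (\<lambda>s. f (x + s *\<^sub>R axis i 1)) (at 0 within increments i x)"

definition has_pd :: "'d \<Rightarrow> (real ^ 'd \<Rightarrow> real ^ 3) \<Rightarrow> bool" where
  "has_pd i f \<longleftrightarrow>
     (\<forall>x\<in>Omega_bar. (\<lambda>s. f (x + s *\<^sub>R axis i 1)) differentiable (at 0 within increments i x))"

definition laplacian :: "(real ^ 'd \<Rightarrow> real ^ 3) \<Rightarrow> real ^ 'd \<Rightarrow> real ^ 3" where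
  "laplacian f x = (\<Sum>i\<in>UNIV. pd i (pd i f) x)"

text \<open>The spaces \<open>C^k\<close> on the closed cube. Since the cube is convex, asking for partial derivatives
  (one-sided on the boundary) that are continuous on the closed cube is the same as asking for
  partial derivatives in the interior that extend continuously to the closed cube.\<close>

fun Ck :: "nat \<Rightarrow> (real ^ 'd \<Rightarrow> real ^ 3) \<Rightarrow> bool" where
  "Ck 0 f \<longleftrightarrow> continuous_on Omega_bar f"
| "Ck (Suc k) f \<longleftrightarrow> continuous_on Omega_bar f \<and> (\<forall>i. has_pd i f \<and> Ck k (pd i f))"

text \<open>The \<open>C^k\<close> norm, meaningful for functions satisfying \<open>Ck k\<close>: the sum of the sup norms of all
  iterated partial derivatives of order at most \<open>k\<close>, one summand for each ordered list of
  directions.\<close>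

fun Ck_norm :: "nat \<Rightarrow> (real ^ 'd \<Rightarrow> real ^ 3) \<Rightarrow> real" where
  "Ck_norm 0 f = (SUP x\<in>Omega_bar. norm (f x))"
| "Ck_norm (Suc k) f = (SUP x\<in>Omega_bar. norm (f x)) + (\<Sum>i\<in>UNIV. Ck_norm k (pd i f))"

text \<open>\<open>C_time T j k u\<close> says \<open>u \<in> C^j([0,T]; C^k)\<close>: continuity and differentiability in time are those
  of a map from \<open>[0,T]\<close> into the normed space \<open>C^k\<close>, one-sided at the end points.\<close>

definition time_continuous :: "real \<Rightarrow> nat \<Rightarrow> (real \<Rightarrow> real ^ 'd \<Rightarrow> real ^ 3) \<Rightarrow> bool" where
  "time_continuous T k u \<longleftrightarrow>
     (\<forall>t\<in>{0..T}. Ck k (u t) \<and>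
       ((\<lambda>s. Ck_norm k (\<lambda>x. u s x - u t x)) \<longlongrightarrow> 0) (at t within {0..T}))"

definition time_derivative ::
  "real \<Rightarrow> nat \<Rightarrow> (real \<Rightarrow> real ^ 'd \<Rightarrow> real ^ 3) \<Rightarrow> (real \<Rightarrow> real ^ 'd \<Rightarrow> real ^ 3) \<Rightarrow> bool" where
  "time_derivative T k u v \<longleftrightarrow>
     (\<forall>t\<in>{0..T}. Ck k (v t) \<and>
       ((\<lambda>s. Ck_norm k (\<lambda>x. (u s x - u t x) /\<^sub>R (s - t) - v t x)) \<longlongrightarrow> 0) (at t within {0..T}))"

fun C_time :: "real \<Rightarrow> nat \<Rightarrow> nat \<Rightarrow> (real \<Rightarrow> real ^ 'd \<Rightarrow> real ^ 3) \<Rightarrow> bool" where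
  "C_time T 0 k u \<longleftrightarrow> time_continuous T k u"
| "C_time T (Suc j) k u \<longleftrightarrow>
     time_continuous T k u \<and> (\<exists>v. time_derivative T k u v \<and> C_time T j k v)"

text \<open>\<open>Linf_time T k u\<close> says \<open>u \<in> L^\<infinity>([0,T]; C^k)\<close> in the Bochner sense: \<open>u\<close> is, for almost every
  \<open>t\<close>, the \<open>C^k\<close>-limit of simple functions of \<open>t\<close> with values in \<open>C^k\<close>, and its \<open>C^k\<close> norm is
  essentially bounded.\<close>

definition Linf_time :: "real \<Rightarrow> nat \<Rightarrow> (real \<Rightarrow> real ^ 'd \<Rightarrow> real ^ 3) \<Rightarrow> bool" where
  "Linf_time T k u \<longleftrightarrow>
     (\<exists>s :: nat \<Rightarrow> real \<Rightarrow> real ^ 'd \<Rightarrow> real ^ 3.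
        (\<forall>j. simple_function (lebesgue_on {0..T}) (s j) \<and> (\<forall>t\<in>{0..T}. Ck k (s j t))) \<and>
        (AE t in lebesgue_on {0..T}. Ck k (u t) \<and>
           (\<lambda>j. Ck_norm k (\<lambda>x. s j t x - u t x)) \<longlonglongrightarrow> 0)) \<and>
     (\<exists>M. AE t in lebesgue_on {0..T}. Ck_norm k (u t) \<le> M)"

definition dt :: "real \<Rightarrow> (real \<Rightarrow> real ^ 'd \<Rightarrow> real ^ 3) \<Rightarrow> real \<Rightarrow> real ^ 'd \<Rightarrow> real ^ 3" where
  "dt T u t x = vector_derivative (\<lambda>s. u s x) (at t within {0..T})"

text \<open>\<open>outward_normal x v\<close>: \<open>x\<close> is a boundary point at which the cube has an outward unit normal
  (i.e. it lies in the relative interior of a face), and \<open>v\<close> is that normal.\<close>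

definition outward_normal :: "real ^ 'd \<Rightarrow> real ^ 'd \<Rightarrow> bool" where
  "outward_normal x v \<longleftrightarrow>
     (\<exists>i. (\<forall>j. j \<noteq> i \<longrightarrow> 0 < x $ j \<and> x $ j < 1) \<and>
          (x $ i = 0 \<and> v = - axis i 1 \<or> x $ i = 1 \<and> v = axis i 1))"

definition iLLG_solution ::
  "real \<Rightarrow> real \<Rightarrow> real \<Rightarrow> (real ^ 'd \<Rightarrow> real ^ 3) \<Rightarrow> (real \<Rightarrow> real ^ 'd \<Rightarrow> real ^ 3) \<Rightarrow> bool" where
  "iLLG_solution \<alpha> \<tau> T m0 m \<longleftrightarrow>
     (\<forall>t\<in>{0..T}. \<forall>x\<in>Omega_bar. norm (m t x) = 1) \<and>
     (\<forall>t\<in>{0<..<T}. \<forall>x\<in>Omega.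
        dt T m t x = - cross3 (m t x) (laplacian (m t) x)
                     + \<alpha> *\<^sub>R cross3 (m t x) (dt T m t x + \<tau> *\<^sub>R dt T (dt T m) t x)) \<and>
     (\<forall>x\<in>Omega. m 0 x = m0 x \<and> dt T m 0 x = 0) \<and>
     (\<forall>t\<in>{0..T}. \<forall>x v. outward_normal x v \<longrightarrow> (\<Sum>i\<in>UNIV. v $ i *\<^sub>R pd i (m t) x) = 0)"

text \<open>A grid function assigns values to multi-indices; only the values on \<open>grid N\<close> matter. The mesh
  size is \<open>h = 1 / N\<close>.\<close>

type_synonym 'd grid_fun = "('d \<Rightarrow> nat) \<Rightarrow> real ^ 3"

definition grid :: "nat \<Rightarrow> ('d \<Rightarrow> nat) set" where
  "grid N = {I. \<forall>j. 1 \<le> I j \<and> I j \<le> N}"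

definition mesh :: "nat \<Rightarrow> real" where
  "mesh N = 1 / real N"

definition cell_center :: "nat \<Rightarrow> ('d \<Rightarrow> nat) \<Rightarrow> real ^ 'd" where
  "cell_center N I = (\<chi> j. (real (I j) - 1/2) * mesh N)"

definition nodal_interp :: "nat \<Rightarrow> (real ^ 'd \<Rightarrow> real ^ 3) \<Rightarrow> 'd grid_fun" where
  "nodal_interp N f = (\<lambda>I. f (cell_center N I))"

text \<open>Neumann ghost values: index 0 is read as 1, and index \<open>N + 1\<close> as \<open>N\<close>.\<close>

definition ghost_ext :: "nat \<Rightarrow> 'd grid_fun \<Rightarrow> 'd grid_fun" where
  "ghost_ext N f = (\<lambda>I. f (\<lambda>j. if I j = 0 then 1 else if I j = N + 1 then N else I j))"

definition dlaplacian :: "nat \<Rightarrow> 'd grid_fun \<Rightarrow> 'd grid_fun" where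
  "dlaplacian N f = (\<lambda>I. \<Sum>j\<in>UNIV.
     (ghost_ext N f (I(j := I j + 1)) - 2 *\<^sub>R f I + ghost_ext N f (I(j := I j - 1))) /\<^sub>R (mesh N)\<^sup>2)"

text \<open>The index \<open>I \<in> faces N j\<close> stands for the face orthogonal to direction \<open>j\<close> between the cells
  \<open>I\<close> and \<open>I(j := I j + 1)\<close>; for \<open>I j = 0\<close> and \<open>I j = N\<close> it is a boundary face, on which the
  discrete gradient vanishes by the choice of the ghost values.\<close>

definition faces :: "nat \<Rightarrow> 'd \<Rightarrow> ('d \<Rightarrow> nat) set" where
  "faces N j = {I. I j \<le> N \<and> (\<forall>l. l \<noteq> j \<longrightarrow> 1 \<le> I l \<and> I l \<le> N)}"

definition dgrad :: "nat \<Rightarrow> 'd grid_fun \<Rightarrow> 'd \<Rightarrow> 'd grid_fun" where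
  "dgrad N f j = (\<lambda>I. (ghost_ext N f (I(j := I j + 1)) - ghost_ext N f I) /\<^sub>R mesh N)"

definition dinner :: "nat \<Rightarrow> 'd::finite grid_fun \<Rightarrow> 'd grid_fun \<Rightarrow> real" where
  "dinner N f g = mesh N ^ CARD('d) * (\<Sum>I\<in>grid N. f I \<bullet> g I)"

definition dnorm :: "nat \<Rightarrow> 'd::finite grid_fun \<Rightarrow> real" where
  "dnorm N f = sqrt (dinner N f f)"

definition dgrad_norm :: "nat \<Rightarrow> 'd::finite grid_fun \<Rightarrow> real" where
  "dgrad_norm N f =
     sqrt (mesh N ^ CARD('d) * (\<Sum>j\<in>UNIV. \<Sum>I\<in>faces N j. (norm (dgrad N f j I))\<^sup>2))"

definition implicit_scheme ::
  "real \<Rightarrow> real \<Rightarrow> real \<Rightarrow> nat \<Rightarrow> real \<Rightarrow> (nat \<Rightarrow> 'd::finite grid_fun) \<Rightarrow> bool" where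
  "implicit_scheme \<alpha> \<tau> T N k m \<longleftrightarrow>
     (\<forall>n\<ge>2. real (n + 1) * k \<le> T \<longrightarrow> (\<forall>I\<in>grid N.
        (let avg = (\<lambda>J. (m (n + 1) J + m (n - 1) J) /\<^sub>R 2);
             D1 = (m (n + 1) I - m (n - 1) I) /\<^sub>R (2 * k);
             D2 = (m (n + 1) I - 2 *\<^sub>R m n I + m (n - 1) I) /\<^sub>R k\<^sup>2
         in D1 - \<alpha> *\<^sub>R cross3 (avg I) (D1 + \<tau> *\<^sub>R D2) = - cross3 (avg I) (dlaplacian N avg I))))"

definition error ::
  "(real \<Rightarrow> real ^ 'd \<Rightarrow> real ^ 3) \<Rightarrow> nat \<Rightarrow> real \<Rightarrow> (nat \<Rightarrow> 'd grid_fun) \<Rightarrow> nat \<Rightarrow> 'd grid_fun" where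
  "error me N k m p = (\<lambda>I. nodal_interp N (me (real p * k)) I - m p I)"

definition initial_errors_bounded ::
  "real \<Rightarrow> (real \<Rightarrow> real ^ 'd::finite \<Rightarrow> real ^ 3) \<Rightarrow> nat \<Rightarrow> real \<Rightarrow> (nat \<Rightarrow> 'd grid_fun) \<Rightarrow> bool" where
  "initial_errors_bounded B me N k m \<longleftrightarrow>
     (\<forall>p\<in>{0, 1, 2}. dnorm N (error me N k m p) + dgrad_norm N (error me N k m p)
                     \<le> B * (k\<^sup>2 + (mesh N)\<^sup>2)) \<and>
     (\<forall>q\<in>{0, 1}. dnorm N (\<lambda>I. (error me N k m (q + 1) I - error me N k m q I) /\<^sub>R k)
                   \<le> B * (k\<^sup>2 + (mesh N)\<^sup>2))"

end

theory Submission
  imports Defs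
begin

text \<open>Write \<open>e\<close> for the error, \<open>D1\<close> and \<open>D2\<close> for the centred time differences, a bar for the average
  of the levels \<open>n + 1\<close> and \<open>n - 1\<close>, and \<open>w = Lap e_bar - \<alpha> D1 e - \<alpha> \<tau> D2 e\<close>. The scheme reads
  \<open>D1 m_h = m_h_bar \<times> (\<dots>)\<close>, so the error equation tested with \<open>w\<close> gives the energy identity for
  \<open>D1 e \<bullet> w\<close> without any bound on \<open>m_h\<close>. Because \<open>\<bar>m\<bar> = 1\<close>, the truncation error \<open>r\<close> is orthogonal to
  \<open>m_bar\<close>; hence \<open>r \<bullet> w\<close> only sees \<open>m_bar \<times> w\<close>, which the scheme expresses by known terms and
  \<open>e_bar \<times> w\<close>. All remaining terms have the form \<open>p \<bullet> (e_bar \<times> w)\<close> with \<open>p\<close> Lipschitz in space and time.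
  The contribution of \<open>Lap e_bar\<close> is summed by parts in space, that of \<open>D2 e\<close> in time, since
  \<open>e_bar \<times> D2 e\<close> is the time difference of \<open>e^n \<times> (e^{n+1} - e^n) / k\<close>. Gronwall then needs neither an
  inverse inequality nor a relation between \<open>k\<close> and \<open>h\<close>.

  The consistency error is of second order although \<open>C^3\<close> in time and a Neumann condition on \<open>m\<close> alone
  do not suffice for this: the equation yields a fourth time derivative, and it shows that the third
  normal derivative of \<open>m\<close> vanishes on the boundary.\<close>

section \<open>Taylor estimates and even extension\<close>

text \<open>The obstacle is the pairing \<open>r . w\<close>. The test function contains
  \<open>Lap e_bar\<close> and \<open>D2 e\<close>, which the energy does not control, and
  \<open>r\<close> is of second order only pointwise: moving a difference from \<open>w\<close> onto
  \<open>r\<close> would cost derivatives of \<open>m\<close> beyond the assumed ones. So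
  \<open>r\<close> is never differenced. It is written as \<open>s x m_bar\<close> with
  \<open>s\<close> again of second order; whatever is left of \<open>w\<close> afterwards comes with
  a factor \<open>e_bar\<close>, and there plain Lipschitz bounds on \<open>s\<close> and on the
  exact field \<open>q\<close> suffice, with \<open>p = q - s\<close>. Dividing by
  \<open>|m_bar|^2\<close> is harmless, because the mean of two unit vectors at distance of order
  \<open>k\<close> has squared length \<open>1 - O(k^2)\<close>. The energy obtained in this way is
  not definite: summation by parts in time leaves \<open>p . (e x V)\<close>, with \<open>V\<close>
  the difference quotient of the error over one step. Under Neumann conditions the gradient does not
  control \<open>e\<close> itself, so a multiple of \<open>|e|^2\<close> is added to the energy,
  large enough to absorb that term.\<close>

lemma has_vector_derivative_affine:
  assumes "(g has_vector_derivative d) (at (a + c * s) within S)"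
    and "\<And>r. r \<in> U \<Longrightarrow> a + c * r \<in> S"
  shows "((\<lambda>r. g (a + c * r)) has_vector_derivative c *\<^sub>R d) (at s within U)"
proof -
  have "((\<lambda>r. a + c * r) has_vector_derivative c) (at s within U)"
    by (auto intro!: derivative_eq_intros simp: has_real_derivative_iff_has_vector_derivative[symmetric])
  moreover have "(g has_vector_derivative d) (at (a + c * s) within (\<lambda>r. a + c * r) ` U)"
    using assms by (auto intro: has_vector_derivative_within_subset)
  ultimately show ?thesis
    using vector_diff_chain_within[of "\<lambda>r. a + c * r" c s U g d] by (simp add: o_def)
qed

text \<open>Mean value inequality against the comparison function
  \<open>K * s^(n+1) / (n+1)\<close>. Used repeatedly, it replaces the integral remainder of
  Taylor's formula without asking the top derivative to be continuous.\<close>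

lemma power_bound_integrate:
  fixes g g' :: "real \<Rightarrow> 'a::real_normed_vector"
  assumes "0 \<le> r"
    and der: "\<And>s. s \<in> {0..r} \<Longrightarrow> (g has_vector_derivative g' s) (at s within {0..r})"
    and bnd: "\<And>s. s \<in> {0..r} \<Longrightarrow> norm (g' s) \<le> K * s ^ n"
    and "g 0 = 0"
  shows "norm (g r) \<le> K * r ^ Suc n / real (Suc n)"
proof (cases "r = 0")
  case False
  then have r: "0 < r" using assms by simp
  have "norm (g r - g 0) \<le> K * r ^ Suc n / real (Suc n) - K * 0 ^ Suc n / real (Suc n)"
  proof (rule differentiable_bound_general[OF r, where f' = g' and \<phi>' = "\<lambda>s. K * s ^ n"])
    show "continuous_on {0..r} g"
      using der by (meson continuous_on_eq_continuous_within has_vector_derivative_continuous)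
    show "continuous_on {0..r} (\<lambda>s. K * s ^ Suc n / real (Suc n))"
      by (intro continuous_intros) auto
    fix s assume s: "0 < s" "s < r"
    then show "(g has_vector_derivative g' s) (at s)"
      using der[of s] at_within_Icc_at[of 0 s r] by auto
    show "((\<lambda>s. K * s ^ Suc n / real (Suc n)) has_vector_derivative K * s ^ n) (at s)"
      unfolding has_real_derivative_iff_has_vector_derivative[symmetric]
      by (rule derivative_eq_intros refl | simp add: divide_simps del: of_nat_Suc power_Suc)+
    show "norm (g' s) \<le> K * s ^ n" using bnd s by auto
  qed
  then show ?thesis using assms by simp
qed (use assms in simp)

lemma increment_bound:
  fixes g g' :: "real \<Rightarrow> 'a::real_normed_vector"
  assumes "a \<le> b"
    and der: "\<And>s. s \<in> {a..b} \<Longrightarrow> (g has_vector_derivative g' s) (at s within {a..b})"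
    and bnd: "\<And>s. s \<in> {a..b} \<Longrightarrow> norm (g' s) \<le> K"
  shows "norm (g b - g a) \<le> K * (b - a)"
proof -
  have "norm ((\<lambda>s. g (a + 1 * s) - g a) (b - a)) \<le> K * (b - a) ^ Suc 0 / real (Suc 0)"
  proof (rule power_bound_integrate[where g' = "\<lambda>s. 1 *\<^sub>R g' (a + 1 * s) - 0"])
    fix s assume s: "s \<in> {0..b - a}"
    show "((\<lambda>s. g (a + 1 * s) - g a) has_vector_derivative 1 *\<^sub>R g' (a + 1 * s) - 0)
            (at s within {0..b - a})"
      using s by (intro has_vector_derivative_diff has_vector_derivative_const
          has_vector_derivative_affine[OF der]) auto
    show "norm (1 *\<^sub>R g' (a + 1 * s) - 0) \<le> K * s ^ 0" using s bnd[of "a + s"] by auto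
  qed (use assms in auto)
  then show ?thesis by simp
qed

lemma symmetric_derivative:
  assumes "\<And>s. s \<in> {x - r..x + r} \<Longrightarrow> (g has_vector_derivative g' s) (at s within {x - r..x + r})"
    and "s \<in> {0..r}"
  shows "((\<lambda>s. g (x + s)) has_vector_derivative g' (x + s)) (at s within {0..r})"
    and "((\<lambda>s. g (x - s)) has_vector_derivative - g' (x - s)) (at s within {0..r})"
proof -
  show "((\<lambda>s. g (x + s)) has_vector_derivative g' (x + s)) (at s within {0..r})"
    using has_vector_derivative_affine[OF assms(1), of x 1 s "{0..r}"] assms(2) by auto
  show "((\<lambda>s. g (x - s)) has_vector_derivative - g' (x - s)) (at s within {0..r})"
    using has_vector_derivative_affine[OF assms(1), of x "-1" s "{0..r}"] assms(2) by auto
qed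

text \<open>As a function of the step, the symmetrised difference vanishes at 0 together with its
  derivative, so the bound \<open>2 * K\<close> on its second derivative is integrated
  twice.\<close>

lemma second_difference_le:
  fixes g :: "real \<Rightarrow> 'a::real_normed_vector"
  assumes "0 \<le> r"
    and g: "\<And>s. s \<in> {x - r..x + r} \<Longrightarrow> (g has_vector_derivative g' s) (at s within {x - r..x + r})"
    and g': "\<And>s. s \<in> {x - r..x + r} \<Longrightarrow> (g' has_vector_derivative g'' s) (at s within {x - r..x + r})"
    and bnd: "\<And>s. s \<in> {x - r..x + r} \<Longrightarrow> norm (g'' s) \<le> K"
  shows "norm (g (x + r) + g (x - r) - 2 *\<^sub>R g x) \<le> K * r\<^sup>2"
proof -
  have 1: "norm (g' (x + s) + - g' (x - s)) \<le> 2 * K * s" if s: "s \<in> {0..r}" for s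
  proof -
    have "norm ((\<lambda>s. g' (x + s) + - g' (x - s)) s) \<le> 2 * K * s ^ Suc 0 / real (Suc 0)"
    proof (rule power_bound_integrate[where g' = "\<lambda>s. g'' (x + s) + - (- g'' (x - s))"])
      fix u assume u: "u \<in> {0..s}"
      have "((\<lambda>s. g' (x + s) + - g' (x - s)) has_vector_derivative g'' (x + u) + - (- g'' (x - u)))
              (at u within {0..r})"
        using u s by (intro has_vector_derivative_add has_vector_derivative_minus
            symmetric_derivative[OF g']) auto
      then show "((\<lambda>s. g' (x + s) + - g' (x - s)) has_vector_derivative g'' (x + u) + - (- g'' (x - u)))
              (at u within {0..s})"
        by (rule has_vector_derivative_within_subset) (use s in auto)
      have "norm (g'' (x + u)) \<le> K" "norm (g'' (x - u)) \<le> K" using u s by (auto intro!: bnd)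
      then show "norm (g'' (x + u) + - (- g'' (x - u))) \<le> 2 * K * u ^ 0"
        using norm_triangle_ineq[of "g'' (x + u)" "g'' (x - u)"] by simp
    qed (use s in auto)
    then show ?thesis by simp
  qed
  have "norm ((\<lambda>s. g (x + s) + g (x - s) - 2 *\<^sub>R g x) r) \<le> 2 * K * r ^ Suc 1 / real (Suc 1)"
  proof (rule power_bound_integrate[where g' = "\<lambda>s. g' (x + s) + - g' (x - s) - 0"])
    fix s assume s: "s \<in> {0..r}"
    show "((\<lambda>s. g (x + s) + g (x - s) - 2 *\<^sub>R g x) has_vector_derivative
            g' (x + s) + - g' (x - s) - 0) (at s within {0..r})"
      using s by (intro has_vector_derivative_diff has_vector_derivative_add
          symmetric_derivative[OF g] has_vector_derivative_const) auto
    show "norm (g' (x + s) + - g' (x - s) - 0) \<le> 2 * K * s ^ 1" using 1[OF s] by simp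
  qed (use assms in auto, simp add: scaleR_2)
  then show ?thesis by (simp add: power2_eq_square mult.assoc)
qed

text \<open>The hypothesis bounds a second difference of \<open>g''\<close> instead of a fourth
  derivative. In time, the second derivative of the exact solution gets such a bound only through
  the equation; in space, it comes from the reflected extension.\<close>

lemma second_difference_consistent:
  fixes g :: "real \<Rightarrow> 'a::real_normed_vector"
  assumes "0 \<le> r" "0 \<le> K"
    and g: "\<And>s. s \<in> {x - r..x + r} \<Longrightarrow> (g has_vector_derivative g' s) (at s within {x - r..x + r})"
    and g': "\<And>s. s \<in> {x - r..x + r} \<Longrightarrow> (g' has_vector_derivative g'' s) (at s within {x - r..x + r})"
    and bnd: "\<And>s. s \<in> {0..r} \<Longrightarrow> norm (g'' (x + s) + g'' (x - s) - 2 *\<^sub>R g'' x) \<le> K * s\<^sup>2"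
  shows "norm (g (x + r) + g (x - r) - 2 *\<^sub>R g x - r\<^sup>2 *\<^sub>R g'' x) \<le> K * r ^ 4"
proof -
  have 1: "norm (g' (x + s) + - g' (x - s) - (2 * s) *\<^sub>R g'' x) \<le> (K / 3) * s ^ 3" if s: "s \<in> {0..r}" for s
  proof -
    have "norm ((\<lambda>s. g' (x + s) + - g' (x - s) - (2 * s) *\<^sub>R g'' x) s) \<le> K * s ^ Suc 2 / real (Suc 2)"
    proof (rule power_bound_integrate[where g' = "\<lambda>s. g'' (x + s) + - (- g'' (x - s)) - 2 *\<^sub>R g'' x"])
      fix u assume u: "u \<in> {0..s}"
      have "((\<lambda>s. (2 * s) *\<^sub>R g'' x) has_vector_derivative 2 *\<^sub>R g'' x) (at u within {0..r})"
        by (auto intro!: derivative_eq_intros simp: has_vector_derivative_def fun_eq_iff)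
      then have "((\<lambda>s. g' (x + s) + - g' (x - s) - (2 * s) *\<^sub>R g'' x) has_vector_derivative
             g'' (x + u) + - (- g'' (x - u)) - 2 *\<^sub>R g'' x) (at u within {0..r})"
        using u s by (intro has_vector_derivative_diff has_vector_derivative_add
            has_vector_derivative_minus symmetric_derivative[OF g']) auto
      then show "((\<lambda>s. g' (x + s) + - g' (x - s) - (2 * s) *\<^sub>R g'' x) has_vector_derivative
             g'' (x + u) + - (- g'' (x - u)) - 2 *\<^sub>R g'' x) (at u within {0..s})"
        by (rule has_vector_derivative_within_subset) (use s in auto)
      show "norm (g'' (x + u) + - (- g'' (x - u)) - 2 *\<^sub>R g'' x) \<le> K * u ^ 2"
        using bnd[of u] u s by simp
    qed (use s in auto)
    then show ?thesis by (simp add: power3_eq_cube power2_eq_square)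
  qed
  have "norm ((\<lambda>s. g (x + s) + g (x - s) - 2 *\<^sub>R g x - s\<^sup>2 *\<^sub>R g'' x) r)
          \<le> (K / 3) * r ^ Suc 3 / real (Suc 3)"
  proof (rule power_bound_integrate[where g' = "\<lambda>s. g' (x + s) + - g' (x - s) - 0 - (2 * s) *\<^sub>R g'' x"])
    fix s assume s: "s \<in> {0..r}"
    have "((\<lambda>s. s\<^sup>2 *\<^sub>R g'' x) has_vector_derivative (2 * s) *\<^sub>R g'' x) (at s within {0..r})"
      by (auto intro!: derivative_eq_intros simp: has_vector_derivative_def fun_eq_iff)
    then show "((\<lambda>s. g (x + s) + g (x - s) - 2 *\<^sub>R g x - s\<^sup>2 *\<^sub>R g'' x) has_vector_derivative
            g' (x + s) + - g' (x - s) - 0 - (2 * s) *\<^sub>R g'' x) (at s within {0..r})"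
      using s by (intro has_vector_derivative_diff has_vector_derivative_add
          symmetric_derivative[OF g] has_vector_derivative_const) auto
    show "norm (g' (x + s) + - g' (x - s) - 0 - (2 * s) *\<^sub>R g'' x) \<le> (K / 3) * s ^ 3"
      using 1[OF s] by simp
  qed (use assms in auto, simp add: scaleR_2)
  \<comment> \<open>The two integrations give \<open>K / 12\<close>, which is rounded up to
    \<open>K\<close>.\<close>
  also have "\<dots> \<le> K * r ^ 4" using assms(1,2) by (simp add: numeral_eq_Suc divide_simps)
  finally show ?thesis by simp
qed

lemma central_difference_consistent:
  fixes g :: "real \<Rightarrow> 'a::real_normed_vector"
  assumes "0 \<le> r" "0 \<le> K"
    and g: "\<And>s. s \<in> {x - r..x + r} \<Longrightarrow> (g has_vector_derivative g' s) (at s within {x - r..x + r})"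
    and bnd: "\<And>s. s \<in> {0..r} \<Longrightarrow> norm (g' (x + s) + g' (x - s) - 2 *\<^sub>R g' x) \<le> K * s\<^sup>2"
  shows "norm (g (x + r) - g (x - r) - (2 * r) *\<^sub>R g' x) \<le> K * r ^ 3"
proof -
  have "norm ((\<lambda>s. g (x + s) + - g (x - s) - (2 * s) *\<^sub>R g' x) r) \<le> K * r ^ Suc 2 / real (Suc 2)"
  proof (rule power_bound_integrate[where g' = "\<lambda>s. g' (x + s) + - (- g' (x - s)) - 2 *\<^sub>R g' x"])
    fix u assume u: "u \<in> {0..r}"
    have "((\<lambda>s. (2 * s) *\<^sub>R g' x) has_vector_derivative 2 *\<^sub>R g' x) (at u within {0..r})"
      by (auto intro!: derivative_eq_intros simp: has_vector_derivative_def fun_eq_iff)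
    then show "((\<lambda>s. g (x + s) + - g (x - s) - (2 * s) *\<^sub>R g' x) has_vector_derivative
             g' (x + u) + - (- g' (x - u)) - 2 *\<^sub>R g' x) (at u within {0..r})"
      using u by (intro has_vector_derivative_diff has_vector_derivative_add
            has_vector_derivative_minus symmetric_derivative[OF g]) auto
    show "norm (g' (x + u) + - (- g' (x - u)) - 2 *\<^sub>R g' x) \<le> K * u ^ 2"
      using bnd[of u] u by simp
  qed (use assms in auto)
  also have "\<dots> \<le> K * r ^ 3" using assms(1,2) by (simp add: numeral_eq_Suc divide_simps)
  finally show ?thesis by simp
qed

section \<open>Even and odd extension across a boundary point\<close>

lemma glue_reflected_derivative:
  fixes g :: "real \<Rightarrow> 'a::real_normed_vector"
  assumes "0 \<le> b" "s \<in> {-b..b}"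
    and f: "\<And>s. s \<in> {-b..0} \<Longrightarrow> (f has_vector_derivative f' s) (at s within {-b..0})"
    and g: "\<And>s. s \<in> {0..b} \<Longrightarrow> (g has_vector_derivative g' s) (at s within {0..b})"
    and "f 0 = g 0" "f' 0 = g' 0"
  shows "((\<lambda>s. if s \<in> {-b..0} then f s else g s) has_vector_derivative
           (if s \<in> {-b..0} then f' s else g' s)) (at s within {-b..b})"
proof (rule has_vector_derivative_If_within_closures[where T = "{0..b}"])
  have "{-b..0} \<union> (closure {-b..0} \<inter> closure {0..b}) = {-b..0}"
    and "{0..b} \<union> (closure {-b..0} \<inter> closure {0..b}) = {0..b}"
    using assms(1) by auto
  then show "s \<in> {-b..0} \<union> (closure {-b..0} \<inter> closure {0..b}) \<Longrightarrow>
      (f has_vector_derivative f' s) (at s within {-b..0} \<union> (closure {-b..0} \<inter> closure {0..b}))"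
    and "s \<in> {0..b} \<union> (closure {-b..0} \<inter> closure {0..b}) \<Longrightarrow>
      (g has_vector_derivative g' s) (at s within {0..b} \<union> (closure {-b..0} \<inter> closure {0..b}))"
    using f g by auto
  show "f s = g s" "f' s = g' s" if "s \<in> closure {-b..0}" "s \<in> closure {0..b}"
    using that assms(5,6) by (auto simp: antisym)
qed (use assms in auto)

text \<open>The vanishing of \<open>g'\<close> at 0 removes the corner of the extension there; since
  \<open>sgn 0 = 0\<close>, one formula covers both sides and the junction.\<close>

lemma even_extension_derivative:
  fixes g :: "real \<Rightarrow> 'a::real_normed_vector"
  assumes "0 \<le> b" "s \<in> {-b..b}"
    and g: "\<And>s. s \<in> {0..b} \<Longrightarrow> (g has_vector_derivative g' s) (at s within {0..b})"
    and "g' 0 = 0"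
  shows "((\<lambda>s. g \<bar>s\<bar>) has_vector_derivative sgn s *\<^sub>R g' \<bar>s\<bar>) (at s within {-b..b})"
proof -
  have "((\<lambda>s. if s \<in> {-b..0} then g (0 + (-1) * s) else g s) has_vector_derivative
           (if s \<in> {-b..0} then (-1) *\<^sub>R g' (0 + (-1) * s) else g' s)) (at s within {-b..b})"
    using assms(1,2,4)
    by (intro glue_reflected_derivative has_vector_derivative_affine[OF g] g) auto
  then have "((\<lambda>s. if s \<in> {-b..0} then g (0 + (-1) * s) else g s) has_vector_derivative
           sgn s *\<^sub>R g' \<bar>s\<bar>) (at s within {-b..b})"
    by (rule has_vector_derivative_eq_rhs) (use assms in \<open>auto simp: sgn_if\<close>)
  then show ?thesis
    by (rule has_vector_derivative_transform[rotated -1]) (use assms in auto)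
qed

text \<open>Here the value at 0 must vanish for continuity, and then the one-sided derivatives agree
  by themselves. Alternating with the even case climbs through the derivatives and meets a condition
  only at those of odd order.\<close>

lemma odd_extension_derivative:
  fixes g :: "real \<Rightarrow> 'a::real_normed_vector"
  assumes "0 \<le> b" "s \<in> {-b..b}"
    and g: "\<And>s. s \<in> {0..b} \<Longrightarrow> (g has_vector_derivative g' s) (at s within {0..b})"
    and "g 0 = 0"
  shows "((\<lambda>s. sgn s *\<^sub>R g \<bar>s\<bar>) has_vector_derivative g' \<bar>s\<bar>) (at s within {-b..b})"
proof -
  have "((\<lambda>s. if s \<in> {-b..0} then - g (0 + (-1) * s) else g s) has_vector_derivative
           (if s \<in> {-b..0} then - ((-1) *\<^sub>R g' (0 + (-1) * s)) else g' s)) (at s within {-b..b})"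
    using assms(1,2,4)
    by (intro glue_reflected_derivative has_vector_derivative_minus has_vector_derivative_affine[OF g] g) auto
  then have "((\<lambda>s. if s \<in> {-b..0} then - g (0 + (-1) * s) else g s) has_vector_derivative
           g' \<bar>s\<bar>) (at s within {-b..b})"
    by (rule has_vector_derivative_eq_rhs) (use assms in auto)
  then show ?thesis
    by (rule has_vector_derivative_transform[rotated -1]) (use assms in \<open>auto simp: sgn_if\<close>)
qed

text \<open>The ghost value of a Neumann grid function is the value of the even extension
  \<open>s \<mapsto> g \<bar>s\<bar>\<close>, which is as smooth as \<open>g\<close> when the odd derivatives of \<open>g\<close> vanish at \<open>0\<close>.\<close>

lemma reflected_second_difference_le:
  fixes g :: "real \<Rightarrow> 'a::real_normed_vector"
  assumes "0 \<le> r" "0 \<le> x" "x + r \<le> 1"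
    and g: "\<And>s. s \<in> {0..1} \<Longrightarrow> (g has_vector_derivative g' s) (at s within {0..1})"
    and g': "\<And>s. s \<in> {0..1} \<Longrightarrow> (g' has_vector_derivative g'' s) (at s within {0..1})"
    and "g' 0 = 0"
    and bnd: "\<And>s. s \<in> {0..1} \<Longrightarrow> norm (g'' s) \<le> K"
  shows "norm (g (x + r) + g \<bar>x - r\<bar> - 2 *\<^sub>R g x) \<le> K * r\<^sup>2"
proof -
  have "norm (g \<bar>x + r\<bar> + g \<bar>x - r\<bar> - 2 *\<^sub>R g \<bar>x\<bar>) \<le> K * r\<^sup>2"
  proof (rule second_difference_le[where g = "\<lambda>s. g \<bar>s\<bar>" and g' = "\<lambda>s. sgn s *\<^sub>R g' \<bar>s\<bar>" and g'' = "\<lambda>s. g'' \<bar>s\<bar>"])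
    fix s assume s: "s \<in> {x - r..x + r}"
    then have s1: "s \<in> {-1..1}" and sub: "{x - r..x + r} \<subseteq> {-1..1}" using assms(1-3) by auto
    show "((\<lambda>s. g \<bar>s\<bar>) has_vector_derivative sgn s *\<^sub>R g' \<bar>s\<bar>) (at s within {x - r..x + r})"
      by (rule has_vector_derivative_within_subset[OF even_extension_derivative sub])
         (use s1 g assms in auto)
    show "((\<lambda>s. sgn s *\<^sub>R g' \<bar>s\<bar>) has_vector_derivative g'' \<bar>s\<bar>) (at s within {x - r..x + r})"
      by (rule has_vector_derivative_within_subset[OF odd_extension_derivative sub])
         (use s1 g' assms in auto)
    show "norm (g'' \<bar>s\<bar>) \<le> K" using bnd s1 by auto
  qed (use assms in auto)
  then show ?thesis using assms(1-3) by simp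
qed

lemma reflected_second_difference_consistent:
  fixes g :: "real \<Rightarrow> 'a::real_normed_vector"
  assumes "0 \<le> r" "0 \<le> x" "x + r \<le> 1"
    and g1: "\<And>s. s \<in> {0..1} \<Longrightarrow> (g has_vector_derivative g1 s) (at s within {0..1})"
    and g2: "\<And>s. s \<in> {0..1} \<Longrightarrow> (g1 has_vector_derivative g2 s) (at s within {0..1})"
    and g3: "\<And>s. s \<in> {0..1} \<Longrightarrow> (g2 has_vector_derivative g3 s) (at s within {0..1})"
    and g4: "\<And>s. s \<in> {0..1} \<Longrightarrow> (g3 has_vector_derivative g4 s) (at s within {0..1})"
    and "g1 0 = 0" "g3 0 = 0"
    and bnd: "\<And>s. s \<in> {0..1} \<Longrightarrow> norm (g4 s) \<le> K"
  shows "norm (g (x + r) + g \<bar>x - r\<bar> - 2 *\<^sub>R g x - r\<^sup>2 *\<^sub>R g2 x) \<le> K * r ^ 4"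
proof -
  have "0 \<le> K" using order_trans[OF norm_ge_zero bnd[of 0]] by simp
  have "norm (g \<bar>x + r\<bar> + g \<bar>x - r\<bar> - 2 *\<^sub>R g \<bar>x\<bar> - r\<^sup>2 *\<^sub>R g2 \<bar>x\<bar>) \<le> K * r ^ 4"
  proof (rule second_difference_consistent[where g = "\<lambda>s. g \<bar>s\<bar>" and g' = "\<lambda>s. sgn s *\<^sub>R g1 \<bar>s\<bar>" and g'' = "\<lambda>s. g2 \<bar>s\<bar>"])
    fix s assume s: "s \<in> {x - r..x + r}"
    then have s1: "s \<in> {-1..1}" and sub: "{x - r..x + r} \<subseteq> {-1..1}" using assms(1-3) by auto
    show "((\<lambda>s. g \<bar>s\<bar>) has_vector_derivative sgn s *\<^sub>R g1 \<bar>s\<bar>) (at s within {x - r..x + r})"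
      by (rule has_vector_derivative_within_subset[OF even_extension_derivative sub])
         (use s1 g1 assms in auto)
    show "((\<lambda>s. sgn s *\<^sub>R g1 \<bar>s\<bar>) has_vector_derivative g2 \<bar>s\<bar>) (at s within {x - r..x + r})"
      by (rule has_vector_derivative_within_subset[OF odd_extension_derivative sub])
         (use s1 g2 assms in auto)
  next
    fix s assume s: "s \<in> {0..r}"
    \<comment> \<open>The previous estimate two derivatives higher up, for the even extension of
      \<open>g2\<close>; this is where \<open>g3 0 = 0\<close> enters.\<close>
    have "norm (g2 (x + s) + g2 \<bar>x - s\<bar> - 2 *\<^sub>R g2 x) \<le> K * s\<^sup>2"
      by (rule reflected_second_difference_le[OF _ _ _ g3 g4]) (use assms s in auto)
    then show "norm (g2 \<bar>x + s\<bar> + g2 \<bar>x - s\<bar> - 2 *\<^sub>R g2 \<bar>x\<bar>) \<le> K * s\<^sup>2"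
      using assms(2) s by simp
  qed (use assms \<open>0 \<le> K\<close> in auto)
  then show ?thesis using assms(1-3) by simp
qed

section \<open>The error identity and summation by parts\<close>

lemma norm_cross3_le: "norm (cross3 x y) \<le> norm x * norm y"
proof (rule power2_le_imp_le)
  show "(norm (cross3 x y))\<^sup>2 \<le> (norm x * norm y)\<^sup>2"
    using norm_cross_dot[of x y] zero_le_power2[of "x \<bullet> y"] by linarith
qed simp

lemma norm_cross3_diff_le:
  "norm (cross3 x y - cross3 x' y') \<le> norm (x - x') * norm y + norm x' * norm (y - y')"
proof -
  have "cross3 x y - cross3 x' y' = cross3 (x - x') y + cross3 x' (y - y')"
    by (simp add: Cross3.left_diff_distrib Cross3.right_diff_distrib)
  then show ?thesis
    by (metis norm_triangle_le add_mono norm_cross3_le)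
qed

lemma triple_le: "\<bar>p \<bullet> cross3 a b\<bar> \<le> norm p * ((norm a)\<^sup>2 + (norm b)\<^sup>2) / 2"
proof -
  have "\<bar>p \<bullet> cross3 a b\<bar> \<le> norm p * (norm a * norm b)"
    by (meson Cauchy_Schwarz_ineq2 mult_left_mono norm_cross3_le norm_ge_zero order_trans)
  also have "norm a * norm b \<le> ((norm a)\<^sup>2 + (norm b)\<^sup>2) / 2"
    using sum_squares_bound[of "norm a" "norm b"] by simp
  finally show ?thesis by (simp add: mult_left_mono)
qed

text \<open>If \<open>r = D - m x q\<close> is orthogonal to \<open>m\<close>, this is the vector
  \<open>s\<close> orthogonal to \<open>m\<close> that solves \<open>s x m = r\<close>, so that
  \<open>r . w = s . (m x w)\<close>. It inherits the size of \<open>r\<close> and depends smoothly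
  on the data as long as \<open>m\<close> stays away from 0.\<close>

definition corrector :: "real ^ 3 \<Rightarrow> real ^ 3 \<Rightarrow> real ^ 3 \<Rightarrow> real ^ 3" where
  "corrector m D q = (1 / (m \<bullet> m)) *\<^sub>R cross3 m (D - cross3 m q)"

text \<open>Since the truncation error \<open>D - m \<times> q\<close> is orthogonal to \<open>m\<close>, pairing it with \<open>w\<close> only sees
  \<open>m \<times> w\<close>, which the scheme expresses without derivatives up to the term \<open>e \<times> w\<close>. The latter can be
  summed by parts because of its antisymmetry.\<close>

lemma error_identity:
  assumes scheme: "D - D1 = cross3 (m - e) (q + w)" and orth: "m \<bullet> D = 0" and "m \<bullet> m \<noteq> 0"
  defines "s \<equiv> corrector m D q"
  shows "- (D1 \<bullet> w) = s \<bullet> D1 - s \<bullet> cross3 e q + (q - s) \<bullet> cross3 e w"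
proof -
  define r where "r = D - cross3 m q"
  have s: "s = (1 / (m \<bullet> m)) *\<^sub>R cross3 m r" by (simp add: s_def corrector_def r_def)
  have "m \<bullet> r = 0" by (simp add: r_def inner_diff_right orth dot_cross_self)
  have "s \<bullet> r = 0" by (simp add: s dot_cross_self)
  have D1: "D1 = r + cross3 e q - cross3 (m - e) w"
    using scheme by (simp add: r_def Cross3.left_diff_distrib cross_add_right algebra_simps)
  \<comment> \<open>The product with the numerical average \<open>m - e\<close> is orthogonal to
    \<open>w\<close> and disappears, whatever its size.\<close>
  have 1: "D1 \<bullet> w = r \<bullet> w + cross3 e q \<bullet> w"
    by (simp add: D1 inner_add_left inner_diff_left dot_cross_self)
  have "cross3 m r \<bullet> cross3 m w = (m \<bullet> m) * (r \<bullet> w) - (m \<bullet> r) * (m \<bullet> w)"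
    by (simp add: cross3_simps)
  then have 2: "r \<bullet> w = s \<bullet> cross3 m w"
    using \<open>m \<bullet> r = 0\<close> \<open>m \<bullet> m \<noteq> 0\<close> by (simp add: s)
  \<comment> \<open>The formula for \<open>D1\<close> read backwards: apart from
    \<open>e x w\<close>, nothing on the right contains \<open>w\<close>.\<close>
  have 3: "cross3 m w = r - D1 + cross3 e q + cross3 e w"
    by (simp add: D1 Cross3.left_diff_distrib)
  have 4: "cross3 e q \<bullet> w = - (q \<bullet> cross3 e w)"
    by (simp add: cross3_simps)
  show ?thesis
    unfolding 1 4 2 3 using \<open>s \<bullet> r = 0\<close>
    by (simp add: inner_add_right inner_diff_right inner_diff_left)
qed

lemma corrector_small:
  assumes "norm m \<le> A" "1 / 2 \<le> m \<bullet> m" "norm (D - cross3 m q) \<le> \<epsilon>"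
  shows "norm (corrector m D q) \<le> 2 * A * \<epsilon>"
proof -
  have "norm (corrector m D q) = (1 / (m \<bullet> m)) * norm (cross3 m (D - cross3 m q))"
    by (simp add: corrector_def)
  also have "\<dots> \<le> 2 * norm (cross3 m (D - cross3 m q))"
    using assms(2) le_imp_inverse_le[OF assms(2)] by (intro mult_right_mono) (auto simp: inverse_eq_divide)
  also have "norm (cross3 m (D - cross3 m q)) \<le> A * \<epsilon>"
    by (meson assms(1,3) mult_mono norm_cross3_le norm_ge_zero order_trans)
  finally show ?thesis by simp
qed

text \<open>The corrector is rational in its arguments with denominator at least
  \<open>1 / 2\<close>. With a free \<delta> the same estimate serves neighbouring cells (\<delta>
  the mesh size) and successive times (\<delta> the time step).\<close>

lemma corrector_lipschitz:
  assumes A: "1 \<le> A" and "0 \<le> \<delta>"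
    and "norm m \<le> A" "norm D \<le> A" "norm q \<le> A" "1 / 2 \<le> m \<bullet> m"
    and "norm m' \<le> A" "norm D' \<le> A" "norm q' \<le> A" "1 / 2 \<le> m' \<bullet> m'"
    and "norm (m - m') \<le> A * \<delta>" "norm (D - D') \<le> A * \<delta>" "norm (q - q') \<le> A * \<delta>"
  shows "norm (corrector m D q) \<le> 4 * A ^ 3"
    and "norm (corrector m D q - corrector m' D' q') \<le> 26 * A ^ 5 * \<delta>"
proof -
  have pow: "A \<le> A ^ 2" "A ^ 2 \<le> A ^ 3" "A ^ 3 \<le> A ^ 4" "A ^ 4 \<le> A ^ 5"
    using A by (auto intro: power_increasing self_le_power)
  define y where "y = D - cross3 m q"
  define y' where "y' = D' - cross3 m' q'"
  have y: "norm y \<le> 2 * A ^ 2" if "norm D \<le> A" "norm m \<le> A" "norm q \<le> A" "y = D - cross3 m q" for y D m q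
  proof -
    have "norm y \<le> norm D + norm m * norm q"
      by (metis that(4) norm_triangle_le_diff add_left_mono norm_cross3_le)
    also have "\<dots> \<le> A + A * A" using that A by (intro add_mono mult_mono) auto
    finally show ?thesis using pow by (simp add: power2_eq_square)
  qed
  have ny: "norm y \<le> 2 * A ^ 2" "norm y' \<le> 2 * A ^ 2"
    using assms by (auto intro: y simp: y_def y'_def)
  have "y - y' = (D - D') - (cross3 m q - cross3 m' q')" by (simp add: y_def y'_def)
  then have "norm (y - y') \<le> norm (D - D') + (norm (m - m') * norm q + norm m' * norm (q - q'))"
    by (metis norm_triangle_le_diff add_left_mono norm_cross3_diff_le)
  also have "\<dots> \<le> A * \<delta> + (A * \<delta> * A + A * (A * \<delta>))"
    using assms by (intro add_mono mult_mono) auto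
  also have "\<dots> = (A + 2 * A ^ 2) * \<delta>" by (simp add: algebra_simps power2_eq_square)
  also have "\<dots> \<le> (3 * A ^ 2) * \<delta>" using pow assms(2) by (intro mult_right_mono) auto
  finally have dy: "norm (y - y') \<le> 3 * A ^ 2 * \<delta>" .
  define z where "z = cross3 m y"
  define z' where "z' = cross3 m' y'"
  have nz: "norm z \<le> 2 * A ^ 3" "norm z' \<le> 2 * A ^ 3"
  proof -
    have z: "norm (cross3 m y) \<le> A * (2 * A ^ 2)" if "norm m \<le> A" "norm y \<le> 2 * A ^ 2" for m y
      by (meson that mult_mono norm_cross3_le norm_ge_zero order_trans)
    then show "norm z \<le> 2 * A ^ 3" "norm z' \<le> 2 * A ^ 3"
      using z[of m y] z[of m' y'] assms ny unfolding z_def z'_def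
      by (auto simp: power2_eq_square power3_eq_cube mult_ac)
  qed
  have "norm (z - z') \<le> norm (m - m') * norm y + norm m' * norm (y - y')"
    unfolding z_def z'_def by (rule norm_cross3_diff_le)
  also have "\<dots> \<le> A * \<delta> * (2 * A ^ 2) + A * (3 * A ^ 2 * \<delta>)"
    using assms ny dy by (intro add_mono mult_mono) auto
  finally have dz: "norm (z - z') \<le> 5 * A ^ 3 * \<delta>"
    by (simp add: power2_eq_square power3_eq_cube algebra_simps)
  define l where "l = 1 / (m \<bullet> m)"
  define l' where "l' = 1 / (m' \<bullet> m')"
  have l: "0 \<le> l" "l \<le> 2" "0 \<le> l'" "l' \<le> 2"
    using assms le_imp_inverse_le[of "1 / 2" "m \<bullet> m"] le_imp_inverse_le[of "1 / 2" "m' \<bullet> m'"]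
    by (auto simp: l_def l'_def inverse_eq_divide)
  have "m \<bullet> m > 0" "m' \<bullet> m' > 0" using assms by auto
  \<comment> \<open>A difference of squared norms factors as an inner product with
    \<open>m' - m\<close>, which makes the reciprocal Lipschitz.\<close>
  then have "l - l' = ((m' - m) \<bullet> (m + m')) * (l * l')"
    by (simp add: l_def l'_def field_simps inner_diff_left inner_diff_right inner_add_right)
       (simp add: inner_commute)
  then have "\<bar>l - l'\<bar> = \<bar>(m' - m) \<bullet> (m + m')\<bar> * (l * l')"
    using l by (simp add: abs_mult)
  also have "\<dots> \<le> (A * \<delta> * (A + A)) * (2 * 2)"
  proof (intro mult_mono)
    have "\<bar>(m' - m) \<bullet> (m + m')\<bar> \<le> norm (m' - m) * norm (m + m')" by (rule Cauchy_Schwarz_ineq2)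
    also have "\<dots> \<le> A * \<delta> * (A + A)"
      using assms by (intro mult_mono norm_triangle_mono) (auto simp: norm_minus_commute)
    finally show "\<bar>(m' - m) \<bullet> (m + m')\<bar> \<le> A * \<delta> * (A + A)" .
  qed (use l assms in auto)
  finally have dl: "\<bar>l - l'\<bar> \<le> 8 * A ^ 2 * \<delta>" by (simp add: power2_eq_square algebra_simps)
  have c: "corrector m D q = l *\<^sub>R z" "corrector m' D' q' = l' *\<^sub>R z'"
    by (simp_all add: corrector_def l_def z_def y_def l'_def z'_def y'_def)
  have "norm (l *\<^sub>R z) \<le> 2 * (2 * A ^ 3)"
    using mult_mono[OF l(2) nz(1)] l by simp
  then show "norm (corrector m D q) \<le> 4 * A ^ 3" using c by simp
  have "l *\<^sub>R z - l' *\<^sub>R z' = (l - l') *\<^sub>R z + l' *\<^sub>R (z - z')" by (simp add: algebra_simps)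
  then have "norm (corrector m D q - corrector m' D' q') \<le> \<bar>l - l'\<bar> * norm z + l' * norm (z - z')"
    unfolding c using l by (metis abs_of_nonneg norm_scaleR norm_triangle_ineq)
  also have "\<dots> \<le> 8 * A ^ 2 * \<delta> * (2 * A ^ 3) + 2 * (5 * A ^ 3 * \<delta>)"
    using l nz dz dl assms by (intro add_mono mult_mono) auto
  also have "\<dots> = (16 * A ^ 5 + 10 * A ^ 3) * \<delta>" by (simp add: numeral_eq_Suc algebra_simps)
  also have "\<dots> \<le> (26 * A ^ 5) * \<delta>" using pow assms(2) by (intro mult_right_mono) auto
  finally show "norm (corrector m D q - corrector m' D' q') \<le> 26 * A ^ 5 * \<delta>" .
qed

section \<open>Grid sums, ghost values and summation by parts in space\<close>

lemma grid_eq_PiE: "grid N = Pi\<^sub>E UNIV (\<lambda>_. {1..N})"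
  by (auto simp: grid_def PiE_def Pi_def)

lemma finite_grid [simp]: "finite (grid N :: ('d::finite \<Rightarrow> nat) set)"
  by (simp add: grid_eq_PiE finite_PiE)

lemma card_grid: "card (grid N :: ('d::finite \<Rightarrow> nat) set) = N ^ CARD('d)"
  by (simp add: grid_eq_PiE card_PiE)

definition gsum :: "nat \<Rightarrow> (('d::finite \<Rightarrow> nat) \<Rightarrow> real) \<Rightarrow> real" where
  "gsum N f = mesh N ^ CARD('d) * (\<Sum>I\<in>grid N. f I)"

definition interior_faces :: "nat \<Rightarrow> 'd \<Rightarrow> ('d \<Rightarrow> nat) set" where
  "interior_faces N j = {I \<in> grid N. I j < N}"

definition shift :: "'d \<Rightarrow> ('d \<Rightarrow> nat) \<Rightarrow> 'd \<Rightarrow> nat" where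
  "shift j I = I(j := I j + 1)"

definition jump :: "'d \<Rightarrow> 'd grid_fun \<Rightarrow> 'd grid_fun" where
  "jump j f I = f (shift j I) - f I"

text \<open>The discrete Dirichlet form. It runs over interior faces, each indexed by its lower
  cell, and uses differences of genuine grid values only, so that ghost values never occur in the
  energy argument.\<close>

definition gform :: "nat \<Rightarrow> 'd::finite grid_fun \<Rightarrow> 'd grid_fun \<Rightarrow> real" where
  "gform N f g =
     mesh N ^ CARD('d) * (\<Sum>j\<in>UNIV. \<Sum>I\<in>interior_faces N j. jump j f I \<bullet> jump j g I / (mesh N)\<^sup>2)"

lemma finite_interior_faces [simp]: "finite (interior_faces N (j :: 'd::finite))"
  by (simp add: interior_faces_def)

lemma shift_in_grid: "I \<in> interior_faces N j \<Longrightarrow> shift j I \<in> grid N"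
  by (auto simp: interior_faces_def grid_def shift_def)

lemma interior_faces_grid: "I \<in> interior_faces N j \<Longrightarrow> I \<in> grid N"
  by (simp add: interior_faces_def)

lemma mesh_nonneg [simp]: "0 \<le> mesh N"
  by (simp add: mesh_def)

lemma gsum_mono: "(\<And>I. I \<in> grid N \<Longrightarrow> f I \<le> g I) \<Longrightarrow> gsum N f \<le> gsum N g"
  by (simp add: gsum_def mult_left_mono sum_mono)

lemma gsum_add: "gsum N (\<lambda>I. f I + g I) = gsum N f + gsum N g"
  and gsum_diff: "gsum N (\<lambda>I. f I - g I) = gsum N f - gsum N g"
  by (simp_all add: gsum_def sum.distrib sum_subtractf distrib_left right_diff_distrib)

lemma gsum_cmult: "gsum N (\<lambda>I. c * f I) = c * gsum N f"
  by (simp add: gsum_def sum_distrib_left[symmetric] mult.left_commute)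

text \<open>The cells fill the unit cube, which has volume one; hence a pointwise truncation bound
  enters the energy without a further factor.\<close>

lemma gsum_const:
  assumes "0 < N" shows "gsum N (\<lambda>I::'d::finite \<Rightarrow> nat. c) = c"
  using assms by (simp add: gsum_def card_grid mesh_def power_one_over)

lemma gsum_nonneg: "(\<And>I. I \<in> grid N \<Longrightarrow> 0 \<le> f I) \<Longrightarrow> 0 \<le> gsum N f"
  by (simp add: gsum_def sum_nonneg)

lemma grid_index: "I \<in> grid N \<Longrightarrow> 0 < I l \<and> I l \<le> N"
  by (simp add: grid_def Suc_le_eq)

lemma ghost_ext_grid:
  assumes "I \<in> grid N"
  shows "ghost_ext N f I = f I"
proof -
  have "(\<lambda>j. if I j = 0 then 1 else if I j = N + 1 then N else I j) = I"
    using grid_index[OF assms] by (auto simp: fun_eq_iff) (metis Suc_n_not_le_n)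
  then show ?thesis by (simp add: ghost_ext_def)
qed

lemma ghost_ext_upper:
  assumes "I \<in> grid N"
  shows "ghost_ext N f (I(j := I j + 1)) = (if I j < N then f (shift j I) else f I)"
proof (cases "I j < N")
  case True
  then have "shift j I \<in> grid N" using assms by (auto simp: shift_def grid_def)
  then show ?thesis using True by (simp add: ghost_ext_grid shift_def)
next
  case False
  then have "I j = N" using assms by (auto simp: grid_def intro: antisym)
  moreover have "I l \<noteq> 0" "I l \<noteq> N + 1" for l
    using grid_index[OF assms, of l] by auto
  ultimately show ?thesis
    by (auto simp: ghost_ext_def intro!: arg_cong[where f = f])
qed

lemma ghost_ext_lower:
  assumes "I \<in> grid N"
  shows "ghost_ext N f (I(j := I j - 1)) = (if 1 < I j then f (I(j := I j - 1)) else f I)"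
proof (cases "1 < I j")
  case True
  then have "I(j := I j - 1) \<in> grid N" using assms by (auto simp: grid_def intro: diff_le_self[THEN order_trans])
  then show ?thesis using True by (simp add: ghost_ext_grid)
next
  case False
  then have "I j = 1" using assms by (auto simp: grid_def intro: antisym)
  moreover have "I l \<noteq> 0" "I l \<noteq> N + 1" for l
    using grid_index[OF assms, of l] by auto
  ultimately show ?thesis
    by (auto simp: ghost_ext_def intro!: arg_cong[where f = f])
qed

text \<open>Each interior face is seen once from below and once from above; \<open>F\<close> takes
  the cell and its lower neighbour separately so that the summand may involve both sides of the
  face.\<close>

lemma sum_lower_neighbours:
  "(\<Sum>I\<in>{I \<in> grid N. 1 < I j}. F I (I(j := I j - 1))) = (\<Sum>I\<in>interior_faces N j. F (shift j I) I)"
proof (rule sum.reindex_bij_witness[where i = "shift j" and j = "\<lambda>I. I(j := I j - 1)"])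
  fix I assume I: "I \<in> {I \<in> grid N. 1 < I j}"
  then show "shift j (I(j := I j - 1)) = I" by (auto simp: shift_def fun_eq_iff)
  then show "F (shift j (I(j := I j - 1))) (I(j := I j - 1)) = F I (I(j := I j - 1))" by simp
  have "1 \<le> I l \<and> I l \<le> N" for l using I by (auto simp: grid_def)
  then have "I(j := I j - 1) \<in> grid N" using I
    by (auto simp: grid_def intro: diff_le_self[THEN order_trans])
  moreover have "I j - 1 < N" using I \<open>\<And>l. 1 \<le> I l \<and> I l \<le> N\<close>[of j] by auto
  ultimately show "I(j := I j - 1) \<in> interior_faces N j"
    by (auto simp: interior_faces_def)
next
  fix I assume I: "I \<in> interior_faces N j"
  then have "0 < I j" by (auto simp: interior_faces_def grid_def Suc_le_eq)
  then show "shift j I \<in> {I \<in> grid N. 1 < I j}"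
    using shift_in_grid[OF I] by (auto simp: shift_def)
  show "(shift j I)(j := shift j I j - 1) = I" by (auto simp: shift_def)
qed

text \<open>The ghost values make the differences across the boundary vanish. In each direction the
  stencil splits into an upward and a downward difference, and collecting the two contributions to
  every interior face gives the product of the jumps.\<close>

lemma sum_by_parts:
  fixes f g :: "'d::finite grid_fun"
  shows "gsum N (\<lambda>I. f I \<bullet> dlaplacian N g I) = - gform N f g"
proof -
  have dir: "(\<Sum>I\<in>grid N. f I \<bullet> (ghost_ext N g (I(j := I j + 1)) - 2 *\<^sub>R g I + ghost_ext N g (I(j := I j - 1))))
     = - (\<Sum>I\<in>interior_faces N j. jump j f I \<bullet> jump j g I)" for j
  proof -
    have "(\<Sum>I\<in>grid N. f I \<bullet> (ghost_ext N g (I(j := I j + 1)) - 2 *\<^sub>R g I + ghost_ext N g (I(j := I j - 1))))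
      = (\<Sum>I\<in>grid N. (if I j < N then f I \<bullet> (g (shift j I) - g I) else 0)
           + (if 1 < I j then f I \<bullet> (g (I(j := I j - 1)) - g I) else 0))"
    proof (rule sum.cong[OF refl])
      fix I :: "'d \<Rightarrow> nat" assume I: "I \<in> grid N"
      have "a - 2 *\<^sub>R b + c = (a - b) + (c - b)" for a b c :: "real ^ 3" by (simp add: scaleR_2)
      then show "f I \<bullet> (ghost_ext N g (I(j := I j + 1)) - 2 *\<^sub>R g I + ghost_ext N g (I(j := I j - 1)))
        = (if I j < N then f I \<bullet> (g (shift j I) - g I) else 0)
           + (if 1 < I j then f I \<bullet> (g (I(j := I j - 1)) - g I) else 0)"
        unfolding ghost_ext_upper[OF I] ghost_ext_lower[OF I] by (simp only: inner_add_right) simp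
    qed
    also have "\<dots> = (\<Sum>I\<in>interior_faces N j. f I \<bullet> (g (shift j I) - g I))
         + (\<Sum>I\<in>{I \<in> grid N. 1 < I j}. f I \<bullet> (g (I(j := I j - 1)) - g I))"
      unfolding sum.distrib interior_faces_def sum.inter_filter[OF finite_grid] by (rule refl)
    also have "(\<Sum>I\<in>{I \<in> grid N. 1 < I j}. f I \<bullet> (g (I(j := I j - 1)) - g I))
        = (\<Sum>I\<in>interior_faces N j. f (shift j I) \<bullet> (g I - g (shift j I)))"
      by (rule sum_lower_neighbours[of "\<lambda>I I'. f I \<bullet> (g I' - g I)"])
    also have "(\<Sum>I\<in>interior_faces N j. f I \<bullet> (g (shift j I) - g I)) + \<dots>
        = - (\<Sum>I\<in>interior_faces N j. jump j f I \<bullet> jump j g I)"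
      unfolding sum.distrib[symmetric] sum_negf[symmetric]
      by (rule sum.cong) (auto simp: jump_def inner_diff_left inner_diff_right)
    finally show ?thesis .
  qed
  have "f I \<bullet> dlaplacian N g I = (\<Sum>j\<in>UNIV. f I \<bullet> (ghost_ext N g (I(j := I j + 1)) - 2 *\<^sub>R g I
           + ghost_ext N g (I(j := I j - 1))) / (mesh N)\<^sup>2)" for I
    by (simp only: dlaplacian_def inner_sum_right inner_scaleR_right divide_inverse_commute)
  then have "(\<Sum>I\<in>grid N. f I \<bullet> dlaplacian N g I)
     = (\<Sum>I\<in>grid N. \<Sum>j\<in>UNIV. f I \<bullet> (ghost_ext N g (I(j := I j + 1)) - 2 *\<^sub>R g I
           + ghost_ext N g (I(j := I j - 1))) / (mesh N)\<^sup>2)"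
    by (simp only:)
  also have "\<dots> = (\<Sum>j\<in>UNIV. \<Sum>I\<in>grid N. f I \<bullet> (ghost_ext N g (I(j := I j + 1)) - 2 *\<^sub>R g I
           + ghost_ext N g (I(j := I j - 1))) / (mesh N)\<^sup>2)"
    by (rule sum.swap)
  also have "\<dots> = (\<Sum>j\<in>UNIV. - (\<Sum>I\<in>interior_faces N j. jump j f I \<bullet> jump j g I) / (mesh N)\<^sup>2)"
    by (simp only: dir sum_divide_distrib[symmetric])
  also have "\<dots> = - (\<Sum>j\<in>UNIV. \<Sum>I\<in>interior_faces N j. jump j f I \<bullet> jump j g I / (mesh N)\<^sup>2)"
    by (simp only: sum_negf sum_divide_distrib minus_divide_left[symmetric])
  finally show ?thesis by (simp add: gsum_def gform_def)
qed

lemma dnorm_sq: "(dnorm N f)\<^sup>2 = gsum N (\<lambda>I. (norm (f I))\<^sup>2)"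
proof -
  have "0 \<le> gsum N (\<lambda>I. (norm (f I))\<^sup>2)" by (simp add: gsum_nonneg)
  then show ?thesis
    by (simp add: dnorm_def dinner_def gsum_def power2_norm_eq_inner)
qed

lemma dgrad_norm_sq: "(dgrad_norm N f)\<^sup>2 = gform N f f"
proof -
  have "(\<Sum>I\<in>faces N j. (norm (dgrad N f j I))\<^sup>2)
      = (\<Sum>I\<in>interior_faces N j. jump j f I \<bullet> jump j f I / (mesh N)\<^sup>2)" for j
  proof (rule sum.mono_neutral_cong_right)
    have "faces N j \<subseteq> Pi\<^sub>E UNIV (\<lambda>_. {0..N})"
      by (auto simp: faces_def PiE_def Pi_def)
    then show "finite (faces N j)" by (rule finite_subset) (simp add: finite_PiE)
    show "interior_faces N j \<subseteq> faces N j"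
      by (auto simp: faces_def interior_faces_def grid_def)
    have boundary: "dgrad N f j I = 0" if I: "I \<in> faces N j" "I j = 0 \<or> I j = N" for I
    proof (cases "N = 0")
      case False
      with I(2) have "(\<lambda>l. if (I(j := I j + 1)) l = 0 then 1 else if (I(j := I j + 1)) l = N + 1 then N else (I(j := I j + 1)) l)
         = (\<lambda>l. if I l = 0 then 1 else if I l = N + 1 then N else I l)"
        by (auto simp: fun_eq_iff)
      then show ?thesis by (simp only: dgrad_def ghost_ext_def diff_self scaleR_zero_right)
    \<comment> \<open>For \<open>N = 0\<close> the mesh size is \<open>1 / 0 = 0\<close>, and
      dividing by it yields 0 as well.\<close>
    qed (simp add: dgrad_def mesh_def)
    show "\<forall>I\<in>faces N j - interior_faces N j. (norm (dgrad N f j I))\<^sup>2 = 0"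
    proof
      fix I assume I: "I \<in> faces N j - interior_faces N j"
      have "I j = 0 \<or> I j = N"
      proof (rule ccontr)
        assume "\<not> ?thesis"
        then have "1 \<le> I j" "I j < N" using I by (auto simp: faces_def)
        then have "1 \<le> I l \<and> I l \<le> N" for l using I by (cases "l = j") (auto simp: faces_def)
        then show False using I \<open>I j < N\<close> by (auto simp: interior_faces_def grid_def)
      qed
      then show "(norm (dgrad N f j I))\<^sup>2 = 0" using boundary I by simp
    qed
    fix I assume I: "I \<in> interior_faces N j"
    then have "dgrad N f j I = jump j f I /\<^sub>R mesh N"
      using ghost_ext_grid[OF interior_faces_grid[OF I]] ghost_ext_grid[OF shift_in_grid[OF I]]
      by (simp add: dgrad_def jump_def shift_def)
    then show "(norm (dgrad N f j I))\<^sup>2 = jump j f I \<bullet> jump j f I / (mesh N)\<^sup>2"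
      by (simp add: divide_inverse power2_eq_square flip: power2_norm_eq_inner)
  qed
  moreover have "0 \<le> gform N f f"
    by (auto simp: gform_def intro!: mult_nonneg_nonneg sum_nonneg)
  ultimately show ?thesis by (simp add: dgrad_norm_def gform_def)
qed

section \<open>The energy estimate\<close>

abbreviation nsq :: "nat \<Rightarrow> 'd::finite grid_fun \<Rightarrow> real" where
  "nsq N f \<equiv> gsum N (\<lambda>I. (norm (f I))\<^sup>2)"

lemma nsq_nonneg [simp]: "0 \<le> nsq N f"
  by (simp add: gsum_nonneg)

lemma gform_self_nonneg [simp]: "0 \<le> gform N f f"
  by (metis dgrad_norm_sq zero_le_power2)

lemma product_le_mean_square: "x * y \<le> (x\<^sup>2 + y\<^sup>2) / 2" for x y :: real
  using sum_squares_bound[of x y] by simp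

lemma norm_average_sq_le: "(norm ((x + y) /\<^sub>R 2))\<^sup>2 \<le> ((norm x)\<^sup>2 + (norm y)\<^sup>2) / 2"
  for x y :: "'a::real_inner"
proof -
  have "(norm (x + y))\<^sup>2 + (norm (x - y))\<^sup>2 = 2 * (norm x)\<^sup>2 + 2 * (norm y)\<^sup>2"
    by (simp add: power2_norm_eq_inner inner_add_left inner_add_right inner_diff_left inner_diff_right)
  moreover have "0 \<le> (norm (x - y))\<^sup>2" by simp
  ultimately have "(norm (x + y))\<^sup>2 \<le> 2 * (norm x)\<^sup>2 + 2 * (norm y)\<^sup>2" by linarith
  then show ?thesis by (simp add: power_divide)
qed

lemma nsq_average_le: "nsq N (\<lambda>I. (f I + g I) /\<^sub>R 2) \<le> (nsq N f + nsq N g) / 2"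
proof -
  have "nsq N (\<lambda>I. (f I + g I) /\<^sub>R 2) \<le> gsum N (\<lambda>I. (1 / 2) * ((norm (f I))\<^sup>2 + (norm (g I))\<^sup>2))"
    by (rule gsum_mono) (use norm_average_sq_le in \<open>fastforce simp: field_simps\<close>)
  also have "\<dots> = (nsq N f + nsq N g) / 2" by (simp only: gsum_cmult gsum_add)
  finally show ?thesis .
qed

lemma gform_mono_sum:
  assumes "\<And>j I. I \<in> interior_faces N j \<Longrightarrow> F j I \<le> G j I"
  shows "mesh N ^ n * (\<Sum>j\<in>UNIV. \<Sum>I\<in>interior_faces N j. F j I)
       \<le> mesh N ^ n * (\<Sum>j\<in>UNIV. \<Sum>I\<in>interior_faces N j. G j (I :: 'd::finite \<Rightarrow> nat))"
  using assms by (intro mult_left_mono sum_mono) auto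

lemma weighted_double_sum:
  fixes F G :: "'i \<Rightarrow> 'j \<Rightarrow> real"
  shows "c * (\<Sum>j\<in>A. \<Sum>I\<in>S j. u * F j I + v * G j I)
    = u * (c * (\<Sum>j\<in>A. \<Sum>I\<in>S j. F j I)) + v * (c * (\<Sum>j\<in>A. \<Sum>I\<in>S j. G j I))"
proof -
  have "(\<Sum>j\<in>A. \<Sum>I\<in>S j. u * F j I + v * G j I) = u * (\<Sum>j\<in>A. \<Sum>I\<in>S j. F j I) + v * (\<Sum>j\<in>A. \<Sum>I\<in>S j. G j I)"
    by (simp only: sum.distrib sum_distrib_left)
  then show ?thesis by (simp add: algebra_simps)
qed

lemma gform_average_le: "gform N (\<lambda>I. (f I + g I) /\<^sub>R 2) (\<lambda>I. (f I + g I) /\<^sub>R 2) \<le> (gform N f f + gform N g g) / 2"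
proof -
  have "gform N (\<lambda>I. (f I + g I) /\<^sub>R 2) (\<lambda>I. (f I + g I) /\<^sub>R 2)
     \<le> mesh N ^ CARD('a) * (\<Sum>j\<in>UNIV. \<Sum>I\<in>interior_faces N j.
         1 / 2 * (jump j f I \<bullet> jump j f I / (mesh N)\<^sup>2) + 1 / 2 * (jump j g I \<bullet> jump j g I / (mesh N)\<^sup>2))"
    unfolding gform_def
  proof (rule gform_mono_sum)
    fix j and I :: "'a \<Rightarrow> nat"
    have "jump j (\<lambda>I. (f I + g I) /\<^sub>R 2) I = (jump j f I + jump j g I) /\<^sub>R 2"
      by (simp only: jump_def scaleR_diff_right[symmetric] add_diff_add)
    then have "jump j (\<lambda>I. (f I + g I) /\<^sub>R 2) I \<bullet> jump j (\<lambda>I. (f I + g I) /\<^sub>R 2) I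
        \<le> (jump j f I \<bullet> jump j f I + jump j g I \<bullet> jump j g I) / 2"
      using norm_average_sq_le[of "jump j f I" "jump j g I"] by (simp only: power2_norm_eq_inner)
    from divide_right_mono[OF this, of "(mesh N)\<^sup>2"]
    show "jump j (\<lambda>I. (f I + g I) /\<^sub>R 2) I \<bullet> jump j (\<lambda>I. (f I + g I) /\<^sub>R 2) I / (mesh N)\<^sup>2
       \<le> 1 / 2 * (jump j f I \<bullet> jump j f I / (mesh N)\<^sup>2) + 1 / 2 * (jump j g I \<bullet> jump j g I / (mesh N)\<^sup>2)"
      by (simp add: add_divide_distrib)
  qed
  also have "\<dots> = 1 / 2 * gform N f f + 1 / 2 * gform N g g"
    unfolding gform_def by (rule weighted_double_sum)
  finally show ?thesis by (simp add: add_divide_distrib)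
qed

text \<open>Pairing a centred difference with the average of the same two levels gives a difference
  of squares, so the gradient energy telescopes exactly, over a distance of two levels.\<close>

lemma gform_increment:
  assumes "k \<noteq> 0"
  shows "gform N (\<lambda>I. (f I - g I) /\<^sub>R (2 * k)) (\<lambda>I. (f I + g I) /\<^sub>R 2) = (gform N f f - gform N g g) / (4 * k)"
proof -
  have "jump j (\<lambda>I. (f I - g I) /\<^sub>R (2 * k)) I \<bullet> jump j (\<lambda>I. (f I + g I) /\<^sub>R 2) I / (mesh N)\<^sup>2
     = 1 / (4 * k) * (jump j f I \<bullet> jump j f I / (mesh N)\<^sup>2) + - 1 / (4 * k) * (jump j g I \<bullet> jump j g I / (mesh N)\<^sup>2)" for j I
  proof -
    have "(x - y) - (z - w) = (x - z) - (y - w)" for x y z w :: "real ^ 3"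
      by simp
    then have "jump j (\<lambda>I. (f I - g I) /\<^sub>R (2 * k)) I = (jump j f I - jump j g I) /\<^sub>R (2 * k)"
      by (simp only: jump_def scaleR_diff_right[symmetric])
    moreover have "jump j (\<lambda>I. (f I + g I) /\<^sub>R 2) I = (jump j f I + jump j g I) /\<^sub>R 2"
      by (simp only: jump_def scaleR_diff_right[symmetric] add_diff_add)
    moreover have "((x - y) /\<^sub>R (2 * k)) \<bullet> ((x + y) /\<^sub>R 2) = (x \<bullet> x - y \<bullet> y) / (4 * k)" for x y :: "real ^ 3"
    proof -
      have "(x - y) \<bullet> (x + y) = x \<bullet> x - y \<bullet> y"
        using inner_commute[of x y] by (simp add: inner_diff_left inner_add_right)
      then show ?thesis using assms by (simp only: inner_scaleR_left inner_scaleR_right) (simp add: field_simps)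
    qed
    ultimately have "jump j (\<lambda>I. (f I - g I) /\<^sub>R (2 * k)) I \<bullet> jump j (\<lambda>I. (f I + g I) /\<^sub>R 2) I
       = (jump j f I \<bullet> jump j f I - jump j g I \<bullet> jump j g I) / (4 * k)"
      by (simp only:)
    then show ?thesis by (simp add: diff_divide_distrib)
  qed
  then have "gform N (\<lambda>I. (f I - g I) /\<^sub>R (2 * k)) (\<lambda>I. (f I + g I) /\<^sub>R 2)
      = 1 / (4 * k) * gform N f f + - 1 / (4 * k) * gform N g g"
    unfolding gform_def by (simp only: weighted_double_sum)
  then show ?thesis by (simp add: diff_divide_distrib)
qed

lemma sum_interior_faces_le:
  assumes "\<And>I. 0 \<le> F I"
  shows "mesh N ^ CARD('d) * (\<Sum>j\<in>UNIV. \<Sum>I\<in>interior_faces N j. F I) \<le> real CARD('d) * gsum N (F :: ('d::finite \<Rightarrow> nat) \<Rightarrow> real)"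
proof -
  have "(\<Sum>j\<in>UNIV. \<Sum>I\<in>interior_faces N j. F I) \<le> (\<Sum>j\<in>(UNIV::'d set). \<Sum>I\<in>grid N. F I)"
    using assms by (intro sum_mono sum_mono2) (auto simp: interior_faces_def)
  then have "(\<Sum>j\<in>UNIV. \<Sum>I\<in>interior_faces N j. F I) \<le> real CARD('d) * (\<Sum>I\<in>grid N. F I)"
    by simp
  from mult_left_mono[OF this, of "mesh N ^ CARD('d)"] show ?thesis
    by (simp add: gsum_def mult.left_commute)
qed

text \<open>In the product rule for the jump of \<open>p x e\<close>, the term with undifferenced
  \<open>p\<close> is a cross product with the jump of \<open>e\<close> and hence orthogonal to it.
  Only the Lipschitz constant of \<open>p\<close> remains.\<close>

lemma gform_cross_le:
  fixes e p :: "'d::finite grid_fun"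
  assumes "0 < N" "0 \<le> P"
    and lip: "\<And>j I. I \<in> interior_faces N j \<Longrightarrow> norm (jump j p I) \<le> P * mesh N"
  shows "- gform N (\<lambda>I. cross3 (p I) (e I)) e \<le> P / 2 * (real CARD('d) * nsq N e + gform N e e)"
proof -
  have h: "0 < mesh N" using assms by (simp add: mesh_def)
  have "- gform N (\<lambda>I. cross3 (p I) (e I)) e = mesh N ^ CARD('d) * (\<Sum>j\<in>UNIV. \<Sum>I\<in>interior_faces N j.
          - (jump j (\<lambda>I. cross3 (p I) (e I)) I \<bullet> jump j e I / (mesh N)\<^sup>2))"
    by (simp only: gform_def sum_negf mult_minus_right)
  also have "\<dots> \<le> mesh N ^ CARD('d) * (\<Sum>j\<in>UNIV. \<Sum>I\<in>interior_faces N j.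
      P / 2 * (norm (e I))\<^sup>2 + P / 2 * (jump j e I \<bullet> jump j e I / (mesh N)\<^sup>2))"
  proof (rule gform_mono_sum)
    fix j :: 'd and I assume I: "I \<in> interior_faces N j"
    have "jump j (\<lambda>I. cross3 (p I) (e I)) I = cross3 (p (shift j I)) (jump j e I) + cross3 (jump j p I) (e I)"
      by (simp add: jump_def Cross3.left_diff_distrib Cross3.right_diff_distrib)
    then have "- (jump j (\<lambda>I. cross3 (p I) (e I)) I \<bullet> jump j e I) = - (cross3 (jump j p I) (e I) \<bullet> jump j e I)"
      by (simp add: inner_add_left dot_cross_self)
    also have "\<dots> \<le> norm (cross3 (jump j p I) (e I)) * norm (jump j e I)"
      using Cauchy_Schwarz_ineq2[of "cross3 (jump j p I) (e I)" "jump j e I"] by linarith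
    also have "\<dots> \<le> (P * mesh N * norm (e I)) * norm (jump j e I)"
      by (intro mult_right_mono order_trans[OF norm_cross3_le] lip I) auto
    finally have "- (jump j (\<lambda>I. cross3 (p I) (e I)) I \<bullet> jump j e I) / (mesh N)\<^sup>2
       \<le> (P * mesh N * norm (e I)) * norm (jump j e I) / (mesh N)\<^sup>2"
      by (rule divide_right_mono) simp
    also have "\<dots> = P * (norm (e I) * (norm (jump j e I) / mesh N))"
      using h by (simp add: power2_eq_square)
    also have "\<dots> \<le> P * (((norm (e I))\<^sup>2 + (norm (jump j e I) / mesh N)\<^sup>2) / 2)"
    proof (rule mult_left_mono)
      show "norm (e I) * (norm (jump j e I) / mesh N) \<le> ((norm (e I))\<^sup>2 + (norm (jump j e I) / mesh N)\<^sup>2) / 2"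
        by (rule product_le_mean_square)
    qed (rule assms)
    finally show "- (jump j (\<lambda>I. cross3 (p I) (e I)) I \<bullet> jump j e I / (mesh N)\<^sup>2)
        \<le> P / 2 * (norm (e I))\<^sup>2 + P / 2 * (jump j e I \<bullet> jump j e I / (mesh N)\<^sup>2)"
      by (simp add: power_divide power2_norm_eq_inner distrib_left add_divide_distrib)
  qed
  also have "\<dots> = P / 2 * (mesh N ^ CARD('d) * (\<Sum>j\<in>UNIV. \<Sum>I\<in>interior_faces N j. (norm (e I))\<^sup>2) + gform N e e)"
    unfolding gform_def distrib_left[of "P / 2"] by (rule weighted_double_sum)
  also have "\<dots> \<le> P / 2 * (real CARD('d) * nsq N e + gform N e e)"
    using assms(2) by (intro mult_left_mono add_right_mono sum_interior_faces_le) auto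
  finally show ?thesis .
qed

text \<open>Here \<open>a\<close>, \<open>c\<close>, \<open>b\<close> are the errors at the times \<open>n + 1\<close>, \<open>n\<close>, \<open>n - 1\<close>. The key
  cancellation is \<open>(a + b) \<times> (a - 2 c + b) = 2 (c \<times> (a - c) - b \<times> (c - b))\<close>, which makes the
  second time difference telescope.\<close>

lemma energy_step:
  fixes a b c p p' s q :: "'d::finite grid_fun" and \<alpha> \<tau> k P \<epsilon> :: real and N :: nat
  defines "av \<equiv> \<lambda>I. (a I + b I) /\<^sub>R 2"
    and "D1 \<equiv> \<lambda>I. (a I - b I) /\<^sub>R (2 * k)"
    and "V \<equiv> \<lambda>I. (a I - c I) /\<^sub>R k"
    and "U \<equiv> \<lambda>I. (c I - b I) /\<^sub>R k"
  defines "w \<equiv> \<lambda>I. dlaplacian N av I - \<alpha> *\<^sub>R D1 I - (\<alpha> * \<tau>) *\<^sub>R ((a I - 2 *\<^sub>R c I + b I) /\<^sub>R k\<^sup>2)"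
  assumes pos: "0 < \<alpha>" "0 < \<tau>" "0 \<le> P" "0 < k" "0 < N" "0 \<le> \<epsilon>"
    and ident: "\<And>I. I \<in> grid N \<Longrightarrow>
      - (D1 I \<bullet> w I) = s I \<bullet> D1 I - s I \<bullet> cross3 (av I) (q I) + p I \<bullet> cross3 (av I) (w I)"
    and bnds: "\<And>I. I \<in> grid N \<Longrightarrow> norm (p I) \<le> P \<and> norm (q I) \<le> P \<and> norm (s I) \<le> P * \<epsilon>"
    and lip: "\<And>j I. I \<in> interior_faces N j \<Longrightarrow> norm (jump j p I) \<le> P * mesh N"
    and tlip: "\<And>I. I \<in> grid N \<Longrightarrow> norm (p I - p' I) \<le> P * k"
  shows "\<alpha> * \<tau> / 2 * (nsq N V - nsq N U)
      + \<alpha> * \<tau> * (gsum N (\<lambda>I. p I \<bullet> cross3 (c I) (V I)) - gsum N (\<lambda>I. p' I \<bullet> cross3 (b I) (U I)))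
      + (gform N a a - gform N b b) / 4
    \<le> k * ((P + P\<^sup>2 + \<alpha> * P) * (\<epsilon>\<^sup>2 + nsq N av + nsq N D1) + P / 2 * (real CARD('d) * nsq N av + gform N av av)
          + \<alpha> * \<tau> * P * (nsq N b + nsq N U))"
proof -
  let ?J = "\<lambda>I. cross3 (c I) (V I)"
  let ?J' = "\<lambda>I. cross3 (b I) (U I)"
  let ?K = "P + P\<^sup>2 + \<alpha> * P"
  \<comment> \<open>The two terms with the discrete Laplacian cannot be estimated pointwise; they
    wait on the left until the sum over the grid allows summation by parts.\<close>
  have key: "\<alpha> * \<tau> / (2 * k) * ((norm (V I))\<^sup>2 - (norm (U I))\<^sup>2)
       + \<alpha> * \<tau> / k * (p I \<bullet> ?J I - p' I \<bullet> ?J' I)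
       - D1 I \<bullet> dlaplacian N av I - cross3 (p I) (av I) \<bullet> dlaplacian N av I
     \<le> ?K * (\<epsilon>\<^sup>2 + (norm (av I))\<^sup>2 + (norm (D1 I))\<^sup>2) + \<alpha> * \<tau> * P * ((norm (b I))\<^sup>2 + (norm (U I))\<^sup>2)"
    if I: "I \<in> grid N" for I
  proof -
    let ?D2 = "(a I - 2 *\<^sub>R c I + b I) /\<^sub>R k\<^sup>2"
    let ?L = "dlaplacian N av I"
    have VU: "V I + U I = (a I - b I) /\<^sub>R k" "V I - U I = (a I - 2 *\<^sub>R c I + b I) /\<^sub>R k"
    proof -
      have "x - 2 *\<^sub>R y + z = (x - y) - (y - z)" for x y z :: "real ^ 3" by (simp add: scaleR_2)
      note 2 = this[of "a I" "c I" "b I"]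
      show "V I + U I = (a I - b I) /\<^sub>R k" by (simp add: V_def U_def scaleR_diff_right)
      show "V I - U I = (a I - 2 *\<^sub>R c I + b I) /\<^sub>R k" by (simp only: V_def U_def 2 scaleR_diff_right)
    qed
    have D1: "D1 I = (1/2) *\<^sub>R (V I + U I)"
      by (simp only: VU D1_def) simp
    have D2: "?D2 = (1 / k) *\<^sub>R (V I - U I)"
      by (simp only: VU) (simp add: power2_eq_square inverse_eq_divide)
    \<comment> \<open>The centred difference is the mean of the successive velocities
      \<open>U\<close> and \<open>V\<close>, and the second difference is their increment divided by
      \<open>k\<close>; their product is again a difference of squares.\<close>
    have "(V I + U I) \<bullet> (V I - U I) = (norm (V I))\<^sup>2 - (norm (U I))\<^sup>2"
      using inner_commute[of "U I" "V I"] by (simp add: power2_norm_eq_inner inner_add_left inner_diff_right)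
    then have d12: "D1 I \<bullet> ?D2 = ((norm (V I))\<^sup>2 - (norm (U I))\<^sup>2) / (2 * k)"
      unfolding D1 D2 by simp
    have V: "V I = (1 / k) *\<^sub>R (a I - c I)" and U: "U I = (1 / k) *\<^sub>R (c I - b I)"
      by (simp_all add: V_def U_def inverse_eq_divide)
    have J: "cross3 (av I) ?D2 = (1 / k) *\<^sub>R (?J I - ?J' I)"
    proof -
      have "cross3 (a I + b I) (a I - 2 *\<^sub>R c I + b I) = 2 *\<^sub>R (cross3 (c I) (a I - c I) - cross3 (b I) (c I - b I))"
        by (simp add: cross3_def vec_eq_iff vector_def forall_3 algebra_simps)
      then have "cross3 (av I) ?D2 = (1 / k\<^sup>2) *\<^sub>R (cross3 (c I) (a I - c I) - cross3 (b I) (c I - b I))"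
        by (simp add: av_def cross_mult_left cross_mult_right inverse_eq_divide)
      then show ?thesis
        unfolding V U cross_mult_right scaleR_diff_right[symmetric]
        by (simp add: power2_eq_square)
    qed
    have m1: "- (D1 I \<bullet> ?L) + \<alpha> * (norm (D1 I))\<^sup>2 + \<alpha> * \<tau> * (D1 I \<bullet> ?D2)
       = s I \<bullet> D1 I - s I \<bullet> cross3 (av I) (q I)
         + cross3 (p I) (av I) \<bullet> ?L - \<alpha> * (p I \<bullet> cross3 (av I) (D1 I)) - \<alpha> * \<tau> * (p I \<bullet> cross3 (av I) ?D2)"
    proof -
      have t: "p I \<bullet> cross3 (av I) ?L = cross3 (p I) (av I) \<bullet> ?L"
        by (simp add: cross3_simps)
      have "p I \<bullet> cross3 (av I) (w I) = cross3 (p I) (av I) \<bullet> ?L - \<alpha> * (p I \<bullet> cross3 (av I) (D1 I))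
          - \<alpha> * \<tau> * (p I \<bullet> cross3 (av I) ?D2)"
        unfolding w_def Cross3.right_diff_distrib cross_mult_right inner_diff_right inner_scaleR_right t ..
      moreover have "D1 I \<bullet> w I = D1 I \<bullet> ?L - \<alpha> * (norm (D1 I))\<^sup>2 - \<alpha> * \<tau> * (D1 I \<bullet> ?D2)"
        unfolding w_def inner_diff_right inner_scaleR_right power2_norm_eq_inner ..
      ultimately show ?thesis using ident[OF I] by linarith
    qed
    \<comment> \<open>Summation by parts in time: the older term has to carry the older weight
      \<open>p'\<close> in order to telescope. The price is \<open>p - p'\<close>, whose order
      \<open>k\<close> compensates the division by \<open>k\<close>.\<close>
    have m2: "p I \<bullet> cross3 (av I) ?D2 = (p I \<bullet> ?J I - p' I \<bullet> ?J' I) / k - ((p I - p' I) \<bullet> ?J' I) / k"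
      unfolding J inner_scaleR_right inner_diff_left inner_diff_right by (simp add: diff_divide_distrib)
    have eq: "\<alpha> * \<tau> / (2 * k) * ((norm (V I))\<^sup>2 - (norm (U I))\<^sup>2)
       + \<alpha> * \<tau> / k * (p I \<bullet> ?J I - p' I \<bullet> ?J' I) - D1 I \<bullet> ?L - cross3 (p I) (av I) \<bullet> ?L
      = s I \<bullet> D1 I - s I \<bullet> cross3 (av I) (q I) - \<alpha> * (p I \<bullet> cross3 (av I) (D1 I))
        - \<alpha> * (norm (D1 I))\<^sup>2 + \<alpha> * \<tau> * (((p I - p' I) \<bullet> ?J' I) / k)"
    proof -
      have "\<alpha> * \<tau> * ((p I \<bullet> ?J I - p' I \<bullet> ?J' I) / k - ((p I - p' I) \<bullet> ?J' I) / k)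
        = \<alpha> * \<tau> / k * (p I \<bullet> ?J I - p' I \<bullet> ?J' I) - \<alpha> * \<tau> * (((p I - p' I) \<bullet> ?J' I) / k)"
        by (simp add: right_diff_distrib diff_divide_distrib)
      moreover have "\<alpha> * \<tau> * (D1 I \<bullet> ?D2) = \<alpha> * \<tau> / (2 * k) * ((norm (V I))\<^sup>2 - (norm (U I))\<^sup>2)"
        unfolding d12 by simp
      ultimately show ?thesis using m1 unfolding m2 by linarith
    qed
    note b = bnds[OF I]
    have e1: "s I \<bullet> D1 I \<le> P * (\<epsilon>\<^sup>2 + (norm (D1 I))\<^sup>2) / 2"
    proof -
      have "s I \<bullet> D1 I \<le> P * \<epsilon> * norm (D1 I)"
        using b by (meson mult_right_mono norm_cauchy_schwarz norm_ge_zero order_trans)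
      also have "\<dots> = P * (\<epsilon> * norm (D1 I))" by simp
      also have "\<dots> \<le> P * ((\<epsilon>\<^sup>2 + (norm (D1 I))\<^sup>2) / 2)"
        using pos sum_squares_bound[of \<epsilon> "norm (D1 I)"] by (intro mult_left_mono) auto
      finally show ?thesis by simp
    qed
    have e2: "- (s I \<bullet> cross3 (av I) (q I)) \<le> P\<^sup>2 * (\<epsilon>\<^sup>2 + (norm (av I))\<^sup>2) / 2"
    proof -
      have "- (s I \<bullet> cross3 (av I) (q I)) \<le> norm (s I) * norm (cross3 (av I) (q I))"
        using Cauchy_Schwarz_ineq2[of "s I" "cross3 (av I) (q I)"] by linarith
      also have "\<dots> \<le> (P * \<epsilon>) * (norm (av I) * P)"
        using b pos by (intro mult_mono order_trans[OF norm_cross3_le]) auto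
      also have "\<dots> = P\<^sup>2 * (\<epsilon> * norm (av I))" by (simp add: power2_eq_square)
      also have "\<dots> \<le> P\<^sup>2 * ((\<epsilon>\<^sup>2 + (norm (av I))\<^sup>2) / 2)"
        using pos sum_squares_bound[of \<epsilon> "norm (av I)"] by (intro mult_left_mono) auto
      finally show ?thesis by simp
    qed
    have tr: "\<bar>x \<bullet> cross3 y z\<bar> \<le> R * ((norm y)\<^sup>2 + (norm z)\<^sup>2) / 2" if "norm x \<le> R" for x y z :: "real ^ 3" and R
    proof -
      have "norm x * ((norm y)\<^sup>2 + (norm z)\<^sup>2) / 2 \<le> R * ((norm y)\<^sup>2 + (norm z)\<^sup>2) / 2"
        using that by (intro divide_right_mono mult_right_mono) auto
      then show ?thesis using triple_le[of x y z] by linarith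
    qed
    have e3: "- \<alpha> * (p I \<bullet> cross3 (av I) (D1 I)) \<le> \<alpha> * (P * ((norm (av I))\<^sup>2 + (norm (D1 I))\<^sup>2) / 2)"
    proof -
      have "- (p I \<bullet> cross3 (av I) (D1 I)) \<le> P * ((norm (av I))\<^sup>2 + (norm (D1 I))\<^sup>2) / 2"
        using tr[of "p I" P "av I" "D1 I"] b by linarith
      from mult_left_mono[OF this, of \<alpha>] show ?thesis using pos by simp
    qed
    have e4: "\<alpha> * \<tau> * (((p I - p' I) \<bullet> ?J' I) / k) \<le> \<alpha> * \<tau> * (P * ((norm (b I))\<^sup>2 + (norm (U I))\<^sup>2) / 2)"
    proof (intro mult_left_mono)
      have "(p I - p' I) \<bullet> ?J' I \<le> P * k * ((norm (b I))\<^sup>2 + (norm (U I))\<^sup>2) / 2"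
        using tr[OF tlip[OF I], of "b I" "U I"] by linarith
      then show "((p I - p' I) \<bullet> ?J' I) / k \<le> P * ((norm (b I))\<^sup>2 + (norm (U I))\<^sup>2) / 2"
        using pos by (simp add: field_simps)
    qed (use pos in auto)
    \<comment> \<open>The damping term stands on the right with a favourable sign and is
      discarded.\<close>
    have "0 \<le> \<alpha> * (norm (D1 I))\<^sup>2" using pos by simp
    moreover have "P * (\<epsilon>\<^sup>2 + (norm (D1 I))\<^sup>2) / 2 + P\<^sup>2 * (\<epsilon>\<^sup>2 + (norm (av I))\<^sup>2) / 2
        + \<alpha> * (P * ((norm (av I))\<^sup>2 + (norm (D1 I))\<^sup>2) / 2) \<le> ?K * (\<epsilon>\<^sup>2 + (norm (av I))\<^sup>2 + (norm (D1 I))\<^sup>2)"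
    proof -
      have "P * (\<epsilon>\<^sup>2 + (norm (D1 I))\<^sup>2) / 2 \<le> P * (\<epsilon>\<^sup>2 + (norm (av I))\<^sup>2 + (norm (D1 I))\<^sup>2)"
        "P\<^sup>2 * (\<epsilon>\<^sup>2 + (norm (av I))\<^sup>2) / 2 \<le> P\<^sup>2 * (\<epsilon>\<^sup>2 + (norm (av I))\<^sup>2 + (norm (D1 I))\<^sup>2)"
        "(\<alpha> * P) * ((norm (av I))\<^sup>2 + (norm (D1 I))\<^sup>2) / 2 \<le> (\<alpha> * P) * (\<epsilon>\<^sup>2 + (norm (av I))\<^sup>2 + (norm (D1 I))\<^sup>2)"
        unfolding times_divide_eq_right[symmetric]
        using zero_le_power2[of \<epsilon>] zero_le_power2[of "norm (av I)"] zero_le_power2[of "norm (D1 I)"] pos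
        by (intro mult_left_mono; simp)+
      then show ?thesis by (simp add: distrib_right)
    qed
    moreover have "\<alpha> * \<tau> * (P * ((norm (b I))\<^sup>2 + (norm (U I))\<^sup>2) / 2) \<le> \<alpha> * \<tau> * P * ((norm (b I))\<^sup>2 + (norm (U I))\<^sup>2)"
      unfolding mult.assoc using pos by (intro mult_left_mono) auto
    ultimately show ?thesis using eq e1 e2 e3 e4 by linarith
  qed
  have "gsum N (\<lambda>I. \<alpha> * \<tau> / (2 * k) * ((norm (V I))\<^sup>2 - (norm (U I))\<^sup>2)
       + \<alpha> * \<tau> / k * (p I \<bullet> ?J I - p' I \<bullet> ?J' I)
       - D1 I \<bullet> dlaplacian N av I - cross3 (p I) (av I) \<bullet> dlaplacian N av I)
     \<le> gsum N (\<lambda>I. ?K * (\<epsilon>\<^sup>2 + (norm (av I))\<^sup>2 + (norm (D1 I))\<^sup>2) + \<alpha> * \<tau> * P * ((norm (b I))\<^sup>2 + (norm (U I))\<^sup>2))"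
    by (rule gsum_mono) (rule key)
  then have "\<alpha> * \<tau> / (2 * k) * (nsq N V - nsq N U)
       + \<alpha> * \<tau> / k * (gsum N (\<lambda>I. p I \<bullet> ?J I) - gsum N (\<lambda>I. p' I \<bullet> ?J' I))
       + gform N D1 av + gform N (\<lambda>I. cross3 (p I) (av I)) av
     \<le> ?K * (\<epsilon>\<^sup>2 + nsq N av + nsq N D1) + \<alpha> * \<tau> * P * (nsq N b + nsq N U)"
    by (simp only: gsum_add gsum_diff gsum_cmult gsum_const[OF pos(5)] sum_by_parts minus_diff_eq diff_minus_eq_add)
  moreover have "- gform N (\<lambda>I. cross3 (p I) (av I)) av \<le> P / 2 * (real CARD('d) * nsq N av + gform N av av)"
    by (rule gform_cross_le) (use pos lip in auto)
  moreover have "gform N D1 av = (gform N a a - gform N b b) / (4 * k)"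
    unfolding D1_def av_def by (rule gform_increment) (use pos in auto)
  ultimately have "\<alpha> * \<tau> / (2 * k) * (nsq N V - nsq N U)
       + \<alpha> * \<tau> / k * (gsum N (\<lambda>I. p I \<bullet> ?J I) - gsum N (\<lambda>I. p' I \<bullet> ?J' I))
       + (gform N a a - gform N b b) / (4 * k)
     \<le> ?K * (\<epsilon>\<^sup>2 + nsq N av + nsq N D1) + P / 2 * (real CARD('d) * nsq N av + gform N av av)
        + \<alpha> * \<tau> * P * (nsq N b + nsq N U)" (is "?l \<le> ?r") by linarith
  then have "k * ?l \<le> k * ?r" using pos by (intro mult_left_mono) auto
  moreover have "k * ?l = \<alpha> * \<tau> / 2 * (nsq N V - nsq N U)
      + \<alpha> * \<tau> * (gsum N (\<lambda>I. p I \<bullet> ?J I) - gsum N (\<lambda>I. p' I \<bullet> ?J' I))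
      + (gform N a a - gform N b b) / 4"
  proof -
    have "k * (\<alpha> * \<tau> / (2 * k) * X + \<alpha> * \<tau> / k * Y + Z / (4 * k)) = \<alpha> * \<tau> / 2 * X + \<alpha> * \<tau> * Y + Z / 4" for X Y Z
      using pos by (simp add: field_simps)
    then show ?thesis .
  qed
  ultimately show ?thesis by linarith
qed

text \<open>The new value occurs on both sides, so \<open>1 - z\<close> has to be divided out; for
  \<open>z \<le> 1 / 2\<close> one has \<open>1 + z \<le> (1 - z) * (1 + 4 * z)\<close>, which gives
  an amplification of at most \<open>1 + 4 * z\<close> per step.\<close>

lemma discrete_gronwall:
  fixes y :: "nat \<Rightarrow> real"
  assumes "0 \<le> z" "z \<le> 1 / 2" and nonneg: "\<And>n. 0 \<le> y n"
    and step: "\<And>n. 2 \<le> n \<Longrightarrow> n \<le> m \<Longrightarrow> y n \<le> y (n - 1) + z * (y n + y (n - 1))"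
    and "1 \<le> m"
  shows "y m \<le> exp (4 * z * real m) * y 1"
proof -
  have one: "y n \<le> (1 + 4 * z) * y (n - 1)" if "2 \<le> n" "n \<le> m" for n
  proof -
    have "(1 - z) * y n \<le> (1 + z) * y (n - 1)" using step[OF that] by (simp add: algebra_simps)
    also have "\<dots> \<le> ((1 - z) * (1 + 4 * z)) * y (n - 1)"
    proof (rule mult_right_mono)
      have "z * (2 * z) \<le> z * 1" using assms by (intro mult_left_mono) auto
      then show "1 + z \<le> (1 - z) * (1 + 4 * z)" by (simp add: algebra_simps)
    qed (rule nonneg)
    finally have "(1 - z) * y n \<le> (1 - z) * ((1 + 4 * z) * y (n - 1))" by (simp only: mult.assoc)
    then show ?thesis using assms by simp
  qed
  have "y n \<le> (1 + 4 * z) ^ n * y 1" if "1 \<le> n" "n \<le> m" for n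
    using that
  proof (induction n rule: dec_induct)
    case base
    have "1 * y 1 \<le> (1 + 4 * z) * y 1" using assms nonneg[of 1] by (intro mult_right_mono) auto
    then show ?case by simp
  next
    case (step n)
    have "y (Suc n) \<le> (1 + 4 * z) * y n" using one[of "Suc n"] step by auto
    also have "\<dots> \<le> (1 + 4 * z) * ((1 + 4 * z) ^ n * y 1)"
      using step assms by (intro mult_left_mono) auto
    finally show ?case by simp
  qed
  from this[of m] have "y m \<le> (1 + 4 * z) ^ m * y 1" using assms by simp
  also have "\<dots> \<le> exp (4 * z) ^ m * y 1"
    using assms nonneg[of 1] exp_ge_add_one_self[of "4 * z"] by (intro mult_right_mono power_mono) auto
  finally show ?thesis by (simp add: exp_of_nat_mult[symmetric] mult_ac)
qed

section \<open>Stability of the error equation\<close>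

definition avg :: "(nat \<Rightarrow> 'd grid_fun) \<Rightarrow> nat \<Rightarrow> 'd grid_fun" where
  "avg m n = (\<lambda>I. (m (n + 1) I + m (n - 1) I) /\<^sub>R 2)"

definition diff1 :: "real \<Rightarrow> (nat \<Rightarrow> 'd grid_fun) \<Rightarrow> nat \<Rightarrow> 'd grid_fun" where
  "diff1 k m n = (\<lambda>I. (m (n + 1) I - m (n - 1) I) /\<^sub>R (2 * k))"

definition diff2 :: "real \<Rightarrow> (nat \<Rightarrow> 'd grid_fun) \<Rightarrow> nat \<Rightarrow> 'd grid_fun" where
  "diff2 k m n = (\<lambda>I. (m (n + 1) I - 2 *\<^sub>R m n I + m (n - 1) I) /\<^sub>R k\<^sup>2)"

text \<open>The effective field, including damping and inertia: the scheme says that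
  \<open>diff1\<close> is the cross product of \<open>avg\<close> with it. Evaluated on the error it
  is \<open>- w\<close> in the notation of the overview.\<close>

definition field :: "real \<Rightarrow> real \<Rightarrow> nat \<Rightarrow> real \<Rightarrow> (nat \<Rightarrow> 'd grid_fun) \<Rightarrow> nat \<Rightarrow> 'd grid_fun" where
  "field \<alpha> \<tau> N k m n = (\<lambda>I. \<alpha> *\<^sub>R (diff1 k m n I + \<tau> *\<^sub>R diff2 k m n I) - dlaplacian N (avg m n) I)"

text \<open>\<open>Y\<close> is the quantity that telescopes and \<open>A\<close> the one that
  measures the error; the coercivity \<open>c0 * A \<le> Y\<close> lets the Gronwall argument run on
  \<open>Y\<close>. Since \<open>p\<close>, \<open>s\<close> and \<open>q\<close> enter only through
  their bounds, all constants are fixed before mesh, time step and error.\<close>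

lemma energy_stability:
  fixes \<alpha> \<tau> T P B :: real
  assumes pos: "0 < \<alpha>" "0 < \<tau>" "0 < T" "0 \<le> P" "0 \<le> B"
  obtains C k0 where "0 < C" "0 < k0"
    "\<And>N k (e :: nat \<Rightarrow> 'd::finite grid_fun) p s q n.
      \<lbrakk>0 < N; 0 < k; k < k0;
       \<And>n I. \<lbrakk>2 \<le> n; real (n + 1) * k \<le> T; I \<in> grid N\<rbrakk> \<Longrightarrow>
         diff1 k e n I \<bullet> field \<alpha> \<tau> N k e n I = s n I \<bullet> diff1 k e n I - s n I \<bullet> cross3 (avg e n I) (q n I)
           - p n I \<bullet> cross3 (avg e n I) (field \<alpha> \<tau> N k e n I);
       \<And>n I. \<lbrakk>1 \<le> n; real (n + 1) * k \<le> T; I \<in> grid N\<rbrakk> \<Longrightarrow>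
         norm (p n I) \<le> P \<and> norm (q n I) \<le> P \<and> norm (s n I) \<le> P * (k\<^sup>2 + (mesh N)\<^sup>2);
       \<And>n j I. \<lbrakk>1 \<le> n; real (n + 1) * k \<le> T; I \<in> interior_faces N j\<rbrakk> \<Longrightarrow>
         norm (jump j (p n) I) \<le> P * mesh N;
       \<And>n I. \<lbrakk>2 \<le> n; real (n + 1) * k \<le> T; I \<in> grid N\<rbrakk> \<Longrightarrow> norm (p n I - p (n - 1) I) \<le> P * k;
       dnorm N (e 1) + dgrad_norm N (e 1) \<le> B * (k\<^sup>2 + (mesh N)\<^sup>2);
       dnorm N (e 2) + dgrad_norm N (e 2) \<le> B * (k\<^sup>2 + (mesh N)\<^sup>2);
       dnorm N (\<lambda>I. (e 2 I - e 1 I) /\<^sub>R k) \<le> B * (k\<^sup>2 + (mesh N)\<^sup>2);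
       2 \<le> n; real n * k \<le> T\<rbrakk>
      \<Longrightarrow> dnorm N (e n) + dgrad_norm N (e n) \<le> C * (k\<^sup>2 + (mesh N)\<^sup>2)"
proof -
  \<comment> \<open>By Young's inequality the indefinite term costs a quarter of the squared
    velocity and \<open>P\<^sup>2\<close> times the squared error. \<open>K\<close> pays for the
    latter with 1 to spare, and \<open>c0\<close> is the coercivity left over.\<close>
  define K where "K = \<alpha> * \<tau> * P\<^sup>2 + 1"
  define c0 where "c0 = min (\<alpha> * \<tau> / 4) (1 / 4)"
  define d where "d = real CARD('d)"
  \<comment> \<open>Every term on the right of the energy step is at most a multiple of one common
    bound \<open>S\<close>; \<open>C1\<close> adds up these multiples, with \<open>4 * K\<close> for
    the growth of the squared error. \<open>C2\<close> dominates both \<open>C1\<close> and the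
    factor \<open>C1 / c0\<close> of passing from \<open>A\<close> to \<open>Y\<close>.\<close>
  define C1 where "C1 = 3 * (P + P\<^sup>2 + \<alpha> * P) + P * (d + 1) + \<alpha> * \<tau> * P + 4 * K"
  define C2 where "C2 = C1 / c0 + C1"
  define C3 where "C3 = \<alpha> * \<tau> + \<alpha> * \<tau> * P + 1 + K"
  define C4 where "C4 = exp (4 * C2 * T) * (5 * C3 * B\<^sup>2 + 1) / c0"
  \<comment> \<open>\<open>C4 + 1\<close> dominates the square root of \<open>C4\<close>, and the
    factor 2 accounts for the two norms. The choice of \<open>k0\<close> makes
    \<open>k * C2 \<le> 1 / 2\<close>, as the Gronwall argument requires.\<close>
  define C where "C = 2 * (C4 + 1)"
  define k0 where "k0 = 1 / (2 * C2)"
  have K: "1 \<le> K" using pos by (simp add: K_def)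
  have c0: "0 < c0" "c0 \<le> \<alpha> * \<tau> / 4" "c0 \<le> 1 / 4" using pos by (auto simp: c0_def)
  have d: "0 \<le> d" by (simp add: d_def)
  have "0 \<le> P + P\<^sup>2 + \<alpha> * P" "0 \<le> P * (d + 1)" "0 \<le> \<alpha> * \<tau> * P" using pos d by auto
  then have C1: "0 < C1" using K by (simp add: C1_def)
  then have C2: "0 < C2" using c0 by (simp add: C2_def add_pos_pos)
  have C3: "0 \<le> C3" using pos K by (simp add: C3_def)
  have C4: "0 \<le> C4" using c0 C3 by (simp add: C4_def)
  show ?thesis
  proof (rule that[of C k0])
    show "0 < C" "0 < k0" using C4 C2 by (auto simp: C_def k0_def)
    fix N k n and e p s q :: "nat \<Rightarrow> 'd grid_fun"
    assume N: "0 < N" and k: "0 < k" "k < k0"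
      and ident: "\<And>n I. \<lbrakk>2 \<le> n; real (n + 1) * k \<le> T; I \<in> grid N\<rbrakk> \<Longrightarrow>
         diff1 k e n I \<bullet> field \<alpha> \<tau> N k e n I = s n I \<bullet> diff1 k e n I - s n I \<bullet> cross3 (avg e n I) (q n I)
           - p n I \<bullet> cross3 (avg e n I) (field \<alpha> \<tau> N k e n I)"
      and bnds: "\<And>n I. \<lbrakk>1 \<le> n; real (n + 1) * k \<le> T; I \<in> grid N\<rbrakk> \<Longrightarrow>
         norm (p n I) \<le> P \<and> norm (q n I) \<le> P \<and> norm (s n I) \<le> P * (k\<^sup>2 + (mesh N)\<^sup>2)"
      and lip: "\<And>n j I. \<lbrakk>1 \<le> n; real (n + 1) * k \<le> T; I \<in> interior_faces N j\<rbrakk> \<Longrightarrow>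
         norm (jump j (p n) I) \<le> P * mesh N"
      and tlip: "\<And>n I. \<lbrakk>2 \<le> n; real (n + 1) * k \<le> T; I \<in> grid N\<rbrakk> \<Longrightarrow> norm (p n I - p (n - 1) I) \<le> P * k"
      and init: "dnorm N (e 1) + dgrad_norm N (e 1) \<le> B * (k\<^sup>2 + (mesh N)\<^sup>2)"
       "dnorm N (e 2) + dgrad_norm N (e 2) \<le> B * (k\<^sup>2 + (mesh N)\<^sup>2)"
       "dnorm N (\<lambda>I. (e 2 I - e 1 I) /\<^sub>R k) \<le> B * (k\<^sup>2 + (mesh N)\<^sup>2)"
      and n: "2 \<le> n" "real n * k \<le> T"
    define \<epsilon> where "\<epsilon> = k\<^sup>2 + (mesh N)\<^sup>2"
    have eps: "0 \<le> \<epsilon>" by (simp add: \<epsilon>_def)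
    define V where "V n = (\<lambda>I. (e (n + 1) I - e n I) /\<^sub>R k)" for n
    define A where "A n = nsq N (V n) + gform N (e (n + 1)) (e (n + 1)) + gform N (e n) (e n)
        + nsq N (e (n + 1)) + nsq N (e n)" for n
    define G where "G n = gsum N (\<lambda>I. p n I \<bullet> cross3 (e n I) (V n I))" for n
    \<comment> \<open>Two consecutive gradient energies are kept because the energy step controls
      the difference of the levels \<open>n + 1\<close> and \<open>n - 1\<close>: in
      \<open>Y n - Y (n - 1)\<close> the middle level cancels.\<close>
    define Y where "Y n = \<alpha> * \<tau> / 2 * nsq N (V n) + \<alpha> * \<tau> * G n
        + (gform N (e (n + 1)) (e (n + 1)) + gform N (e n) (e n)) / 4 + K * (nsq N (e (n + 1)) + nsq N (e n))" for n
    have A0: "0 \<le> A n" for n by (simp add: A_def)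
    have lower: "c0 * A n \<le> Y n" and upper: "Y n \<le> C3 * A n" if n: "1 \<le> n" "real (n + 1) * k \<le> T" for n
    proof -
      have "gsum N (\<lambda>I. (- 1 / 4) * (norm (V n I))\<^sup>2 + (- P\<^sup>2) * (norm (e n I))\<^sup>2) \<le> G n"
        unfolding G_def
      proof (rule gsum_mono)
        fix I :: "'d \<Rightarrow> nat" assume I: "I \<in> grid N"
        have "\<bar>p n I \<bullet> cross3 (e n I) (V n I)\<bar> \<le> norm (p n I) * norm (cross3 (e n I) (V n I))"
          by (rule Cauchy_Schwarz_ineq2)
        also have "\<dots> \<le> P * (norm (e n I) * norm (V n I))"
          using bnds[OF n I] pos(4) by (intro mult_mono norm_cross3_le) auto
        also have "\<dots> \<le> (1 / 4) * (norm (V n I))\<^sup>2 + P\<^sup>2 * (norm (e n I))\<^sup>2"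
          using sum_squares_bound[of "P * norm (e n I)" "norm (V n I) / 2"]
          by (simp add: power_mult_distrib power_divide)
        finally show "(- 1 / 4) * (norm (V n I))\<^sup>2 + (- P\<^sup>2) * (norm (e n I))\<^sup>2 \<le> p n I \<bullet> cross3 (e n I) (V n I)"
          by linarith
      qed
      then have "(- 1 / 4) * nsq N (V n) + (- P\<^sup>2) * nsq N (e n) \<le> G n"
        by (simp only: gsum_add gsum_cmult)
      then have "\<alpha> * \<tau> * ((- 1 / 4) * nsq N (V n) + (- P\<^sup>2) * nsq N (e n)) \<le> \<alpha> * \<tau> * G n"
        using pos by (intro mult_left_mono) auto
      then have Y_ge: "\<alpha> * \<tau> / 4 * nsq N (V n) + (gform N (e (n + 1)) (e (n + 1)) + gform N (e n) (e n)) / 4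
         + nsq N (e n) + K * nsq N (e (n + 1)) \<le> Y n"
        by (simp add: Y_def K_def algebra_simps)
      have "c0 * A n \<le> \<alpha> * \<tau> / 4 * nsq N (V n) + 1 / 4 * gform N (e (n + 1)) (e (n + 1))
          + 1 / 4 * gform N (e n) (e n) + K * nsq N (e (n + 1)) + 1 * nsq N (e n)"
        unfolding A_def distrib_left using c0 K by (intro add_mono mult_right_mono) auto
      also have "\<dots> = \<alpha> * \<tau> / 4 * nsq N (V n) + (gform N (e (n + 1)) (e (n + 1)) + gform N (e n) (e n)) / 4
         + nsq N (e n) + K * nsq N (e (n + 1))"
        by (simp add: add_divide_distrib)
      also note Y_ge
      finally show "c0 * A n \<le> Y n" .
      have "G n \<le> gsum N (\<lambda>I. P / 2 * ((norm (e n I))\<^sup>2 + (norm (V n I))\<^sup>2))"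
        unfolding G_def
      proof (rule gsum_mono)
        fix I :: "'d \<Rightarrow> nat" assume I: "I \<in> grid N"
        have "norm (p n I) * ((norm (e n I))\<^sup>2 + (norm (V n I))\<^sup>2) / 2 \<le> P * ((norm (e n I))\<^sup>2 + (norm (V n I))\<^sup>2) / 2"
          using bnds[OF n I] by (intro divide_right_mono mult_right_mono) auto
        then show "p n I \<bullet> cross3 (e n I) (V n I) \<le> P / 2 * ((norm (e n I))\<^sup>2 + (norm (V n I))\<^sup>2)"
          using triple_le[of "p n I" "e n I" "V n I"] by simp
      qed
      also have "\<dots> = P / 2 * (nsq N (e n) + nsq N (V n))"
        by (simp only: gsum_add gsum_cmult)
      also have "P / 2 * (nsq N (e n) + nsq N (V n)) \<le> P * (nsq N (e n) + nsq N (V n))"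
        using pos by (intro mult_right_mono) auto
      finally have "G n \<le> P * (nsq N (e n) + nsq N (V n))" .
      then have "\<alpha> * \<tau> * G n \<le> \<alpha> * \<tau> * (P * (nsq N (e n) + nsq N (V n)))"
        using pos by (intro mult_left_mono) auto
      also have "\<dots> = \<alpha> * \<tau> * P * nsq N (V n) + \<alpha> * \<tau> * P * nsq N (e n)"
        by (simp add: algebra_simps)
      finally have "\<alpha> * \<tau> * G n \<le> \<alpha> * \<tau> * P * nsq N (V n) + \<alpha> * \<tau> * P * nsq N (e n)" .
      moreover have "\<alpha> * \<tau> / 2 * nsq N (V n) \<le> \<alpha> * \<tau> * nsq N (V n)"
        using pos by (intro mult_right_mono) auto
      ultimately have "Y n \<le> (\<alpha> * \<tau> + \<alpha> * \<tau> * P) * nsq N (V n) + gform N (e (n + 1)) (e (n + 1)) + gform N (e n) (e n)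
         + K * nsq N (e (n + 1)) + (\<alpha> * \<tau> * P + K) * nsq N (e n)"
        unfolding Y_def add_divide_distrib distrib_right distrib_left
        using gform_self_nonneg[of N "e n"] gform_self_nonneg[of N "e (n + 1)"] by linarith
      also have "\<dots> \<le> C3 * A n"
      proof -
        have "0 \<le> \<alpha> * \<tau>" "0 \<le> \<alpha> * \<tau> * P" using pos by auto
        then have "\<alpha> * \<tau> + \<alpha> * \<tau> * P \<le> C3" "1 \<le> C3" "\<alpha> * \<tau> * P + K \<le> C3" "K \<le> C3"
          using K by (simp_all add: C3_def)
        then have "(\<alpha> * \<tau> + \<alpha> * \<tau> * P) * nsq N (V n) + 1 * gform N (e (n + 1)) (e (n + 1)) + 1 * gform N (e n) (e n)
           + K * nsq N (e (n + 1)) + (\<alpha> * \<tau> * P + K) * nsq N (e n) \<le> C3 * A n"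
          unfolding A_def distrib_left[of C3] by (intro add_mono mult_right_mono) auto
        then show ?thesis by (simp only: mult_1)
      qed
      finally show "Y n \<le> C3 * A n" .
    qed
    have step: "Y n - Y (n - 1) \<le> k * C1 * (\<epsilon>\<^sup>2 + A n + A (n - 1))" if n: "2 \<le> n" "real (n + 1) * k \<le> T" for n
    proof -
      have n1: "n - 1 + 1 = n" "1 \<le> n" using n by auto
      let ?a = "e (n + 1)" and ?c = "e n" and ?b = "e (n - 1)"
      let ?av = "avg e n" and ?D1 = "diff1 k e n" and ?U = "\<lambda>I. (e n I - e (n - 1) I) /\<^sub>R k"
      have U: "V (n - 1) = ?U" by (simp only: V_def n1)
      have es: "\<alpha> * \<tau> / 2 * (nsq N (V n) - nsq N ?U) + \<alpha> * \<tau> * (G n - G (n - 1))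
         + (gform N ?a ?a - gform N ?b ?b) / 4
       \<le> k * ((P + P\<^sup>2 + \<alpha> * P) * (\<epsilon>\<^sup>2 + nsq N ?av + nsq N ?D1) + P / 2 * (real CARD('d) * nsq N ?av + gform N ?av ?av)
          + \<alpha> * \<tau> * P * (nsq N ?b + nsq N ?U))"
        unfolding V_def G_def n1 avg_def diff1_def
      proof (rule energy_step[where \<alpha> = \<alpha> and \<tau> = \<tau> and q = "q n" and s = "s n"])
        fix I :: "'d \<Rightarrow> nat" assume I: "I \<in> grid N"
        have f: "dlaplacian N (\<lambda>I. (e (n + 1) I + e (n - 1) I) /\<^sub>R 2) I - \<alpha> *\<^sub>R ((e (n + 1) I - e (n - 1) I) /\<^sub>R (2 * k))
           - (\<alpha> * \<tau>) *\<^sub>R ((e (n + 1) I - 2 *\<^sub>R e n I + e (n - 1) I) /\<^sub>R k\<^sup>2) = - field \<alpha> \<tau> N k e n I"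
          by (simp add: field_def diff1_def diff2_def avg_def scaleR_add_right mult.assoc)
        show "- (((e (n + 1) I - e (n - 1) I) /\<^sub>R (2 * k)) \<bullet> (dlaplacian N (\<lambda>I. (e (n + 1) I + e (n - 1) I) /\<^sub>R 2) I
            - \<alpha> *\<^sub>R ((e (n + 1) I - e (n - 1) I) /\<^sub>R (2 * k)) - (\<alpha> * \<tau>) *\<^sub>R ((e (n + 1) I - 2 *\<^sub>R e n I + e (n - 1) I) /\<^sub>R k\<^sup>2)))
          = s n I \<bullet> ((e (n + 1) I - e (n - 1) I) /\<^sub>R (2 * k)) - s n I \<bullet> cross3 ((e (n + 1) I + e (n - 1) I) /\<^sub>R 2) (q n I)
            + p n I \<bullet> cross3 ((e (n + 1) I + e (n - 1) I) /\<^sub>R 2) (dlaplacian N (\<lambda>I. (e (n + 1) I + e (n - 1) I) /\<^sub>R 2) I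
            - \<alpha> *\<^sub>R ((e (n + 1) I - e (n - 1) I) /\<^sub>R (2 * k)) - (\<alpha> * \<tau>) *\<^sub>R ((e (n + 1) I - 2 *\<^sub>R e n I + e (n - 1) I) /\<^sub>R k\<^sup>2))"
          unfolding f using ident[OF n I] by (simp add: diff1_def avg_def)
      qed (use pos k N eps bnds[OF n1(2) n(2)] lip[OF n1(2) n(2)] tlip[OF n] in \<open>auto simp: \<epsilon>_def\<close>)
      have av: "nsq N ?av \<le> (nsq N ?a + nsq N ?b) / 2" unfolding avg_def by (rule nsq_average_le)
      have gav: "gform N ?av ?av \<le> (gform N ?a ?a + gform N ?b ?b) / 2" unfolding avg_def by (rule gform_average_le)
      have D1V: "?D1 = (\<lambda>I. (V n I + ?U I) /\<^sub>R 2)"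
        using k by (simp add: diff1_def V_def fun_eq_iff algebra_simps)
      have D1: "nsq N ?D1 \<le> (nsq N (V n) + nsq N ?U) / 2" unfolding D1V by (rule nsq_average_le)
      \<comment> \<open>Constants lie in the kernel of the Neumann gradient, so the norm of the
        error needs an increment estimate of its own: \<open>?a - ?b\<close> is \<open>2 * k\<close>
        times the centred difference and \<open>?a + ?b\<close> twice the average.\<close>
      have inc: "nsq N ?a - nsq N ?b \<le> 2 * k * (nsq N ?D1 + nsq N ?av)"
      proof -
        have "nsq N ?a - nsq N ?b = gsum N (\<lambda>I. (norm (?a I))\<^sup>2 - (norm (?b I))\<^sup>2)" by (simp only: gsum_diff)
        also have "\<dots> \<le> gsum N (\<lambda>I. (2 * k) * ((norm (?D1 I))\<^sup>2 + (norm (?av I))\<^sup>2))"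
        proof (rule gsum_mono)
          fix I
          have "(norm (?a I))\<^sup>2 - (norm (?b I))\<^sup>2 = (?a I - ?b I) \<bullet> (?a I + ?b I)"
            using inner_commute[of "?a I" "?b I"] by (simp add: power2_norm_eq_inner inner_diff_left inner_add_right)
          also have "\<dots> = 4 * k * (?D1 I \<bullet> ?av I)"
            using k by (simp add: diff1_def avg_def)
          also have "\<dots> \<le> 4 * k * (((norm (?D1 I))\<^sup>2 + (norm (?av I))\<^sup>2) / 2)"
          proof (rule mult_left_mono)
            have "?D1 I \<bullet> ?av I \<le> norm (?D1 I) * norm (?av I)" by (rule norm_cauchy_schwarz)
            then show "?D1 I \<bullet> ?av I \<le> ((norm (?D1 I))\<^sup>2 + (norm (?av I))\<^sup>2) / 2"
              using sum_squares_bound[of "norm (?D1 I)" "norm (?av I)"] by simp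
          qed (use k in auto)
          finally show "(norm (?a I))\<^sup>2 - (norm (?b I))\<^sup>2 \<le> (2 * k) * ((norm (?D1 I))\<^sup>2 + (norm (?av I))\<^sup>2)" by simp
        qed
        also have "\<dots> = 2 * k * (nsq N ?D1 + nsq N ?av)" by (simp only: gsum_cmult gsum_add)
        finally show ?thesis .
      qed
      define S where "S = \<epsilon>\<^sup>2 + A n + A (n - 1)"
      have S: "\<epsilon>\<^sup>2 \<le> S" "nsq N ?av \<le> S" "nsq N ?D1 \<le> S" "gform N ?av ?av \<le> S" "nsq N ?b + nsq N ?U \<le> S" "0 \<le> S"
        using av[unfolded add_divide_distrib] gav[unfolded add_divide_distrib] D1[unfolded add_divide_distrib]
          nsq_nonneg[of N "V n"] nsq_nonneg[of N ?U] nsq_nonneg[of N ?a] nsq_nonneg[of N ?b]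
          nsq_nonneg[of N ?c] gform_self_nonneg[of N ?a] gform_self_nonneg[of N ?b] gform_self_nonneg[of N ?c]
          zero_le_power2[of \<epsilon>]
        unfolding S_def A_def U n1 by - linarith+
      have Y: "Y n - Y (n - 1) = \<alpha> * \<tau> / 2 * (nsq N (V n) - nsq N ?U) + \<alpha> * \<tau> * (G n - G (n - 1))
         + (gform N ?a ?a - gform N ?b ?b) / 4 + K * (nsq N ?a - nsq N ?b)"
        unfolding Y_def U n1 by (simp add: algebra_simps diff_divide_distrib add_divide_distrib)
      have "(P + P\<^sup>2 + \<alpha> * P) * (\<epsilon>\<^sup>2 + nsq N ?av + nsq N ?D1) \<le> (P + P\<^sup>2 + \<alpha> * P) * (3 * S)"
        using S pos by (intro mult_left_mono) auto
      moreover have "P / 2 * (real CARD('d) * nsq N ?av + gform N ?av ?av) \<le> P * (d * S + S)"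
      proof -
        have "real CARD('d) * nsq N ?av + gform N ?av ?av \<le> d * S + S"
          unfolding d_def using S by (intro add_mono mult_left_mono) auto
        moreover have "0 \<le> d * S + S" using d S by auto
        ultimately show ?thesis using pos by (intro mult_mono) auto
      qed
      moreover have "\<alpha> * \<tau> * P * (nsq N ?b + nsq N ?U) \<le> \<alpha> * \<tau> * P * S"
        using S pos by (intro mult_left_mono) auto
      ultimately have "(P + P\<^sup>2 + \<alpha> * P) * (\<epsilon>\<^sup>2 + nsq N ?av + nsq N ?D1) + P / 2 * (real CARD('d) * nsq N ?av + gform N ?av ?av)
          + \<alpha> * \<tau> * P * (nsq N ?b + nsq N ?U) \<le> (C1 - 4 * K) * S"
        by (simp add: C1_def algebra_simps)
      then have 1: "k * ((P + P\<^sup>2 + \<alpha> * P) * (\<epsilon>\<^sup>2 + nsq N ?av + nsq N ?D1) + P / 2 * (real CARD('d) * nsq N ?av + gform N ?av ?av)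
          + \<alpha> * \<tau> * P * (nsq N ?b + nsq N ?U)) \<le> k * ((C1 - 4 * K) * S)"
        using k by (intro mult_left_mono) auto
      have "nsq N ?a - nsq N ?b \<le> 2 * k * (S + S)"
        using S k by (intro order_trans[OF inc] mult_left_mono add_mono) auto
      then have "K * (nsq N ?a - nsq N ?b) \<le> K * (2 * k * (S + S))"
        using K by (intro mult_left_mono) auto
      with es 1 Y have "Y n - Y (n - 1) \<le> k * ((C1 - 4 * K) * S) + K * (2 * k * (S + S))" by linarith
      also have "\<dots> = k * C1 * S" by (simp add: algebra_simps)
      finally show ?thesis by (simp add: S_def)
    qed
    \<comment> \<open>\<open>Y m\<close> already contains the norms at level \<open>m + 1\<close>,
      so level \<open>n\<close> is reached at index \<open>n - 1\<close>.\<close>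
    define m where "m = n - 1"
    have m: "1 \<le> m" "n = m + 1" "real (m + 1) * k \<le> T" using n by (auto simp: m_def)
    \<comment> \<open>Adding \<open>\<epsilon>\<^sup>2\<close> makes the recursion homogeneous.
      Beyond the index range the bounds on \<open>p\<close> may fail and the sign of
      \<open>Y\<close> is unknown, so the sequence is continued by 0.\<close>
    define y where "y j = (if 1 \<le> j \<and> j \<le> m then Y j + \<epsilon>\<^sup>2 else 0)" for j
    have ok: "real (j + 1) * k \<le> T" if "j \<le> m" for j
    proof -
      have "real (j + 1) * k \<le> real (m + 1) * k" using that k by (intro mult_right_mono) auto
      then show ?thesis using m by linarith
    qed
    have Y0: "0 \<le> Y j" if "1 \<le> j" "j \<le> m" for j
      using lower[OF that(1) ok[OF that(2)]] c0 A0[of j] mult_nonneg_nonneg[of c0 "A j"] by linarith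
    have "y m \<le> exp (4 * (k * C2) * real m) * y 1"
    proof (rule discrete_gronwall)
      show "0 \<le> k * C2" using k C2 by simp
      show "k * C2 \<le> 1 / 2" using k C2 by (simp add: k0_def field_simps)
      show "0 \<le> y j" for j using Y0 by (simp add: y_def)
      fix j assume j: "2 \<le> j" "j \<le> m"
      have j1: "1 \<le> j" "1 \<le> j - 1" "j - 1 \<le> m" using j by auto
      have "A j \<le> Y j / c0" "A (j - 1) \<le> Y (j - 1) / c0"
        using lower[OF j1(1) ok[OF j(2)]] lower[OF j1(2) ok[OF j1(3)]] c0 by (auto simp: field_simps)
      then have "\<epsilon>\<^sup>2 + A j + A (j - 1) \<le> \<epsilon>\<^sup>2 + Y j / c0 + Y (j - 1) / c0" by linarith
      then have "k * C1 * (\<epsilon>\<^sup>2 + A j + A (j - 1)) \<le> k * C1 * (\<epsilon>\<^sup>2 + Y j / c0 + Y (j - 1) / c0)"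
        using k C1 by (intro mult_left_mono) auto
      then have "Y j - Y (j - 1) \<le> k * C1 * (\<epsilon>\<^sup>2 + Y j / c0 + Y (j - 1) / c0)"
        using step[OF j(1) ok[OF j(2)]] by linarith
      also have "\<dots> = k * (C1 * \<epsilon>\<^sup>2 + C1 / c0 * Y j + C1 / c0 * Y (j - 1))"
        by (simp add: algebra_simps)
      also have "\<dots> \<le> k * (C2 * (2 * \<epsilon>\<^sup>2) + C2 * Y j + C2 * Y (j - 1))"
      proof -
        have C12: "C1 \<le> C2" "C1 / c0 \<le> C2" using C1 c0 by (simp_all add: C2_def)
        have "C1 * \<epsilon>\<^sup>2 \<le> C2 * (2 * \<epsilon>\<^sup>2)" using C12 C2 by (intro mult_mono) auto
        then show ?thesis
          using k C12 Y0[OF j1(1) j(2)] Y0[OF j1(2,3)] by (intro mult_left_mono add_mono mult_right_mono) auto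
      qed
      finally have "Y j - Y (j - 1) \<le> k * C2 * ((Y j + \<epsilon>\<^sup>2) + (Y (j - 1) + \<epsilon>\<^sup>2))"
        by (simp add: algebra_simps)
      then show "y j \<le> y (j - 1) + k * C2 * (y j + y (j - 1))"
        using j j1 by (simp add: y_def)
    qed (use m in auto)
    also have "\<dots> \<le> exp (4 * C2 * T) * ((5 * C3 * B\<^sup>2 + 1) * \<epsilon>\<^sup>2)"
    proof (rule mult_mono)
      have "k * real m \<le> T" using ok[of m] k by (simp add: algebra_simps)
      then have "C2 * (k * real m) \<le> C2 * T" using C2 by (intro mult_left_mono) auto
      then show "exp (4 * (k * C2) * real m) \<le> exp (4 * C2 * T)" by (simp add: mult_ac)
      have sq: "x\<^sup>2 \<le> B\<^sup>2 * \<epsilon>\<^sup>2" if "0 \<le> x" "x \<le> B * \<epsilon>" for x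
        using power_mono[OF that(2,1), of 2] by (simp add: power_mult_distrib)
      have nn: "0 \<le> dnorm N f" "0 \<le> dgrad_norm N f" for f :: "'d grid_fun"
        by (simp_all add: dnorm_def dinner_def dgrad_norm_def sum_nonneg)
      have sep: "(dnorm N f)\<^sup>2 \<le> B\<^sup>2 * \<epsilon>\<^sup>2" "(dgrad_norm N f)\<^sup>2 \<le> B\<^sup>2 * \<epsilon>\<^sup>2"
        if "dnorm N f + dgrad_norm N f \<le> B * \<epsilon>" for f :: "'d grid_fun"
        using nn[of f] that by (auto intro!: sq)
      \<comment> \<open>Each of the five terms of \<open>A 1\<close> is at most
        \<open>B\<^sup>2 * \<epsilon>\<^sup>2\<close>; the additional 1 in the constant is the
        \<open>\<epsilon>\<^sup>2\<close> contained in \<open>y 1\<close>.\<close>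
      have "(dnorm N (V 1))\<^sup>2 \<le> B\<^sup>2 * \<epsilon>\<^sup>2"
        using init(3) by (intro sq nn) (simp add: V_def \<epsilon>_def numeral_2_eq_2)
      then have "A 1 \<le> 5 * (B\<^sup>2 * \<epsilon>\<^sup>2)"
        using sep[OF init(1)[folded \<epsilon>_def]] sep[OF init(2)[folded \<epsilon>_def]]
        unfolding A_def dnorm_sq dgrad_norm_sq by (simp add: numeral_2_eq_2)
      then have "C3 * A 1 \<le> C3 * (5 * (B\<^sup>2 * \<epsilon>\<^sup>2))" using C3 by (rule mult_left_mono)
      then show "y 1 \<le> (5 * C3 * B\<^sup>2 + 1) * \<epsilon>\<^sup>2"
        using upper[OF _ ok[OF m(1)]] m by (simp add: y_def algebra_simps)
      show "0 \<le> y 1" using Y0[of 1] m by (simp add: y_def)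
    qed simp
    finally have "Y m + \<epsilon>\<^sup>2 \<le> exp (4 * C2 * T) * ((5 * C3 * B\<^sup>2 + 1) * \<epsilon>\<^sup>2)"
      using m by (simp add: y_def)
    then have "c0 * A m \<le> exp (4 * C2 * T) * ((5 * C3 * B\<^sup>2 + 1) * \<epsilon>\<^sup>2)"
      using lower[OF m(1) ok] zero_le_power2[of \<epsilon>] by (smt (verit) order_refl)
    then have "A m \<le> C4 * \<epsilon>\<^sup>2" using c0 by (simp add: C4_def field_simps)
    also have "\<dots> \<le> (C4 + 1)\<^sup>2 * \<epsilon>\<^sup>2"
    proof (rule mult_right_mono)
      have "0 \<le> C4 * C4" by simp
      then show "C4 \<le> (C4 + 1)\<^sup>2" using C4 by (simp add: power2_eq_square algebra_simps)
    qed simp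
    finally have Am: "A m \<le> ((C4 + 1) * \<epsilon>)\<^sup>2" by (simp add: power_mult_distrib)
    have "(dnorm N (e n))\<^sup>2 \<le> A m" "(dgrad_norm N (e n))\<^sup>2 \<le> A m"
      unfolding dnorm_sq dgrad_norm_sq A_def m(2) by (simp_all add: add_nonneg_nonneg)
    then have "(dnorm N (e n))\<^sup>2 \<le> ((C4 + 1) * \<epsilon>)\<^sup>2" "(dgrad_norm N (e n))\<^sup>2 \<le> ((C4 + 1) * \<epsilon>)\<^sup>2"
      using Am by linarith+
    then have "dnorm N (e n) \<le> (C4 + 1) * \<epsilon>" "dgrad_norm N (e n) \<le> (C4 + 1) * \<epsilon>"
      using C4 eps by (auto intro: power2_le_imp_le)
    then show "dnorm N (e n) + dgrad_norm N (e n) \<le> C * (k\<^sup>2 + (mesh N)\<^sup>2)"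
      unfolding \<epsilon>_def[symmetric] C_def by (simp add: algebra_simps)
  qed
qed

section \<open>Convergence for consistent grid values\<close>

lemma dlaplacian_diff: "dlaplacian N (\<lambda>I. f I - g I) I = dlaplacian N f I - dlaplacian N g I"
proof -
  have "(a - b) - 2 *\<^sub>R (c - d) + (x - y) = (a - 2 *\<^sub>R c + x) - (b - 2 *\<^sub>R d + y)" for a b c d x y :: "real ^ 3"
    by (simp add: scaleR_diff_right)
  then show ?thesis
    by (simp only: dlaplacian_def ghost_ext_def sum_subtractf[symmetric] scaleR_diff_right[symmetric])
qed

lemma avg_diff: "avg (\<lambda>n I. f n I - g n I) n = (\<lambda>I. avg f n I - avg g n I)"
  by (simp add: avg_def fun_eq_iff scaleR_diff_right[symmetric] add_diff_add)

lemma diff1_diff: "diff1 k (\<lambda>n I. f n I - g n I) n I = diff1 k f n I - diff1 k g n I"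
proof -
  have "(a - b) - (c - d) = (a - c) - (b - d)" for a b c d :: "real ^ 3" by simp
  then show ?thesis by (simp only: diff1_def scaleR_diff_right[symmetric])
qed

lemma diff2_diff: "diff2 k (\<lambda>n I. f n I - g n I) n I = diff2 k f n I - diff2 k g n I"
proof -
  have "(a - b) - 2 *\<^sub>R (c - d) + (x - y) = (a - 2 *\<^sub>R c + x) - (b - 2 *\<^sub>R d + y)" for a b c d x y :: "real ^ 3"
    by (simp add: scaleR_diff_right)
  then show ?thesis by (simp only: diff2_def scaleR_diff_right[symmetric])
qed

lemma field_diff: "field \<alpha> \<tau> N k (\<lambda>n I. f n I - g n I) n I = field \<alpha> \<tau> N k f n I - field \<alpha> \<tau> N k g n I"
  by (simp add: field_def avg_diff diff1_diff diff2_diff dlaplacian_diff scaleR_diff_right scaleR_add_right)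

lemma implicit_scheme_field:
  assumes "implicit_scheme \<alpha> \<tau> T N k m" "2 \<le> n" "real (n + 1) * k \<le> T" "I \<in> grid N"
  shows "diff1 k m n I = cross3 (avg m n I) (field \<alpha> \<tau> N k m n I)"
proof -
  have "diff1 k m n I - \<alpha> *\<^sub>R cross3 (avg m n I) (diff1 k m n I + \<tau> *\<^sub>R diff2 k m n I)
      = - cross3 (avg m n I) (dlaplacian N (avg m n) I)"
    using assms unfolding implicit_scheme_def Let_def avg_def diff1_def diff2_def by blast
  then show ?thesis
    unfolding field_def Cross3.right_diff_distrib cross_mult_right by (simp add: algebra_simps)
qed

text \<open>Only the truncation error is required to be of second order; the differences of average,
  velocity and field need just Lipschitz bounds. Indices start at 1, one below the first step of the
  scheme, because the weight \<open>p\<close> is needed at the level before that step.\<close>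

definition consistent ::
  "real \<Rightarrow> real \<Rightarrow> real \<Rightarrow> nat \<Rightarrow> real \<Rightarrow> real \<Rightarrow> (nat \<Rightarrow> 'd::finite grid_fun) \<Rightarrow> bool" where
  "consistent \<alpha> \<tau> T N k A m \<longleftrightarrow> (\<forall>n\<ge>1. real (n + 1) * k \<le> T \<longrightarrow>
     (\<forall>I\<in>grid N. norm (m (n + 1) I) = 1 \<and> norm (m (n - 1) I) = 1 \<and>
        norm (diff1 k m n I) \<le> A \<and> norm (field \<alpha> \<tau> N k m n I) \<le> A \<and>
        norm (diff1 k m n I - cross3 (avg m n I) (field \<alpha> \<tau> N k m n I)) \<le> A * (k\<^sup>2 + (mesh N)\<^sup>2)) \<and>
     (\<forall>j. \<forall>I\<in>interior_faces N j. norm (jump j (avg m n) I) \<le> A * mesh N \<and>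
        norm (jump j (diff1 k m n) I) \<le> A * mesh N \<and>
        norm (jump j (field \<alpha> \<tau> N k m n) I) \<le> A * mesh N) \<and>
     (2 \<le> n \<longrightarrow> (\<forall>I\<in>grid N. norm (avg m n I - avg m (n - 1) I) \<le> A * k \<and>
        norm (diff1 k m n I - diff1 k m (n - 1) I) \<le> A * k \<and>
        norm (field \<alpha> \<tau> N k m n I - field \<alpha> \<tau> N k m (n - 1) I) \<le> A * k)))"

text \<open>Polarisation for two unit vectors. The orthogonality is the discrete form of
  \<open>m . m_t = 0\<close> and holds exactly; the last identity shows that the average leaves the
  sphere only to second order in \<open>k\<close>, hence has squared length at least
  \<open>1 / 2\<close> for small \<open>k\<close>.\<close>

lemma average_of_unit_vectors:
  fixes x y :: "'a::real_inner"
  assumes "norm x = 1" "norm y = 1" "0 < k"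
  shows "norm ((x + y) /\<^sub>R 2) \<le> 1"
    and "((x + y) /\<^sub>R 2) \<bullet> ((x - y) /\<^sub>R (2 * k)) = 0"
    and "((x + y) /\<^sub>R 2) \<bullet> ((x + y) /\<^sub>R 2) = 1 - (k * norm ((x - y) /\<^sub>R (2 * k)))\<^sup>2"
proof -
  have xy: "x \<bullet> x = 1" "y \<bullet> y = 1" using assms by (simp_all add: norm_eq_1)
  show "norm ((x + y) /\<^sub>R 2) \<le> 1"
    using norm_triangle_ineq[of x y] assms by simp
  have "(x + y) \<bullet> (x - y) = 0"
    using inner_commute[of x y] xy by (simp add: inner_diff_right inner_add_left)
  then show "((x + y) /\<^sub>R 2) \<bullet> ((x - y) /\<^sub>R (2 * k)) = 0" by simp
  have h: "k * norm ((x - y) /\<^sub>R (2 * k)) = norm (x - y) / 2" using assms(3) by simp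
  have 1: "(k * norm ((x - y) /\<^sub>R (2 * k)))\<^sup>2 = ((x - y) \<bullet> (x - y)) / 4"
    unfolding h by (simp add: power_divide power2_norm_eq_inner)
  have 4: "((x + y) /\<^sub>R 2) \<bullet> ((x + y) /\<^sub>R 2) = ((x + y) \<bullet> (x + y)) / 4"
    by (simp only: inner_scaleR_left inner_scaleR_right) simp
  have "(x - y) \<bullet> (x - y) = 2 - 2 * (x \<bullet> y)" "(x + y) \<bullet> (x + y) = 2 + 2 * (x \<bullet> y)"
    using inner_commute[of x y] xy
    by (simp_all add: inner_diff_right inner_diff_left inner_add_right inner_add_left)
  then have "((x + y) \<bullet> (x + y)) / 4 = 1 - ((x - y) \<bullet> (x - y)) / 4"
    by (simp only:) (simp add: add_divide_distrib diff_divide_distrib)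
  then show "((x + y) /\<^sub>R 2) \<bullet> ((x + y) /\<^sub>R 2) = 1 - (k * norm ((x - y) /\<^sub>R (2 * k)))\<^sup>2"
    unfolding 1 4 .
qed

lemma convergence_of_consistent:
  fixes \<alpha> \<tau> T A B :: real
  assumes pos: "0 < \<alpha>" "0 < \<tau>" "0 < T" "1 \<le> A"
  obtains C k0 where "0 < C" "0 < k0"
    "\<And>N k (m :: nat \<Rightarrow> 'd::finite grid_fun) mh n.
      \<lbrakk>0 < N; 0 < k; k < k0; consistent \<alpha> \<tau> T N k A m; implicit_scheme \<alpha> \<tau> T N k mh;
       dnorm N (\<lambda>I. m 1 I - mh 1 I) + dgrad_norm N (\<lambda>I. m 1 I - mh 1 I) \<le> B * (k\<^sup>2 + (mesh N)\<^sup>2);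
       dnorm N (\<lambda>I. m 2 I - mh 2 I) + dgrad_norm N (\<lambda>I. m 2 I - mh 2 I) \<le> B * (k\<^sup>2 + (mesh N)\<^sup>2);
       dnorm N (\<lambda>I. (m 2 I - mh 2 I - (m 1 I - mh 1 I)) /\<^sub>R k) \<le> B * (k\<^sup>2 + (mesh N)\<^sup>2);
       2 \<le> n; real n * k \<le> T\<rbrakk>
      \<Longrightarrow> dnorm N (\<lambda>I. m n I - mh n I) + dgrad_norm N (\<lambda>I. m n I - mh n I) \<le> C * (k\<^sup>2 + (mesh N)\<^sup>2)"
proof -
  \<comment> \<open>The field \<open>q\<close> contributes \<open>A \<le> A ^ 5\<close> to the
    Lipschitz constant of \<open>p = q - s\<close>, the corrector \<open>26 * A ^ 5\<close>.\<close>
  define P where "P = 27 * A ^ 5"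
  have pow: "A \<le> A ^ 2" "A ^ 2 \<le> A ^ 3" "A ^ 3 \<le> A ^ 4" "A ^ 4 \<le> A ^ 5"
    using pos(4) by (auto intro: power_increasing self_le_power)
  have P: "0 \<le> P" using pos by (simp add: P_def)
  obtain C k1 where C: "0 < C" "0 < k1" and stab:
    "\<And>N k (e :: nat \<Rightarrow> 'd::finite grid_fun) p s q n.
      \<lbrakk>0 < N; 0 < k; k < k1;
       \<And>n I. \<lbrakk>2 \<le> n; real (n + 1) * k \<le> T; I \<in> grid N\<rbrakk> \<Longrightarrow>
         diff1 k e n I \<bullet> field \<alpha> \<tau> N k e n I = s n I \<bullet> diff1 k e n I - s n I \<bullet> cross3 (avg e n I) (q n I)
           - p n I \<bullet> cross3 (avg e n I) (field \<alpha> \<tau> N k e n I);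
       \<And>n I. \<lbrakk>1 \<le> n; real (n + 1) * k \<le> T; I \<in> grid N\<rbrakk> \<Longrightarrow>
         norm (p n I) \<le> P \<and> norm (q n I) \<le> P \<and> norm (s n I) \<le> P * (k\<^sup>2 + (mesh N)\<^sup>2);
       \<And>n j I. \<lbrakk>1 \<le> n; real (n + 1) * k \<le> T; I \<in> interior_faces N j\<rbrakk> \<Longrightarrow>
         norm (jump j (p n) I) \<le> P * mesh N;
       \<And>n I. \<lbrakk>2 \<le> n; real (n + 1) * k \<le> T; I \<in> grid N\<rbrakk> \<Longrightarrow> norm (p n I - p (n - 1) I) \<le> P * k;
       dnorm N (e 1) + dgrad_norm N (e 1) \<le> max B 0 * (k\<^sup>2 + (mesh N)\<^sup>2);
       dnorm N (e 2) + dgrad_norm N (e 2) \<le> max B 0 * (k\<^sup>2 + (mesh N)\<^sup>2);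
       dnorm N (\<lambda>I. (e 2 I - e 1 I) /\<^sub>R k) \<le> max B 0 * (k\<^sup>2 + (mesh N)\<^sup>2);
       2 \<le> n; real n * k \<le> T\<rbrakk>
      \<Longrightarrow> dnorm N (e n) + dgrad_norm N (e n) \<le> C * (k\<^sup>2 + (mesh N)\<^sup>2)"
    using energy_stability[OF pos(1-3) P max.cobounded2[of 0 B], where ?'d = 'd] by blast
  \<comment> \<open>The second bound gives \<open>k * A \<le> 1 / 2\<close> and thereby keeps the
    average of the exact values away from 0.\<close>
  define k0 where "k0 = min k1 (1 / (2 * A))"
  show ?thesis
  proof (rule that[of C k0])
    show "0 < C" "0 < k0" using C pos by (auto simp: k0_def)
    fix N k n and m mh :: "nat \<Rightarrow> 'd grid_fun"
    assume N: "0 < N" and k: "0 < k" "k < k0" and cons: "consistent \<alpha> \<tau> T N k A m"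
      and scheme: "implicit_scheme \<alpha> \<tau> T N k mh"
      and init: "dnorm N (\<lambda>I. m 1 I - mh 1 I) + dgrad_norm N (\<lambda>I. m 1 I - mh 1 I) \<le> B * (k\<^sup>2 + (mesh N)\<^sup>2)"
       "dnorm N (\<lambda>I. m 2 I - mh 2 I) + dgrad_norm N (\<lambda>I. m 2 I - mh 2 I) \<le> B * (k\<^sup>2 + (mesh N)\<^sup>2)"
       "dnorm N (\<lambda>I. (m 2 I - mh 2 I - (m 1 I - mh 1 I)) /\<^sub>R k) \<le> B * (k\<^sup>2 + (mesh N)\<^sup>2)"
      and n: "2 \<le> n" "real n * k \<le> T"
    have kA: "k * A \<le> 1 / 2"
    proof -
      have "k * A \<le> (1 / (2 * A)) * A" using k pos by (intro mult_right_mono) (auto simp: k0_def)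
      then show ?thesis using pos by simp
    qed
    define e where "e = (\<lambda>n I. m n I - mh n I)"
    define q where "q = field \<alpha> \<tau> N k m"
    define s where "s = (\<lambda>n I. corrector (avg m n I) (diff1 k m n I) (q n I))"
    define p where "p = (\<lambda>n I. q n I - s n I)"
    have c1: "norm (m (n + 1) I) = 1 \<and> norm (m (n - 1) I) = 1 \<and>
        norm (diff1 k m n I) \<le> A \<and> norm (q n I) \<le> A \<and>
        norm (diff1 k m n I - cross3 (avg m n I) (q n I)) \<le> A * (k\<^sup>2 + (mesh N)\<^sup>2)"
      if "1 \<le> n" "real (n + 1) * k \<le> T" "I \<in> grid N" for n I
      using cons that unfolding consistent_def q_def by blast
    have c2: "norm (jump j (avg m n) I) \<le> A * mesh N \<and> norm (jump j (diff1 k m n) I) \<le> A * mesh N \<and>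
        norm (jump j (q n) I) \<le> A * mesh N"
      if "1 \<le> n" "real (n + 1) * k \<le> T" "I \<in> interior_faces N j" for n I j
      using cons that unfolding consistent_def q_def by blast
    have c3: "norm (avg m n I - avg m (n - 1) I) \<le> A * k \<and>
        norm (diff1 k m n I - diff1 k m (n - 1) I) \<le> A * k \<and> norm (q n I - q (n - 1) I) \<le> A * k"
      if "2 \<le> n" "real (n + 1) * k \<le> T" "I \<in> grid N" for n I
    proof -
      have "1 \<le> n" using that by simp
      then show ?thesis using cons that unfolding consistent_def q_def by blast
    qed
    have av: "norm (avg m n I) \<le> A" "avg m n I \<bullet> diff1 k m n I = 0" "1 / 2 \<le> avg m n I \<bullet> avg m n I"
      if n: "1 \<le> n" "real (n + 1) * k \<le> T" "I \<in> grid N" for n I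
    proof -
      note u = average_of_unit_vectors[of "m (n + 1) I" "m (n - 1) I" k]
      show "norm (avg m n I) \<le> A" "avg m n I \<bullet> diff1 k m n I = 0"
        using u(1,2) c1[OF n] k pos by (auto simp: avg_def diff1_def)
      have "(k * norm (diff1 k m n I))\<^sup>2 \<le> (1 / 2)\<^sup>2"
      proof (rule power_mono)
        have "k * norm (diff1 k m n I) \<le> k * A" using c1[OF n] k by (intro mult_left_mono) auto
        then show "k * norm (diff1 k m n I) \<le> 1 / 2" using kA by linarith
      qed (use k in auto)
      then have "(k * norm (diff1 k m n I))\<^sup>2 \<le> 1 / 2" by (simp add: power2_eq_square)
      moreover have "avg m n I \<bullet> avg m n I = 1 - (k * norm (diff1 k m n I))\<^sup>2"
        using u(3) c1[OF n] k unfolding avg_def diff1_def by blast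
      ultimately show "1 / 2 \<le> avg m n I \<bullet> avg m n I" by linarith
    qed
    \<comment> \<open>Both the cell and the time level may change, so that one estimate yields the
      jumps of \<open>p\<close> as well as its time increments.\<close>
    have lip: "norm (p n I - p n' I') \<le> P * \<delta>"
      if "1 \<le> n" "real (n + 1) * k \<le> T" "I \<in> grid N" "1 \<le> n'" "real (n' + 1) * k \<le> T" "I' \<in> grid N" "0 \<le> \<delta>"
        and d: "norm (avg m n I - avg m n' I') \<le> A * \<delta>" "norm (diff1 k m n I - diff1 k m n' I') \<le> A * \<delta>"
          "norm (q n I - q n' I') \<le> A * \<delta>" for n n' I I' \<delta>
    proof -
      have "norm (s n I - s n' I') \<le> 26 * A ^ 5 * \<delta>"
        unfolding s_def using pos(4) that(7) av[OF that(1-3)] av[OF that(4-6)] c1[OF that(1-3)] c1[OF that(4-6)] d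
        by (intro corrector_lipschitz(2)) auto
      moreover have "p n I - p n' I' = (q n I - q n' I') - (s n I - s n' I')" by (simp add: p_def)
      ultimately have "norm (p n I - p n' I') \<le> A * \<delta> + 26 * A ^ 5 * \<delta>"
        using d(3) norm_triangle_ineq4[of "q n I - q n' I'" "s n I - s n' I'"] by simp
      also have "\<dots> \<le> A ^ 5 * \<delta> + 26 * A ^ 5 * \<delta>"
        using pow that(7) by (intro add_right_mono mult_right_mono) auto
      finally show ?thesis by (simp add: P_def mult_ac)
    qed
    have "dnorm N (e n) + dgrad_norm N (e n) \<le> C * (k\<^sup>2 + (mesh N)\<^sup>2)"
    proof (rule stab[where p = p and s = s and q = q])
      show "0 < N" "0 < k" "k < k1" "2 \<le> n" "real n * k \<le> T" using N k n by (auto simp: k0_def)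
    next
      fix n I assume n: "2 \<le> n" "real (n + 1) * k \<le> T" and I: "(I :: 'd \<Rightarrow> nat) \<in> grid N"
      then have n1: "1 \<le> n" by simp
      have "- (diff1 k e n I \<bullet> - field \<alpha> \<tau> N k e n I) = s n I \<bullet> diff1 k e n I - s n I \<bullet> cross3 (avg e n I) (q n I)
          + (q n I - s n I) \<bullet> cross3 (avg e n I) (- field \<alpha> \<tau> N k e n I)"
        unfolding s_def
      proof (rule error_identity)
        have "diff1 k mh n I = cross3 (avg mh n I) (field \<alpha> \<tau> N k mh n I)"
          by (rule implicit_scheme_field[OF scheme n I])
        then show "diff1 k m n I - diff1 k e n I = cross3 (avg m n I - avg e n I) (q n I + - field \<alpha> \<tau> N k e n I)"
          by (simp add: e_def diff1_diff avg_diff field_diff q_def)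
        show "avg m n I \<bullet> diff1 k m n I = 0" "avg m n I \<bullet> avg m n I \<noteq> 0"
          using av[OF n1 n(2) I] by auto
      qed
      then show "diff1 k e n I \<bullet> field \<alpha> \<tau> N k e n I = s n I \<bullet> diff1 k e n I - s n I \<bullet> cross3 (avg e n I) (q n I)
           - p n I \<bullet> cross3 (avg e n I) (field \<alpha> \<tau> N k e n I)"
        by (simp add: p_def)
    next
      fix n I assume n: "1 \<le> n" "real (n + 1) * k \<le> T" "(I :: 'd \<Rightarrow> nat) \<in> grid N"
      note c = c1[OF n] and a = av[OF n]
      have "norm (s n I) \<le> 4 * A ^ 3"
        unfolding s_def using corrector_lipschitz(1)[OF pos(4), of 0 "avg m n I" "diff1 k m n I" "q n I" "avg m n I" "diff1 k m n I" "q n I"]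
          c a by simp
      then have "norm (p n I) \<le> A + 4 * A ^ 3"
        unfolding p_def using c norm_triangle_ineq4[of "q n I" "s n I"] by linarith
      then have "norm (p n I) \<le> P" "norm (q n I) \<le> P" using pow c pos(4) by (auto simp: P_def)
      moreover have "norm (s n I) \<le> 2 * A * (A * (k\<^sup>2 + (mesh N)\<^sup>2))"
        unfolding s_def by (rule corrector_small) (use a c in auto)
      moreover have "2 * A * (A * (k\<^sup>2 + (mesh N)\<^sup>2)) = (2 * A ^ 2) * (k\<^sup>2 + (mesh N)\<^sup>2)" by (simp add: power2_eq_square)
      moreover have "\<dots> \<le> P * (k\<^sup>2 + (mesh N)\<^sup>2)"
        using pow pos(4) by (intro mult_right_mono) (auto simp: P_def)
      ultimately show "norm (p n I) \<le> P \<and> norm (q n I) \<le> P \<and> norm (s n I) \<le> P * (k\<^sup>2 + (mesh N)\<^sup>2)"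
        by simp
    next
      fix n j I assume n: "1 \<le> n" "real (n + 1) * k \<le> T" "(I :: 'd \<Rightarrow> nat) \<in> interior_faces N j"
      show "norm (jump j (p n) I) \<le> P * mesh N"
        unfolding jump_def
        by (rule lip) (use n c2[OF n] in \<open>auto simp: shift_in_grid interior_faces_grid jump_def\<close>)
    next
      fix n I assume n: "2 \<le> n" "real (n + 1) * k \<le> T" "(I :: 'd \<Rightarrow> nat) \<in> grid N"
      have "real (n - 1 + 1) * k \<le> real (n + 1) * k" using n k by (intro mult_right_mono) auto
      then have "real (n - 1 + 1) * k \<le> T" using n(2) by linarith
      then show "norm (p n I - p (n - 1) I) \<le> P * k"
        by (intro lip) (use n c3[OF n] k in auto)
    next
      \<comment> \<open>The sign of \<open>B\<close> is open, whereas stability is formulated for a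
        nonnegative constant.\<close>
      have "B * (k\<^sup>2 + (mesh N)\<^sup>2) \<le> max B 0 * (k\<^sup>2 + (mesh N)\<^sup>2)" by (intro mult_right_mono) auto
      then show "dnorm N (e 1) + dgrad_norm N (e 1) \<le> max B 0 * (k\<^sup>2 + (mesh N)\<^sup>2)"
       "dnorm N (e 2) + dgrad_norm N (e 2) \<le> max B 0 * (k\<^sup>2 + (mesh N)\<^sup>2)"
       "dnorm N (\<lambda>I. (e 2 I - e 1 I) /\<^sub>R k) \<le> max B 0 * (k\<^sup>2 + (mesh N)\<^sup>2)"
        using init unfolding e_def by linarith+
    qed
    then show "dnorm N (\<lambda>I. m n I - mh n I) + dgrad_norm N (\<lambda>I. m n I - mh n I) \<le> C * (k\<^sup>2 + (mesh N)\<^sup>2)"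
      by (simp add: e_def)
  qed
qed

section \<open>Fields on the closed cube\<close>

lemma mem_Omega_bar: "x \<in> (Omega_bar :: (real ^ 'd) set) \<longleftrightarrow> (\<forall>i. 0 \<le> x $ i \<and> x $ i \<le> 1)"
  by (simp add: mem_box_cart)

lemma mem_Omega: "x \<in> (Omega :: (real ^ 'd) set) \<longleftrightarrow> (\<forall>i. 0 < x $ i \<and> x $ i < 1)"
  by (simp add: mem_box_cart)

lemma line_nth: "(x + s *\<^sub>R axis i 1) $ l = (if l = i then x $ l + s else (x :: real ^ 'd) $ l)"
  by (simp add: axis_def)

lemma line_in_Omega_bar:
  assumes "x \<in> Omega_bar"
  shows "x + s *\<^sub>R axis i 1 \<in> Omega_bar \<longleftrightarrow> - x $ i \<le> s \<and> s \<le> 1 - x $ i"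
  using assms unfolding mem_Omega_bar line_nth by (auto split: if_splits)

lemma increments_eq: "x \<in> Omega_bar \<Longrightarrow> increments i x = {- x $ i..1 - x $ i}"
  by (rule set_eqI) (simp only: increments_def mem_Collect_eq line_in_Omega_bar atLeastAtMost_iff)

lemma zero_in_Omega_bar: "0 \<in> Omega_bar"
  by (simp add: mem_Omega_bar)

text \<open>The increments admissible at a shifted point are the shifted increments of
  \<open>x\<close>, so differentiability at 0 for all base points becomes differentiability along
  the whole chord through the cube.\<close>

lemma pd_line:
  assumes "has_pd i f" "x \<in> Omega_bar" "s \<in> increments i x"
  shows "((\<lambda>s. f (x + s *\<^sub>R axis i 1)) has_vector_derivative pd i f (x + s *\<^sub>R axis i 1)) (at s within increments i x)"
proof -
  let ?y = "x + s *\<^sub>R axis i 1"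
  have y: "?y \<in> Omega_bar" using assms by (simp add: increments_def)
  have "((\<lambda>r. f (?y + r *\<^sub>R axis i 1)) has_vector_derivative pd i f ?y) (at (- s + 1 * s) within increments i ?y)"
    using assms(1) y unfolding has_pd_def pd_def by (simp add: vector_derivative_works)
  then have "((\<lambda>r. f (?y + (- s + 1 * r) *\<^sub>R axis i 1)) has_vector_derivative 1 *\<^sub>R pd i f ?y) (at s within increments i x)"
    by (rule has_vector_derivative_affine) (simp add: increments_def algebra_simps)
  then show ?thesis by (simp add: algebra_simps)
qed

lemma signed_line:
  assumes "has_pd i f" "x \<in> Omega_bar" "s \<in> S" "\<And>r. r \<in> S \<Longrightarrow> x + (c * r) *\<^sub>R axis i 1 \<in> Omega_bar"
  shows "((\<lambda>s. f (x + (c * s) *\<^sub>R axis i 1)) has_vector_derivative c *\<^sub>R pd i f (x + (c * s) *\<^sub>R axis i 1)) (at s within S)"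
proof -
  have "((\<lambda>s. f (x + s *\<^sub>R axis i 1)) has_vector_derivative pd i f (x + (0 + c * s) *\<^sub>R axis i 1))
      (at (0 + c * s) within increments i x)"
    using pd_line[OF assms(1,2), of "0 + c * s"] assms(3,4) by (simp add: increments_def)
  from has_vector_derivative_affine[OF this, of S] assms(4) show ?thesis by (simp add: increments_def)
qed

lemma pd_unique:
  assumes "x \<in> Omega_bar" "((\<lambda>s. f (x + s *\<^sub>R axis i 1)) has_vector_derivative D) (at 0 within increments i x)"
  shows "pd i f x = D"
proof -
  have "0 \<in> increments i x" using assms(1) by (simp add: increments_def)
  with assms show ?thesis
    unfolding pd_def increments_eq[OF assms(1)]
    by (intro vector_derivative_within_closed_interval) auto
qed

lemma pd_derivative_0:
  assumes "has_pd i f" "x \<in> Omega_bar"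
  shows "((\<lambda>s. f (x + s *\<^sub>R axis i 1)) has_vector_derivative pd i f x) (at 0 within increments i x)"
  using pd_line[OF assms, of 0] assms(2) by (simp add: increments_def)

lemma has_pdI:
  assumes "\<And>x. x \<in> Omega_bar \<Longrightarrow>
    ((\<lambda>s. f (x + s *\<^sub>R axis i 1)) has_vector_derivative D x) (at 0 within increments i x)"
  shows "has_pd i f" "\<And>x. x \<in> Omega_bar \<Longrightarrow> pd i f x = D x"
  using assms pd_unique unfolding has_pd_def by (blast intro: differentiableI_vector)+

lemma line_cong:
  assumes "\<And>x. x \<in> Omega_bar \<Longrightarrow> f x = g x" "x \<in> Omega_bar"
  shows "((\<lambda>s. f (x + s *\<^sub>R axis i 1)) has_vector_derivative D) (at 0 within increments i x)
     \<longleftrightarrow> ((\<lambda>s. g (x + s *\<^sub>R axis i 1)) has_vector_derivative D) (at 0 within increments i x)"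
proof -
  have 0: "0 \<in> increments i x" using assms(2) by (simp add: increments_def)
  have eq: "f (x + s *\<^sub>R axis i 1) = g (x + s *\<^sub>R axis i 1)" if "s \<in> increments i x" for s
    by (rule assms(1)) (use that in \<open>simp only: increments_def mem_Collect_eq\<close>)
  show ?thesis
    by (rule iffI) (erule has_vector_derivative_transform[OF 0, rotated], simp only: eq)+
qed

text \<open>\<open>vector_derivative\<close> is a choice from the set of derivatives, and functions
  that agree on the cube have the same set. Therefore the equality holds even where no derivative
  exists, and the norms below can be rewritten unconditionally.\<close>

lemma pd_cong:
  assumes "\<And>x. x \<in> Omega_bar \<Longrightarrow> f x = g x"
  shows "x \<in> Omega_bar \<Longrightarrow> pd i f x = pd i g x" "has_pd i f \<longleftrightarrow> has_pd i g"
proof -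
  show "pd i f x = pd i g x" if "x \<in> Omega_bar"
    by (simp only: pd_def vector_derivative_def line_cong[of f g, OF assms that])
  have "(\<lambda>s. f (x + s *\<^sub>R axis i 1)) differentiable (at 0 within increments i x)
    \<longleftrightarrow> (\<lambda>s. g (x + s *\<^sub>R axis i 1)) differentiable (at 0 within increments i x)" if "x \<in> Omega_bar" for x
    by (simp only: vector_derivative_works vector_derivative_def line_cong[of f g, OF assms that])
  then show "has_pd i f \<longleftrightarrow> has_pd i g" unfolding has_pd_def by blast
qed

lemma Ck_cong: "(\<And>x. x \<in> Omega_bar \<Longrightarrow> f x = g x) \<Longrightarrow> Ck k f \<longleftrightarrow> Ck k g"
proof (induction k arbitrary: f g)
  case 0
  then show ?case by (simp cong: continuous_on_cong)
next
  case (Suc k)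
  have "Ck k (pd i f) \<longleftrightarrow> Ck k (pd i g)" for i
    by (rule Suc.IH) (rule pd_cong(1)[OF Suc.prems])
  moreover have "continuous_on Omega_bar f \<longleftrightarrow> continuous_on Omega_bar g"
    using Suc.prems by (simp cong: continuous_on_cong)
  moreover have "has_pd i f \<longleftrightarrow> has_pd i g" for i
    by (rule pd_cong(2)[OF Suc.prems])
  ultimately show ?case by simp
qed

lemma Ck_norm_cong: "(\<And>x. x \<in> Omega_bar \<Longrightarrow> f x = g x) \<Longrightarrow> Ck_norm k f = Ck_norm k g"
proof (induction k arbitrary: f g)
  case 0
  then show ?case by (auto intro: SUP_cong)
next
  case (Suc k)
  have "Ck_norm k (pd i f) = Ck_norm k (pd i g)" for i
    by (rule Suc.IH) (rule pd_cong(1)[OF Suc.prems])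
  moreover have "(SUP x\<in>Omega_bar. norm (f x)) = (SUP x\<in>Omega_bar. norm (g x))"
    using Suc.prems by (auto intro: SUP_cong)
  ultimately show ?case by simp
qed

lemma Ck_continuous: "Ck k f \<Longrightarrow> continuous_on Omega_bar f"
  by (cases k) auto

lemma pd_linear:
  assumes "has_pd i f" "has_pd i g"
  shows "has_pd i (\<lambda>x. a *\<^sub>R f x + b *\<^sub>R g x)"
    and "x \<in> Omega_bar \<Longrightarrow> pd i (\<lambda>x. a *\<^sub>R f x + b *\<^sub>R g x) x = a *\<^sub>R pd i f x + b *\<^sub>R pd i g x"
proof -
  have "((\<lambda>s. a *\<^sub>R f (x + s *\<^sub>R axis i 1) + b *\<^sub>R g (x + s *\<^sub>R axis i 1)) has_vector_derivative
      a *\<^sub>R pd i f x + b *\<^sub>R pd i g x) (at 0 within increments i x)" if "x \<in> Omega_bar" for x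
    using pd_derivative_0[OF assms(1) that] pd_derivative_0[OF assms(2) that]
    by (intro has_vector_derivative_add bounded_linear.has_vector_derivative[OF bounded_linear_scaleR_right])
  from has_pdI[OF this] show "has_pd i (\<lambda>x. a *\<^sub>R f x + b *\<^sub>R g x)"
    "x \<in> Omega_bar \<Longrightarrow> pd i (\<lambda>x. a *\<^sub>R f x + b *\<^sub>R g x) x = a *\<^sub>R pd i f x + b *\<^sub>R pd i g x" by auto
qed

lemma Ck_linear: "Ck k f \<Longrightarrow> Ck k g \<Longrightarrow> Ck k (\<lambda>x. a *\<^sub>R f x + b *\<^sub>R g x)"
proof (induction k arbitrary: f g)
  case 0
  then show ?case by (auto intro!: continuous_intros)
next
  case (Suc k)
  then have pd: "has_pd i f" "has_pd i g" "Ck k (pd i f)" "Ck k (pd i g)" for i by auto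
  have "Ck k (\<lambda>x. a *\<^sub>R pd i f x + b *\<^sub>R pd i g x)" for i using Suc.IH pd by blast
  then have "Ck k (pd i (\<lambda>x. a *\<^sub>R f x + b *\<^sub>R g x))" for i
    by (subst Ck_cong[OF pd_linear(2)[OF pd(1,2)]]) auto
  then show ?case using Suc.prems pd_linear(1)[OF pd(1,2)] by (auto intro!: continuous_intros)
qed

lemma sup_norm_bound:
  assumes "continuous_on Omega_bar f" "x \<in> Omega_bar"
  shows "norm (f x) \<le> (SUP x\<in>Omega_bar. norm (f x))"
proof (rule cSUP_upper[OF assms(2)])
  have "compact ((\<lambda>x. norm (f x)) ` Omega_bar)"
    using assms by (intro compact_continuous_image continuous_intros) auto
  then show "bdd_above ((\<lambda>x. norm (f x)) ` Omega_bar)"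
    by (intro bounded_imp_bdd_above compact_imp_bounded)
qed

lemma sup_norm_nonneg: "continuous_on Omega_bar f \<Longrightarrow> 0 \<le> (SUP x\<in>Omega_bar. norm (f x))"
  using sup_norm_bound[OF _ zero_in_Omega_bar] norm_ge_zero order_trans by blast

lemma Ck_norm_nonneg: "Ck k f \<Longrightarrow> 0 \<le> Ck_norm k f"
  by (induction k arbitrary: f) (auto intro!: sup_norm_nonneg add_nonneg_nonneg sum_nonneg)

lemma norm_le_Ck_norm: "Ck k f \<Longrightarrow> x \<in> Omega_bar \<Longrightarrow> norm (f x) \<le> Ck_norm k f"
proof (cases k)
  case (Suc l)
  assume "Ck k f" "x \<in> Omega_bar"
  then have "norm (f x) \<le> (SUP x\<in>Omega_bar. norm (f x))" "0 \<le> (\<Sum>i\<in>UNIV. Ck_norm l (pd i f))"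
    using Suc by (auto intro!: sup_norm_bound sum_nonneg Ck_norm_nonneg)
  then show ?thesis using Suc by simp
qed (auto intro: sup_norm_bound)

lemma Ck_norm_pd_le:
  assumes "Ck (Suc k) f"
  shows "Ck_norm k (pd i f) \<le> Ck_norm (Suc k) f"
proof -
  have "Ck_norm k (pd i f) \<le> (\<Sum>i\<in>UNIV. Ck_norm k (pd i f))"
    using assms by (intro member_le_sum) (auto intro: Ck_norm_nonneg)
  moreover have "0 \<le> (SUP x\<in>Omega_bar. norm (f x))" using assms by (intro sup_norm_nonneg) auto
  ultimately show ?thesis by simp
qed

section \<open>Partial derivatives of time-dependent fields\<close>

lemma eventually_in_interval: "eventually (\<lambda>s. s \<in> {0..T}) (at t within {0..T})"
  by (simp add: eventually_at_filter)

text \<open>Taking a partial derivative is linear and does not increase the norm from order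
  \<open>k + 1\<close> to order \<open>k\<close>, hence commutes with limits in time. Linearity
  holds only on the cube and for differentiable arguments, which the congruence lemmas take care
  of.\<close>

lemma time_continuous_pd:
  assumes "time_continuous T (Suc k) u"
  shows "time_continuous T k (\<lambda>t. pd i (u t))"
  unfolding time_continuous_def
proof (intro ballI conjI)
  fix t assume t: "t \<in> {0..T}"
  have C: "Ck (Suc k) (u s)" if "s \<in> {0..T}" for s using assms that by (simp only: time_continuous_def)
  then show "Ck k (pd i (u t))" using t by simp
  have lim: "((\<lambda>s. Ck_norm (Suc k) (\<lambda>x. u s x - u t x)) \<longlongrightarrow> 0) (at t within {0..T})"
    using assms t by (simp only: time_continuous_def)
  have diff: "Ck (Suc k) (\<lambda>x. u s x - u t x)" and
    eq: "Ck_norm k (\<lambda>x. pd i (u s) x - pd i (u t) x) = Ck_norm k (pd i (\<lambda>x. u s x - u t x))"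
    and C': "Ck k (\<lambda>x. pd i (u s) x - pd i (u t) x)" if s: "s \<in> {0..T}" for s
  proof -
    have "Ck (Suc k) (\<lambda>x. 1 *\<^sub>R u s x + (-1) *\<^sub>R u t x)" using C[OF s] C[OF t] by (rule Ck_linear)
    then show "Ck (Suc k) (\<lambda>x. u s x - u t x)" by simp
    have "has_pd i (u s)" "has_pd i (u t)" using C[OF s] C[OF t] by auto
    then show "Ck_norm k (\<lambda>x. pd i (u s) x - pd i (u t) x) = Ck_norm k (pd i (\<lambda>x. u s x - u t x))"
      using pd_linear(2)[of i "u s" "u t" _ 1 "-1"] by (intro Ck_norm_cong) simp
    have "Ck k (\<lambda>x. 1 *\<^sub>R pd i (u s) x + (-1) *\<^sub>R pd i (u t) x)" using C[OF s] C[OF t] by (intro Ck_linear) auto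
    then show "Ck k (\<lambda>x. pd i (u s) x - pd i (u t) x)" by simp
  qed
  have b: "0 \<le> Ck_norm k (\<lambda>x. pd i (u s) x - pd i (u t) x)"
    "Ck_norm k (\<lambda>x. pd i (u s) x - pd i (u t) x) \<le> Ck_norm (Suc k) (\<lambda>x. u s x - u t x)"
    if "s \<in> {0..T}" for s
    by (rule Ck_norm_nonneg[OF C'[OF that]]) (simp only: eq[OF that] Ck_norm_pd_le[OF diff[OF that]])
  show "((\<lambda>s. Ck_norm k (\<lambda>x. pd i (u s) x - pd i (u t) x)) \<longlongrightarrow> 0) (at t within {0..T})"
    by (rule tendsto_sandwich[OF _ _ tendsto_const lim]; rule eventually_mono[OF eventually_in_interval])
       (simp_all only: b)
qed

text \<open>The same argument for difference quotients; it is the source of every exchange of time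
  and space derivatives of the exact solution.\<close>

lemma time_derivative_pd:
  assumes "\<And>t. t \<in> {0..T} \<Longrightarrow> Ck (Suc k) (u t)" "time_derivative T (Suc k) u v"
  shows "time_derivative T k (\<lambda>t. pd i (u t)) (\<lambda>t. pd i (v t))"
  unfolding time_derivative_def
proof (intro ballI conjI)
  fix t assume t: "t \<in> {0..T}"
  have C: "Ck (Suc k) (u s)" if "s \<in> {0..T}" for s using assms that by blast
  have Cv: "Ck (Suc k) (v t)" using assms(2) t by (simp only: time_derivative_def)
  then show "Ck k (pd i (v t))" by simp
  have lim: "((\<lambda>s. Ck_norm (Suc k) (\<lambda>x. (u s x - u t x) /\<^sub>R (s - t) - v t x)) \<longlongrightarrow> 0) (at t within {0..T})"
    using assms t by (simp only: time_derivative_def)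
  have diff: "Ck (Suc k) (\<lambda>x. (u s x - u t x) /\<^sub>R (s - t) - v t x)" and
    eq: "Ck_norm k (\<lambda>x. (pd i (u s) x - pd i (u t) x) /\<^sub>R (s - t) - pd i (v t) x)
       = Ck_norm k (pd i (\<lambda>x. (u s x - u t x) /\<^sub>R (s - t) - v t x))"
    and C': "Ck k (\<lambda>x. (pd i (u s) x - pd i (u t) x) /\<^sub>R (s - t) - pd i (v t) x)" if s: "s \<in> {0..T}" for s
  proof -
    let ?q = "\<lambda>x. inverse (s - t) *\<^sub>R u s x + (- inverse (s - t)) *\<^sub>R u t x"
    have q: "Ck (Suc k) ?q" using C[OF s] C[OF t] by (rule Ck_linear)
    then have "Ck (Suc k) (\<lambda>x. 1 *\<^sub>R ?q x + (-1) *\<^sub>R v t x)" using Cv by (rule Ck_linear)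
    moreover have e: "(\<lambda>x. (u s x - u t x) /\<^sub>R (s - t) - v t x) = (\<lambda>x. 1 *\<^sub>R ?q x + (-1) *\<^sub>R v t x)"
      by (simp add: fun_eq_iff scaleR_diff_right)
    ultimately show "Ck (Suc k) (\<lambda>x. (u s x - u t x) /\<^sub>R (s - t) - v t x)" by simp
    have h: "has_pd i (u s)" "has_pd i (u t)" "has_pd i (v t)" using C[OF s] C[OF t] Cv by auto
    show "Ck_norm k (\<lambda>x. (pd i (u s) x - pd i (u t) x) /\<^sub>R (s - t) - pd i (v t) x)
       = Ck_norm k (pd i (\<lambda>x. (u s x - u t x) /\<^sub>R (s - t) - v t x))"
    proof (rule Ck_norm_cong)
      fix x :: "real ^ 'a" assume x: "x \<in> Omega_bar"
      show "(pd i (u s) x - pd i (u t) x) /\<^sub>R (s - t) - pd i (v t) x = pd i (\<lambda>x. (u s x - u t x) /\<^sub>R (s - t) - v t x) x"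
        unfolding e pd_linear(2)[OF pd_linear(1)[OF h(1,2)] h(3) x] pd_linear(2)[OF h(1,2) x]
        by (simp add: scaleR_diff_right)
    qed
    have "Ck k (\<lambda>x. inverse (s - t) *\<^sub>R pd i (u s) x + (- inverse (s - t)) *\<^sub>R pd i (u t) x)"
      using C[OF s] C[OF t] by (intro Ck_linear) auto
    then have "Ck k (\<lambda>x. 1 *\<^sub>R (inverse (s - t) *\<^sub>R pd i (u s) x + (- inverse (s - t)) *\<^sub>R pd i (u t) x) + (-1) *\<^sub>R pd i (v t) x)"
      using C[OF s] C[OF t] Cv by (intro Ck_linear) auto
    then show "Ck k (\<lambda>x. (pd i (u s) x - pd i (u t) x) /\<^sub>R (s - t) - pd i (v t) x)"
      by (simp add: scaleR_diff_right)
  qed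
  have b: "0 \<le> Ck_norm k (\<lambda>x. (pd i (u s) x - pd i (u t) x) /\<^sub>R (s - t) - pd i (v t) x)"
    "Ck_norm k (\<lambda>x. (pd i (u s) x - pd i (u t) x) /\<^sub>R (s - t) - pd i (v t) x) \<le> Ck_norm (Suc k) (\<lambda>x. (u s x - u t x) /\<^sub>R (s - t) - v t x)"
    if "s \<in> {0..T}" for s
    by (rule Ck_norm_nonneg[OF C'[OF that]]) (simp only: eq[OF that] Ck_norm_pd_le[OF diff[OF that]])
  show "((\<lambda>s. Ck_norm k (\<lambda>x. (pd i (u s) x - pd i (u t) x) /\<^sub>R (s - t) - pd i (v t) x)) \<longlongrightarrow> 0) (at t within {0..T})"
    by (rule tendsto_sandwich[OF _ _ tendsto_const lim]; rule eventually_mono[OF eventually_in_interval])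
       (simp_all only: b)
qed

lemma time_derivative_pointwise:
  assumes "\<And>t. t \<in> {0..T} \<Longrightarrow> Ck k (u t)" "time_derivative T k u v" "t \<in> {0..T}" "x \<in> Omega_bar"
  shows "((\<lambda>s. u s x) has_vector_derivative v t x) (at t within {0..T})"
proof -
  have lim: "((\<lambda>s. Ck_norm k (\<lambda>x. (u s x - u t x) /\<^sub>R (s - t) - v t x)) \<longlongrightarrow> 0) (at t within {0..T})"
    and Cv: "Ck k (v t)"
    using assms by (simp_all only: time_derivative_def)
  have C: "Ck k (\<lambda>x. (u s x - u t x) /\<^sub>R (s - t) - v t x)" if s: "s \<in> {0..T}" for s
  proof -
    have "Ck k (\<lambda>x. 1 *\<^sub>R (inverse (s - t) *\<^sub>R u s x + (- inverse (s - t)) *\<^sub>R u t x) + (-1) *\<^sub>R v t x)"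
      using assms(1)[OF s] assms(1)[OF assms(3)] Cv by (intro Ck_linear)
    then show ?thesis by (simp add: scaleR_diff_right)
  qed
  have "((\<lambda>s. norm ((u s x - u t x) /\<^sub>R (s - t) - v t x)) \<longlongrightarrow> 0) (at t within {0..T})"
    by (rule tendsto_sandwich[OF _ _ tendsto_const lim]; rule eventually_mono[OF eventually_in_interval])
       (use C norm_le_Ck_norm assms(4) in auto)
  then have "((\<lambda>s. norm ((1 / norm (s - t)) *\<^sub>R (u s x - (u t x + (s - t) *\<^sub>R v t x)))) \<longlongrightarrow> 0) (at t within {0..T})"
  proof (rule Lim_transform_within[OF _ zero_less_one])
    fix s assume "0 < dist s t"
    then have "s \<noteq> t" by auto
    then have "(u s x - u t x) /\<^sub>R (s - t) - v t x = (1 / (s - t)) *\<^sub>R (u s x - (u t x + (s - t) *\<^sub>R v t x))"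
      by (simp add: scaleR_diff_right scaleR_add_right inverse_eq_divide)
    then show "norm ((u s x - u t x) /\<^sub>R (s - t) - v t x) = norm ((1 / norm (s - t)) *\<^sub>R (u s x - (u t x + (s - t) *\<^sub>R v t x)))"
      by simp
  qed
  then show ?thesis
    unfolding has_vector_derivative_def has_derivative_within
    by (auto intro!: bounded_linear_scaleR_left simp only: tendsto_norm_zero_iff)
qed

text \<open>Continuity in time is uniform in space and each time slice is continuous, so the field
  is jointly continuous on a compact set.\<close>

lemma time_continuous_bounded:
  fixes u :: "real \<Rightarrow> real ^ 'd \<Rightarrow> real ^ 3"
  assumes "time_continuous T k u"
  obtains M where "\<And>t x. t \<in> {0..T} \<Longrightarrow> x \<in> Omega_bar \<Longrightarrow> norm (u t x) \<le> M"
proof -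
  let ?K = "Sigma {0..T} (\<lambda>_. Omega_bar :: (real ^ 'd) set)"
  have C: "Ck k (u s)" if "s \<in> {0..T}" for s using assms that by (simp only: time_continuous_def)
  have "continuous_on ?K (\<lambda>(t, x). u t x)"
    unfolding continuous_on_iff
  proof (intro ballI allI impI)
    fix p and \<epsilon> :: real
    assume p: "p \<in> ?K" and e: "0 < \<epsilon>"
    obtain t x where tx: "p = (t, x)" "t \<in> {0..T}" "x \<in> Omega_bar" using p by auto
    have "((\<lambda>s. Ck_norm k (\<lambda>x. u s x - u t x)) \<longlongrightarrow> 0) (at t within {0..T})"
      using assms tx by (simp only: time_continuous_def)
    then have "eventually (\<lambda>s. dist (Ck_norm k (\<lambda>x. u s x - u t x)) 0 < \<epsilon> / 2) (at t within {0..T})"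
      using e half_gt_zero tendstoD by blast
    then obtain d1 where d1: "0 < d1"
      "\<And>s. s \<in> {0..T} \<Longrightarrow> s \<noteq> t \<Longrightarrow> dist s t < d1 \<Longrightarrow> \<bar>Ck_norm k (\<lambda>x. u s x - u t x)\<bar> < \<epsilon> / 2"
      unfolding eventually_at by (auto simp: dist_norm)
    have "continuous_on Omega_bar (u t)" using C[OF tx(2)] by (rule Ck_continuous)
    then obtain d2 where d2: "0 < d2" "\<And>y. y \<in> Omega_bar \<Longrightarrow> dist y x < d2 \<Longrightarrow> dist (u t y) (u t x) < \<epsilon> / 2"
      using e tx(3) unfolding continuous_on_iff by (meson half_gt_zero)
    show "\<exists>d>0. \<forall>q\<in>?K. dist q p < d \<longrightarrow> dist (case q of (t, x) \<Rightarrow> u t x) (case p of (t, x) \<Rightarrow> u t x) < \<epsilon>"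
    proof (intro exI[of _ "min d1 d2"] conjI ballI impI)
      show "0 < min d1 d2" using d1 d2 by simp
      fix q assume q: "q \<in> ?K" "dist q p < min d1 d2"
      obtain s y where sy: "q = (s, y)" "s \<in> {0..T}" "y \<in> Omega_bar" using q by auto
      have ds: "dist s t < d1" "dist y x < d2"
        using q(2) dist_fst_le[of q p] dist_snd_le[of q p] sy tx by auto
      have "norm (u s y - u t y) < \<epsilon> / 2"
      proof (cases "s = t")
        case False
        have "Ck k (\<lambda>x. 1 *\<^sub>R u s x + (-1) *\<^sub>R u t x)" using C sy tx by (intro Ck_linear) auto
        then have "Ck k (\<lambda>x. u s x - u t x)" by simp
        from norm_le_Ck_norm[OF this sy(3)] d1(2)[OF sy(2) False ds(1)] show ?thesis by linarith
      qed (use e in simp)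
      moreover have "norm (u t y - u t x) < \<epsilon> / 2" using d2(2)[OF sy(3) ds(2)] by (simp add: dist_norm)
      ultimately have "norm (u s y - u t x) < \<epsilon>"
        using norm_triangle_ineq[of "u s y - u t y" "u t y - u t x"] by simp
      then show "dist (case q of (t, x) \<Rightarrow> u t x) (case p of (t, x) \<Rightarrow> u t x) < \<epsilon>"
        by (simp add: sy tx dist_norm)
    qed
  qed
  moreover have "compact ?K" by (intro compact_Times) auto
  ultimately have "bounded ((\<lambda>(t, x). u t x) ` ?K)"
    by (intro compact_imp_bounded compact_continuous_image)
  then obtain M where "\<forall>t\<in>{0..T}. \<forall>x\<in>Omega_bar. norm (u t x) \<le> M" by (auto simp: bounded_iff)
  then show ?thesis by (intro that[of M]) auto
qed

lemma Ck_Suc_imp: "Ck (Suc k) f \<Longrightarrow> Ck k f"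
  by (induction k arbitrary: f) auto

lemma derivative_increments_unique:
  assumes "x \<in> Omega_bar" "(\<phi> has_vector_derivative D) (at 0 within increments i x)"
    "(\<phi> has_vector_derivative D') (at 0 within increments i x)"
  shows "D = D'"
proof (rule vector_derivative_unique_within_closed_interval)
  show "- x $ i < 1 - x $ i" by simp
  show "0 \<in> cbox (- x $ i) (1 - x $ i)"
    using assms(1) by (simp add: mem_Omega_bar)
  show "(\<phi> has_vector_derivative D) (at 0 within cbox (- x $ i) (1 - x $ i))"
    "(\<phi> has_vector_derivative D') (at 0 within cbox (- x $ i) (1 - x $ i))"
    using assms by (simp_all add: increments_eq)
qed

section \<open>Symmetry of mixed partial derivatives up to the boundary\<close>

text \<open>From every point of the cube a step of length up to \<open>1 / 2\<close> in this
  direction stays inside, so that rectangles can be attached even at boundary points and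
  corners.\<close>

definition inward :: "real ^ 'd \<Rightarrow> 'd \<Rightarrow> real" where
  "inward x i = (if x $ i \<le> 1 / 2 then 1 else - 1)"

lemma inward_abs: "\<bar>inward x i\<bar> = 1"
  by (simp add: inward_def)

lemma corner_in_Omega_bar:
  assumes "x \<in> Omega_bar" "i \<noteq> j" "0 \<le> s" "s \<le> 1 / 2" "0 \<le> t" "t \<le> 1 / 2"
  shows "x + (inward x i * s) *\<^sub>R axis i 1 + (inward x j * t) *\<^sub>R axis j 1 \<in> Omega_bar"
  unfolding mem_Omega_bar
proof
  fix l
  have x: "0 \<le> x $ l" "x $ l \<le> 1" using assms(1) by (auto simp: mem_Omega_bar)
  then show "0 \<le> (x + (inward x i * s) *\<^sub>R axis i 1 + (inward x j * t) *\<^sub>R axis j 1) $ l \<and>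
      (x + (inward x i * s) *\<^sub>R axis i 1 + (inward x j * t) *\<^sub>R axis j 1) $ l \<le> 1"
    using assms(2-) unfolding line_nth by (auto simp: inward_def)
qed

text \<open>The rectangle difference is treated by two mean value estimates: in direction
  \<open>j\<close> for \<open>pd i f\<close>, then in direction \<open>i\<close> for the increments
  of \<open>f\<close>. Continuity of the mixed derivative at \<open>x\<close> makes both deviations
  small.\<close>

lemma corner_difference:
  fixes f :: "real ^ 'd \<Rightarrow> real ^ 3"
  assumes "has_pd i f" "has_pd j (pd i f)" "continuous_on Omega_bar (pd j (pd i f))"
    and x: "x \<in> Omega_bar" and "i \<noteq> j" and "0 < \<epsilon>"
  obtains \<delta> where "0 < \<delta>" "\<And>r. 0 < r \<Longrightarrow> r < \<delta> \<Longrightarrow>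
    norm (f (x + (inward x i * r) *\<^sub>R axis i 1 + (inward x j * r) *\<^sub>R axis j 1) - f (x + (inward x i * r) *\<^sub>R axis i 1)
      - (f (x + (inward x j * r) *\<^sub>R axis j 1) - f x) - (inward x i * inward x j * r\<^sup>2) *\<^sub>R pd j (pd i f) x) \<le> \<epsilon> * r\<^sup>2"
proof -
  let ?a = "inward x i" and ?b = "inward x j" and ?D = "pd j (pd i f) x"
  let ?X = "\<lambda>s t. x + (?a * s) *\<^sub>R axis i 1 + (?b * t) *\<^sub>R axis j 1"
  have X: "?X s t \<in> Omega_bar" if "0 \<le> s" "s \<le> 1 / 2" "0 \<le> t" "t \<le> 1 / 2" for s t
    using corner_in_Omega_bar[OF x assms(5) that] .
  obtain \<eta> where eta: "0 < \<eta>" "\<And>y. y \<in> Omega_bar \<Longrightarrow> dist y x < \<eta> \<Longrightarrow> norm (pd j (pd i f) y - ?D) < \<epsilon>"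
    using assms(3) x assms(6) unfolding continuous_on_iff dist_norm by blast
  show thesis
  \<comment> \<open>Points of the rectangle are at distance at most \<open>2 * r\<close> from
    \<open>x\<close>, hence \<open>\<eta> / 2\<close>; the other bound keeps the rectangle in the
    cube.\<close>
  proof (rule that[of "min (1 / 2) (\<eta> / 2)"])
    show "0 < min (1 / 2) (\<eta> / 2)" using eta by simp
    fix r :: real assume r: "0 < r" "r < min (1 / 2) (\<eta> / 2)"
    have near: "norm (pd j (pd i f) (?X s t) - ?D) \<le> \<epsilon>" if "s \<in> {0..r}" "t \<in> {0..r}" for s t
    proof -
      have "dist (?X s t) x = norm ((?a * s) *\<^sub>R axis i (1::real) + (?b * t) *\<^sub>R axis j 1)"
        by (simp add: dist_norm add.assoc)
      also have "\<dots> \<le> s + t"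
        using norm_triangle_ineq[of "(?a * s) *\<^sub>R axis i (1::real)" "(?b * t) *\<^sub>R axis j 1"] that
        by (simp add: abs_mult inward_abs)
      also have "\<dots> < \<eta>" using that r by simp
      finally show ?thesis using eta(2)[OF X] that r by (simp add: less_imp_le)
    qed
    have g': "norm (pd i f (?X s r) - pd i f (?X s 0) - (?b * r) *\<^sub>R ?D) \<le> \<epsilon> * r" if s: "s \<in> {0..r}" for s
    proof -
      have "norm ((\<lambda>t. pd i f (?X s t) - (?b * t) *\<^sub>R ?D) r - (\<lambda>t. pd i f (?X s t) - (?b * t) *\<^sub>R ?D) 0) \<le> \<epsilon> * (r - 0)"
      proof (rule increment_bound[where g' = "\<lambda>t. ?b *\<^sub>R pd j (pd i f) (?X s t) - ?b *\<^sub>R ?D"])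
        fix t assume t: "t \<in> {0..r}"
        have "((\<lambda>t. pd i f (?X s t)) has_vector_derivative ?b *\<^sub>R pd j (pd i f) (?X s t)) (at t within {0..r})"
          by (rule signed_line[OF assms(2)]) (use X[of s 0] X[of s] s t r in auto)
        moreover have "((\<lambda>t. (?b * t) *\<^sub>R ?D) has_vector_derivative ?b *\<^sub>R ?D) (at t within {0..r})"
          by (auto intro!: derivative_eq_intros simp: has_vector_derivative_def fun_eq_iff)
        ultimately show "((\<lambda>t. pd i f (?X s t) - (?b * t) *\<^sub>R ?D) has_vector_derivative ?b *\<^sub>R pd j (pd i f) (?X s t) - ?b *\<^sub>R ?D) (at t within {0..r})"
          by (rule has_vector_derivative_diff)
        have "norm (?b *\<^sub>R pd j (pd i f) (?X s t) - ?b *\<^sub>R ?D) = norm (pd j (pd i f) (?X s t) - ?D)"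
          unfolding scaleR_diff_right[symmetric] by (simp add: inward_abs)
        then show "norm (?b *\<^sub>R pd j (pd i f) (?X s t) - ?b *\<^sub>R ?D) \<le> \<epsilon>" using near[OF s t] by simp
      qed (use r in auto)
      then show ?thesis by (simp add: algebra_simps)
    qed
    have F1: "norm ((\<lambda>s. f (?X s r) - f (?X s 0) - (?a * s) *\<^sub>R (?b * r) *\<^sub>R ?D) r
        - (\<lambda>s. f (?X s r) - f (?X s 0) - (?a * s) *\<^sub>R (?b * r) *\<^sub>R ?D) 0) \<le> (\<epsilon> * r) * (r - 0)"
    proof (rule increment_bound[where g' = "\<lambda>s. ?a *\<^sub>R pd i f (?X s r) - ?a *\<^sub>R pd i f (?X s 0) - ?a *\<^sub>R (?b * r) *\<^sub>R ?D"])
      fix s assume s: "s \<in> {0..r}"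
      have line: "((\<lambda>s. f (?X s t)) has_vector_derivative ?a *\<^sub>R pd i f (?X s t)) (at s within {0..r})" if t: "t \<in> {0..r}" for t
      proof -
        have "((\<lambda>s. f (x + (?b * t) *\<^sub>R axis j 1 + (?a * s) *\<^sub>R axis i 1)) has_vector_derivative
            ?a *\<^sub>R pd i f (x + (?b * t) *\<^sub>R axis j 1 + (?a * s) *\<^sub>R axis i 1)) (at s within {0..r})"
          by (rule signed_line[OF assms(1)]) (use X[of 0 t] X[of _ t] s t r in \<open>auto simp: add_ac\<close>)
        then show ?thesis by (simp add: add_ac)
      qed
      have "((\<lambda>s. (?a * s) *\<^sub>R (?b * r) *\<^sub>R ?D) has_vector_derivative ?a *\<^sub>R (?b * r) *\<^sub>R ?D) (at s within {0..r})"
        by (auto intro!: derivative_eq_intros simp: has_vector_derivative_def fun_eq_iff)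
      then show "((\<lambda>s. f (?X s r) - f (?X s 0) - (?a * s) *\<^sub>R (?b * r) *\<^sub>R ?D) has_vector_derivative
          ?a *\<^sub>R pd i f (?X s r) - ?a *\<^sub>R pd i f (?X s 0) - ?a *\<^sub>R (?b * r) *\<^sub>R ?D) (at s within {0..r})"
        using r by (intro has_vector_derivative_diff line) auto
      have "norm (?a *\<^sub>R pd i f (?X s r) - ?a *\<^sub>R pd i f (?X s 0) - ?a *\<^sub>R (?b * r) *\<^sub>R ?D)
          = norm (pd i f (?X s r) - pd i f (?X s 0) - (?b * r) *\<^sub>R ?D)"
        unfolding scaleR_diff_right[symmetric] by (simp add: inward_abs)
      then show "norm (?a *\<^sub>R pd i f (?X s r) - ?a *\<^sub>R pd i f (?X s 0) - ?a *\<^sub>R (?b * r) *\<^sub>R ?D) \<le> \<epsilon> * r"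
        using g'[OF s] by simp
    qed (use r in auto)
    have F2: "(\<lambda>s. f (?X s r) - f (?X s 0) - (?a * s) *\<^sub>R (?b * r) *\<^sub>R ?D) r
        - (\<lambda>s. f (?X s r) - f (?X s 0) - (?a * s) *\<^sub>R (?b * r) *\<^sub>R ?D) 0
      = f (?X r r) - f (x + (?a * r) *\<^sub>R axis i 1) - (f (x + (?b * r) *\<^sub>R axis j 1) - f x)
        - (?a * ?b * r\<^sup>2) *\<^sub>R ?D"
      by (simp add: power2_eq_square mult_ac diff_right_commute)
    show "norm (f (?X r r) - f (x + (?a * r) *\<^sub>R axis i 1)
      - (f (x + (?b * r) *\<^sub>R axis j 1) - f x) - (?a * ?b * r\<^sup>2) *\<^sub>R ?D) \<le> \<epsilon> * r\<^sup>2"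
      using F1 unfolding F2 by (simp only: power2_eq_square mult.assoc diff_0_right)
  qed
qed

text \<open>The rectangle difference is symmetric in the two directions, while each order of
  differentiation is its limit after division by \<open>r\<^sup>2\<close>. Rectangles pointing
  inward make this valid for one-sided derivatives on the boundary too.\<close>

lemma pd_commute:
  fixes f :: "real ^ 'd \<Rightarrow> real ^ 3"
  assumes f: "Ck 2 f" and x: "x \<in> Omega_bar"
  shows "pd i (pd j f) x = pd j (pd i f) x"
proof (cases "i = j")
  case False
  have pd: "has_pd i f" "has_pd j (pd i f)" "continuous_on Omega_bar (pd j (pd i f))" for i j
    using f by (auto simp: numeral_2_eq_2)
  let ?a = "inward x i" and ?b = "inward x j"
  have "norm (pd i (pd j f) x - pd j (pd i f) x) \<le> 2 * \<epsilon>" if e: "0 < \<epsilon>" for \<epsilon>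
  proof -
    obtain d1 where d1: "0 < d1" "\<And>r. 0 < r \<Longrightarrow> r < d1 \<Longrightarrow>
      norm (f (x + (?a * r) *\<^sub>R axis i 1 + (?b * r) *\<^sub>R axis j 1) - f (x + (?a * r) *\<^sub>R axis i 1)
      - (f (x + (?b * r) *\<^sub>R axis j 1) - f x) - (?a * ?b * r\<^sup>2) *\<^sub>R pd j (pd i f) x) \<le> \<epsilon> * r\<^sup>2"
      using corner_difference[OF pd(1)[where i = i] pd(2)[where i = i and j = j] pd(3)[where i = i and j = j] x False e] by blast
    obtain d2 where d2: "0 < d2" "\<And>r. 0 < r \<Longrightarrow> r < d2 \<Longrightarrow>
      norm (f (x + (?b * r) *\<^sub>R axis j 1 + (?a * r) *\<^sub>R axis i 1) - f (x + (?b * r) *\<^sub>R axis j 1)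
      - (f (x + (?a * r) *\<^sub>R axis i 1) - f x) - (?b * ?a * r\<^sup>2) *\<^sub>R pd i (pd j f) x) \<le> \<epsilon> * r\<^sup>2"
      using corner_difference[OF pd(1)[where i = j] pd(2)[where i = j and j = i] pd(3)[where i = j and j = i] x False[symmetric] e] by blast
    define r where "r = min d1 d2 / 2"
    have r: "0 < r" "r < d1" "r < d2" using d1 d2 by (auto simp: r_def)
    let ?S = "f (x + (?a * r) *\<^sub>R axis i 1 + (?b * r) *\<^sub>R axis j 1) - f (x + (?a * r) *\<^sub>R axis i 1)
      - (f (x + (?b * r) *\<^sub>R axis j 1) - f x)"
    have S: "f (x + (?b * r) *\<^sub>R axis j 1 + (?a * r) *\<^sub>R axis i 1) - f (x + (?b * r) *\<^sub>R axis j 1)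
      - (f (x + (?a * r) *\<^sub>R axis i 1) - f x) = ?S"
      by (simp add: add_ac)
    have 1: "norm (?S - (?a * ?b * r\<^sup>2) *\<^sub>R pd j (pd i f) x) \<le> \<epsilon> * r\<^sup>2" by (rule d1(2)[OF r(1,2)])
    have 2: "norm (?S - (?a * ?b * r\<^sup>2) *\<^sub>R pd i (pd j f) x) \<le> \<epsilon> * r\<^sup>2"
      using d2(2)[OF r(1,3)] unfolding S by (simp only: mult.commute[of ?b ?a])
    have eq: "(?a * ?b * r\<^sup>2) *\<^sub>R (pd i (pd j f) x - pd j (pd i f) x)
       = (?S - (?a * ?b * r\<^sup>2) *\<^sub>R pd j (pd i f) x) - (?S - (?a * ?b * r\<^sup>2) *\<^sub>R pd i (pd j f) x)"
    proof -
      have "p - q = (u - q) - (u - p)" for p q u :: "real ^ 3" by simp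
      then show ?thesis unfolding scaleR_diff_right by blast
    qed
    have "norm ((?a * ?b * r\<^sup>2) *\<^sub>R (pd i (pd j f) x - pd j (pd i f) x)) \<le> \<epsilon> * r\<^sup>2 + \<epsilon> * r\<^sup>2"
      unfolding eq by (rule order_trans[OF norm_triangle_ineq4 add_mono[OF 1 2]])
    then have "r\<^sup>2 * norm (pd i (pd j f) x - pd j (pd i f) x) \<le> r\<^sup>2 * (2 * \<epsilon>)"
      by (simp add: abs_mult inward_abs mult_ac)
    then show ?thesis using r(1) by simp
  qed
  \<comment> \<open>With a quarter of the norm as \<open>\<epsilon>\<close>, the bound says that the
    norm is at most half of itself.\<close>
  from this[of "norm (pd i (pd j f) x - pd j (pd i f) x) / 4"]
  have "\<not> 0 < norm (pd i (pd j f) x - pd j (pd i f) x)" by auto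
  then show ?thesis by simp
qed simp

section \<open>Neumann conditions\<close>

definition onface :: "'d \<Rightarrow> real \<Rightarrow> real ^ 'd \<Rightarrow> bool" where
  "onface i c x \<longleftrightarrow> x $ i = c \<and> (\<forall>l. l \<noteq> i \<longrightarrow> 0 < x $ l \<and> x $ l < 1)"

text \<open>Only relative interiors of faces occur, where a normal exists. This is enough for the
  scheme, since the grid lines through cell centres leave the cube exactly there.\<close>

definition neumann :: "(real ^ 'd \<Rightarrow> real ^ 3) \<Rightarrow> bool" where
  "neumann f \<longleftrightarrow> (\<forall>i c x. c \<in> {0, 1} \<longrightarrow> onface i c x \<longrightarrow> pd i f x = 0)"

lemma onface_Omega_bar: "onface i c x \<Longrightarrow> c \<in> {0, 1} \<Longrightarrow> x \<in> Omega_bar"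
  unfolding mem_Omega_bar onface_def by (metis insert_iff less_eq_real_def order_refl singletonD zero_le_one)

lemma neumannI:
  assumes "\<And>x v. outward_normal x v \<Longrightarrow> (\<Sum>i\<in>UNIV. v $ i *\<^sub>R pd i f x) = 0"
  shows "neumann f"
  unfolding neumann_def
proof (intro allI impI)
  fix i :: 'a and c x assume c: "c \<in> {0, 1::real}" and x: "onface i c x"
  define v :: "real ^ 'a" where "v = (if c = 0 then - axis i 1 else axis i 1)"
  have "outward_normal x v" using c x by (auto simp: outward_normal_def onface_def v_def)
  then have "(\<Sum>l\<in>UNIV. v $ l *\<^sub>R pd l f x) = 0" by (rule assms)
  moreover have "v $ l *\<^sub>R pd l f x = (if l = i then (if c = 0 then - 1 else 1) *\<^sub>R pd i f x else 0)" for l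
    by (simp add: v_def axis_def)
  ultimately show "pd i f x = 0" by (simp split: if_splits)
qed

text \<open>The face is relatively open, so small tangential steps stay on it and meet only zeros of
  \<open>g\<close>.\<close>

lemma pd_tangential_zero:
  assumes g: "\<And>y. onface i c y \<Longrightarrow> g y = 0" and "has_pd j g" "j \<noteq> i" "c \<in> {0, 1}" "onface i c x"
  shows "pd j g x = 0"
proof -
  have x: "x \<in> Omega_bar" using assms onface_Omega_bar by blast
  have xj: "0 < x $ j" "x $ j < 1" using assms by (auto simp: onface_def)
  have "((\<lambda>s. 0) has_vector_derivative pd j g x) (at 0 within increments j x)"
  proof (rule has_vector_derivative_transform_within[OF pd_derivative_0[OF assms(2) x]])
    show "0 < min (x $ j) (1 - x $ j)" using xj by simp
    show "0 \<in> increments j x" using x by (simp add: increments_def)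
    fix s assume "s \<in> increments j x" "dist s 0 < min (x $ j) (1 - x $ j)"
    then have "onface i c (x + s *\<^sub>R axis j 1)"
      using assms(3,5) unfolding onface_def line_nth by (auto simp: abs_if split: if_splits)
    then show "g (x + s *\<^sub>R axis j 1) = 0" by (rule g)
  qed
  then show ?thesis by (rule derivative_increments_unique[OF x]) (rule has_vector_derivative_const)
qed

text \<open>Differentiating \<open>f . f = 1\<close> twice in each direction gives the component of
  the Laplacian along \<open>f\<close> in terms of first derivatives.\<close>

lemma laplacian_of_unit_field:
  assumes f: "Ck 2 f" and unit: "\<And>x. x \<in> Omega_bar \<Longrightarrow> norm (f x) = 1" and x: "x \<in> Omega_bar"
  shows "f x \<bullet> laplacian f x = - (\<Sum>j\<in>UNIV. pd j f x \<bullet> pd j f x)"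
proof -
  have pd: "has_pd j f" "has_pd j (pd j f)" for j using f by (auto simp: numeral_2_eq_2)
  have 1: "f y \<bullet> pd j f y = 0" if y: "y \<in> Omega_bar" for y j
  proof -
    have "((\<lambda>s. f (y + s *\<^sub>R axis j 1) \<bullet> f (y + s *\<^sub>R axis j 1)) has_vector_derivative
        f (y + 0 *\<^sub>R axis j 1) \<bullet> pd j f y + pd j f y \<bullet> f (y + 0 *\<^sub>R axis j 1)) (at 0 within increments j y)"
      by (rule bounded_bilinear.has_vector_derivative[OF bounded_bilinear_inner pd_derivative_0[OF pd(1) y] pd_derivative_0[OF pd(1) y]])
    then have "((\<lambda>s. 1) has_vector_derivative f (y + 0 *\<^sub>R axis j 1) \<bullet> pd j f y + pd j f y \<bullet> f (y + 0 *\<^sub>R axis j 1)) (at 0 within increments j y)"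
      by (rule has_vector_derivative_transform[rotated 2])
         (use y unit in \<open>simp_all add: increments_def power2_norm_eq_inner[symmetric]\<close>)
    then have "f (y + 0 *\<^sub>R axis j 1) \<bullet> pd j f y + pd j f y \<bullet> f (y + 0 *\<^sub>R axis j 1) = 0"
      by (rule derivative_increments_unique[OF y]) (rule has_vector_derivative_const)
    then show ?thesis by (simp add: inner_commute)
  qed
  have 2: "f x \<bullet> pd j (pd j f) x = - (pd j f x \<bullet> pd j f x)" for j
  proof -
    have "((\<lambda>s. f (x + s *\<^sub>R axis j 1) \<bullet> pd j f (x + s *\<^sub>R axis j 1)) has_vector_derivative
        f (x + 0 *\<^sub>R axis j 1) \<bullet> pd j (pd j f) x + pd j f x \<bullet> pd j f (x + 0 *\<^sub>R axis j 1)) (at 0 within increments j x)"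
      by (rule bounded_bilinear.has_vector_derivative[OF bounded_bilinear_inner pd_derivative_0[OF pd(1) x] pd_derivative_0[OF pd(2) x]])
    then have "((\<lambda>s. 0) has_vector_derivative f (x + 0 *\<^sub>R axis j 1) \<bullet> pd j (pd j f) x + pd j f x \<bullet> pd j f (x + 0 *\<^sub>R axis j 1)) (at 0 within increments j x)"
      by (rule has_vector_derivative_transform[rotated 2]) (use x 1 in \<open>simp_all add: increments_def\<close>)
    then have "f (x + 0 *\<^sub>R axis j 1) \<bullet> pd j (pd j f) x + pd j f x \<bullet> pd j f (x + 0 *\<^sub>R axis j 1) = 0"
      by (rule derivative_increments_unique[OF x]) (rule has_vector_derivative_const)
    then show ?thesis by simp
  qed
  show ?thesis by (simp add: laplacian_def inner_sum_right 2 sum_negf)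
qed

lemma continuous_on_laplacian: "Ck 2 f \<Longrightarrow> continuous_on Omega_bar (laplacian f)"
  unfolding laplacian_def by (auto intro!: continuous_intros simp: numeral_2_eq_2)

text \<open>The equation determines \<open>laplacian f\<close> from lower order terms, all of which have vanishing
  normal derivative on the boundary; hence so has \<open>laplacian f\<close>, and the tangential part of the
  Laplacian does not contribute.\<close>

lemma third_normal_derivative_zero:
  assumes f: "Ck 4 f" "neumann f" and v: "Ck 1 v" "neumann v" and w: "Ck 1 w" "neumann w"
    and unit: "\<And>x. x \<in> Omega_bar \<Longrightarrow> norm (f x) = 1"
    and eq: "\<And>x. x \<in> Omega \<Longrightarrow> v x = - cross3 (f x) (laplacian f x) + \<alpha> *\<^sub>R cross3 (f x) (v x + \<tau> *\<^sub>R w x)"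
    and c: "c \<in> {0, 1}" and b: "onface i c b"
  shows "pd i (pd i (pd i f)) b = 0"
proof -
  have bO: "b \<in> Omega_bar" using b c onface_Omega_bar by blast
  have f2: "Ck 2 f" and pf2: "Ck 2 (pd j f)" for j
    using f(1) by (auto simp: numeral_eq_Suc intro: Ck_Suc_imp)
  have hpd: "has_pd j f" "has_pd j (pd l f)" "has_pd j (pd l (pd m f))" for j l m
    using f(1) by (auto simp: numeral_eq_Suc)
  have hv: "has_pd i v" "has_pd i w" "continuous_on Omega_bar v" "continuous_on Omega_bar w" using v w by auto
  let ?\<sigma> = "\<lambda>x. \<Sum>j\<in>UNIV. pd j f x \<bullet> pd j f x"
  let ?G = "\<lambda>x. \<alpha> *\<^sub>R cross3 (f x) (v x + \<tau> *\<^sub>R w x) - v x"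
  let ?R = "\<lambda>x. - (?\<sigma> x *\<^sub>R f x) - cross3 (f x) (?G x)"
  \<comment> \<open>The equation gives only \<open>f x laplacian f\<close>. Crossing with
    \<open>f\<close> once more recovers the part of the Laplacian orthogonal to \<open>f\<close>,
    and the unit length provides the rest.\<close>
  have R: "laplacian f x = ?R x" if "x \<in> Omega" for x
  proof -
    have x: "x \<in> Omega_bar" using that by (auto simp: mem_Omega mem_Omega_bar less_imp_le)
    have "?G x = cross3 (f x) (laplacian f x)" using eq[OF that] by (simp add: algebra_simps)
    then have "cross3 (f x) (?G x) = (f x \<bullet> laplacian f x) *\<^sub>R f x - (f x \<bullet> f x) *\<^sub>R laplacian f x"
      by (simp only: Lagrange)
    moreover have "f x \<bullet> f x = 1" using unit[OF x] by (simp add: norm_eq_1)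
    ultimately show ?thesis using laplacian_of_unit_field[OF f2 unit x] by simp
  qed
  \<comment> \<open>The equation is available in the open cube only, but the normal derivative is
    taken on the boundary, so the representation is carried there by continuity.\<close>
  have "norm (laplacian f x - ?R x) \<le> 0" if "x \<in> Omega_bar" for x
  proof (rule continuous_le_on_closure[where f = "\<lambda>x. norm (laplacian f x - ?R x)"])
    have "(\<chi> l. 1 / 2) \<in> (Omega :: (real ^ 'a) set)" by (simp add: mem_Omega)
    then have cl: "closure Omega = (Omega_bar :: (real ^ 'a) set)" by (intro closure_box) blast
    then show "x \<in> closure Omega" using that by simp
    have "continuous_on Omega_bar (pd j f)" for j using pf2 by (rule Ck_continuous)
    then show "continuous_on (closure Omega) (\<lambda>x. norm (laplacian f x - ?R x))"
      unfolding cl using continuous_on_laplacian[OF f2] hv Ck_continuous[OF f2]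
      by (intro continuous_intros continuous_on_cross) auto
    show "norm (laplacian f x - ?R x) \<le> 0" if "x \<in> Omega" for x using R[OF that] by simp
  qed
  then have R': "laplacian f x = ?R x" if "x \<in> Omega_bar" for x using that by fastforce
  have pz: "pd i f b = 0" "pd i v b = 0" "pd i w b = 0"
    using f(2) v(2) w(2) c b unfolding neumann_def by blast+
  have tz: "pd j (pd i f) x = 0" if "j \<noteq> i" "onface i c x" for j x
    by (rule pd_tangential_zero[OF _ hpd(2) that(1) c that(2)]) (use f(2) c in \<open>auto simp: neumann_def\<close>)
  \<comment> \<open>For \<open>j = i\<close> the first factor vanishes by the Neumann condition;
    otherwise the second is, after exchanging derivatives, a tangential derivative of
    \<open>pd i f\<close>, which is zero on the face.\<close>
  have mixed: "pd j f b \<bullet> pd i (pd j f) b = 0" for j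
  proof (cases "j = i")
    case False
    have "pd i (pd j f) b = pd j (pd i f) b" by (rule pd_commute[OF f2 bO])
    then show ?thesis using tz[OF False b] by simp
  qed (simp add: pz)
  have line: "((\<lambda>s. g (b + s *\<^sub>R axis i 1)) has_vector_derivative D) (at 0 within increments i b)"
    if "has_pd i g" "pd i g b = D" for g D
    using pd_derivative_0[OF that(1) bO] that(2) by simp
  have b0: "b + 0 *\<^sub>R axis i 1 = b" by simp
  have ds: "((\<lambda>s. ?\<sigma> (b + s *\<^sub>R axis i 1)) has_vector_derivative 0) (at 0 within increments i b)"
  proof -
    have "((\<lambda>s. pd j f (b + s *\<^sub>R axis i 1) \<bullet> pd j f (b + s *\<^sub>R axis i 1)) has_vector_derivative 0) (at 0 within increments i b)" for j
      using bounded_bilinear.has_vector_derivative[OF bounded_bilinear_inner line[OF hpd(2) refl] line[OF hpd(2) refl], of j j]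
      unfolding b0 by (simp add: mixed inner_commute)
    then have "((\<lambda>s. ?\<sigma> (b + s *\<^sub>R axis i 1)) has_vector_derivative (\<Sum>j\<in>(UNIV::'a set). 0)) (at 0 within increments i b)"
      by (rule has_vector_derivative_sum)
    then show ?thesis by simp
  qed
  note df = line[OF hpd(1) pz(1)] and dv = line[OF hv(1) pz(2)] and dw = line[OF hv(2) pz(3)]
  have bcross: "bounded_bilinear cross3"
    using bilinear_cross bilinear_conv_bounded_bilinear by blast
  have "((\<lambda>s. ?R (b + s *\<^sub>R axis i 1)) has_vector_derivative 0) (at 0 within increments i b)"
  proof -
    have 1: "((\<lambda>s. v (b + s *\<^sub>R axis i 1) + \<tau> *\<^sub>R w (b + s *\<^sub>R axis i 1)) has_vector_derivative 0 + \<tau> *\<^sub>R 0) (at 0 within increments i b)"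
      by (intro has_vector_derivative_add dv bounded_linear.has_vector_derivative[OF bounded_linear_scaleR_right] dw)
    have 2: "((\<lambda>s. ?G (b + s *\<^sub>R axis i 1)) has_vector_derivative
        \<alpha> *\<^sub>R (cross3 (f (b + 0 *\<^sub>R axis i 1)) (0 + \<tau> *\<^sub>R 0)
          + cross3 0 (v (b + 0 *\<^sub>R axis i 1) + \<tau> *\<^sub>R w (b + 0 *\<^sub>R axis i 1))) - 0) (at 0 within increments i b)"
      by (intro has_vector_derivative_diff dv bounded_linear.has_vector_derivative[OF bounded_linear_scaleR_right]
          bounded_bilinear.has_vector_derivative[OF bcross df 1])
    have "((\<lambda>s. ?R (b + s *\<^sub>R axis i 1)) has_vector_derivative
       - (?\<sigma> (b + 0 *\<^sub>R axis i 1) *\<^sub>R 0 + 0 *\<^sub>R f (b + 0 *\<^sub>R axis i 1)) -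
        (cross3 (f (b + 0 *\<^sub>R axis i 1)) (\<alpha> *\<^sub>R (cross3 (f (b + 0 *\<^sub>R axis i 1)) (0 + \<tau> *\<^sub>R 0)
          + cross3 0 (v (b + 0 *\<^sub>R axis i 1) + \<tau> *\<^sub>R w (b + 0 *\<^sub>R axis i 1))) - 0)
         + cross3 0 (?G (b + 0 *\<^sub>R axis i 1)))) (at 0 within increments i b)"
      by (intro has_vector_derivative_diff has_vector_derivative_minus
          bounded_bilinear.has_vector_derivative[OF bounded_bilinear_scaleR ds df]
          bounded_bilinear.has_vector_derivative[OF bcross df 2])
    then show ?thesis by simp
  qed
  then have "((\<lambda>s. laplacian f (b + s *\<^sub>R axis i 1)) has_vector_derivative 0) (at 0 within increments i b)"
    by (rule has_vector_derivative_transform[rotated 2]) (use bO R' in \<open>simp_all add: increments_def\<close>)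
  moreover have "((\<lambda>s. laplacian f (b + s *\<^sub>R axis i 1)) has_vector_derivative (\<Sum>j\<in>UNIV. pd i (pd j (pd j f)) b)) (at 0 within increments i b)"
    unfolding laplacian_def by (intro has_vector_derivative_sum line hpd refl)
  ultimately have "(\<Sum>j\<in>UNIV. pd i (pd j (pd j f)) b) = 0"
    using derivative_increments_unique[OF bO] by blast
  \<comment> \<open>Derivatives are exchanged until the normal one acts first; what follows are
    tangential derivatives of a function vanishing on the face.\<close>
  moreover have "pd i (pd j (pd j f)) b = 0" if "j \<noteq> i" for j
  proof -
    have "pd i (pd j (pd j f)) b = pd j (pd i (pd j f)) b" by (rule pd_commute[OF pf2 bO])
    also have "\<dots> = pd j (pd j (pd i f)) b" by (rule pd_cong(1)[OF pd_commute[OF f2] bO])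
    also have "\<dots> = 0" by (rule pd_tangential_zero[OF _ hpd(3) that c b]) (rule tz[OF that])
    finally show ?thesis .
  qed
  then have "(\<Sum>j\<in>UNIV. pd i (pd j (pd j f)) b) = (\<Sum>j\<in>UNIV. if j = i then pd i (pd i (pd i f)) b else 0)"
    by (intro sum.cong) auto
  ultimately show ?thesis by simp
qed

section \<open>Spatial consistency\<close>

definition stencil :: "nat \<Rightarrow> 'd grid_fun \<Rightarrow> 'd \<Rightarrow> 'd grid_fun" where
  "stencil N F j I = ghost_ext N F (I(j := I j + 1)) - 2 *\<^sub>R F I + ghost_ext N F (I(j := I j - 1))"

lemma dlaplacian_stencil: "dlaplacian N F I = (\<Sum>j\<in>UNIV. stencil N F j I /\<^sub>R (mesh N)\<^sup>2)"
  by (simp only: dlaplacian_def stencil_def)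

text \<open>The first cell centre lies half a mesh width from the boundary, so the mirror image of
  its missing neighbour is that centre itself: the ghost value is the value of the even extension.
  The last cell is read from the other end through \<open>1 - x\<close>; with at least two cells, no
  cell touches both ends.\<close>

lemma stencil_reflected:
  assumes N: "2 \<le> N" and I: "I \<in> grid N"
    and F: "\<And>a. 1 \<le> a \<Longrightarrow> a \<le> N \<Longrightarrow> F (I(j := a)) = g ((real a - 1 / 2) * mesh N)"
  defines "x \<equiv> (real (I j) - 1 / 2) * mesh N"
  shows "I j < N \<Longrightarrow> stencil N F j I = g (x + mesh N) + g \<bar>x - mesh N\<bar> - 2 *\<^sub>R g x \<and> 0 \<le> x \<and> x + mesh N \<le> 1"
    and "I j = N \<Longrightarrow> stencil N F j I = g (1 - (1 - x + mesh N)) + g (1 - \<bar>1 - x - mesh N\<bar>) - 2 *\<^sub>R g (1 - (1 - x))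
      \<and> 0 \<le> 1 - x \<and> 1 - x + mesh N \<le> 1"
proof -
  have Ij: "1 \<le> I j" "I j \<le> N" using I by (auto simp: grid_def)
  have h: "0 < mesh N" "real N * mesh N = 1" using N by (simp_all add: mesh_def)
  have FI: "F I = g x" using F[OF Ij] by (simp add: x_def)
  { assume lt: "I j < N"
    have up: "ghost_ext N F (I(j := I j + 1)) = g (x + mesh N)"
    proof -
      have "ghost_ext N F (I(j := I j + 1)) = F (I(j := I j + 1))"
        using ghost_ext_upper[OF I] lt by (simp add: shift_def)
      also have "\<dots> = g ((real (I j + 1) - 1 / 2) * mesh N)" by (rule F) (use lt in auto)
      finally show ?thesis by (simp add: x_def algebra_simps)
    qed
    have low: "ghost_ext N F (I(j := I j - 1)) = g \<bar>x - mesh N\<bar>"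
    proof (cases "1 < I j")
      case True
      then have "ghost_ext N F (I(j := I j - 1)) = F (I(j := I j - 1))"
        using ghost_ext_lower[OF I, of F j] by simp
      also have "\<dots> = g ((real (I j - 1) - 1 / 2) * mesh N)" by (rule F) (use True Ij in auto)
      also have "(real (I j - 1) - 1 / 2) * mesh N = x - mesh N"
        using True by (simp add: x_def of_nat_diff algebra_simps)
      finally have e: "ghost_ext N F (I(j := I j - 1)) = g (x - mesh N)" .
      have "3 / 2 * mesh N \<le> x" unfolding x_def using True h by (intro mult_right_mono) auto
      then show ?thesis using e h by simp
    next
      case False
      then have "I j = 1" using Ij by simp
      then have "x - mesh N = - x" by (simp add: x_def algebra_simps)
      moreover have "0 \<le> x" using h \<open>I j = 1\<close> by (simp add: x_def)
      ultimately have "\<bar>x - mesh N\<bar> = x" by simp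
      then show ?thesis using ghost_ext_lower[OF I, of F j] False FI by simp
    qed
    have "0 \<le> x" unfolding x_def using Ij h by (intro mult_nonneg_nonneg) auto
    moreover have "x + mesh N \<le> 1"
    proof -
      have "x + mesh N = (real (I j) + 1 / 2) * mesh N" by (simp add: x_def algebra_simps)
      also have "\<dots> \<le> real N * mesh N" using lt h by (intro mult_right_mono) auto
      finally show ?thesis using h by simp
    qed
    ultimately show "stencil N F j I = g (x + mesh N) + g \<bar>x - mesh N\<bar> - 2 *\<^sub>R g x \<and> 0 \<le> x \<and> x + mesh N \<le> 1"
      unfolding stencil_def up low FI by simp }
  { assume eq: "I j = N"
    have x: "1 - x = mesh N / 2" using h by (simp add: x_def eq algebra_simps)
    have up: "ghost_ext N F (I(j := I j + 1)) = g (1 - \<bar>1 - x - mesh N\<bar>)"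
    proof -
      have "\<bar>1 - x - mesh N\<bar> = 1 - x" using x h by simp
      then show ?thesis using ghost_ext_upper[OF I, of F j] eq FI by simp
    qed
    have low: "ghost_ext N F (I(j := I j - 1)) = g (1 - (1 - x + mesh N))"
    proof -
      have "ghost_ext N F (I(j := I j - 1)) = F (I(j := I j - 1))"
        using ghost_ext_lower[OF I, of F j] eq N by simp
      also have "\<dots> = g ((real (I j - 1) - 1 / 2) * mesh N)" by (rule F) (use eq N in auto)
      also have "(real (I j - 1) - 1 / 2) * mesh N = 1 - (1 - x + mesh N)"
        using Ij by (simp add: x_def of_nat_diff algebra_simps)
      finally show ?thesis .
    qed
    have "2 * mesh N \<le> real N * mesh N" using N h by (intro mult_right_mono) auto
    then have "1 - x + mesh N \<le> 1" "0 \<le> 1 - x" using x h by auto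
    then show "stencil N F j I = g (1 - (1 - x + mesh N)) + g (1 - \<bar>1 - x - mesh N\<bar>) - 2 *\<^sub>R g (1 - (1 - x))
      \<and> 0 \<le> 1 - x \<and> 1 - x + mesh N \<le> 1"
      unfolding stencil_def up low FI by simp }
qed

lemma reflect_derivative:
  assumes "\<And>s. s \<in> {0..1} \<Longrightarrow> (g has_vector_derivative g' s) (at s within {0..1})" "s \<in> {0..1::real}"
  shows "((\<lambda>s. g (1 - s)) has_vector_derivative - g' (1 - s)) (at s within {0..1})"
    and "((\<lambda>s. - g (1 - s)) has_vector_derivative g' (1 - s)) (at s within {0..1})"
proof -
  show 1: "((\<lambda>s. g (1 - s)) has_vector_derivative - g' (1 - s)) (at s within {0..1})"
    using has_vector_derivative_affine[OF assms(1), of 1 "-1" s "{0..1}"] assms(2) by auto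
  show "((\<lambda>s. - g (1 - s)) has_vector_derivative g' (1 - s)) (at s within {0..1})"
    using has_vector_derivative_minus[OF 1] by simp
qed

lemma stencil_le:
  assumes "2 \<le> N" "I \<in> grid N"
    "\<And>a. 1 \<le> a \<Longrightarrow> a \<le> N \<Longrightarrow> F (I(j := a)) = g ((real a - 1 / 2) * mesh N)"
    and g1: "\<And>s. s \<in> {0..1} \<Longrightarrow> (g has_vector_derivative g1 s) (at s within {0..1})"
    and g2: "\<And>s. s \<in> {0..1} \<Longrightarrow> (g1 has_vector_derivative g2 s) (at s within {0..1})"
    and z: "g1 0 = 0" "g1 1 = 0"
    and bnd: "\<And>s. s \<in> {0..1} \<Longrightarrow> norm (g2 s) \<le> K"
  shows "norm (stencil N F j I) \<le> K * (mesh N)\<^sup>2"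
proof (cases "I j < N")
  case True
  note r = stencil_reflected(1)[of N I F j g, OF assms(1-3) True]
  show ?thesis
    using reflected_second_difference_le[OF _ _ _ g1 g2 z(1) bnd] r by simp
next
  case False
  then have "I j = N" using assms(2) by (auto simp: grid_def intro: antisym)
  note r = stencil_reflected(2)[of N I F j g, OF assms(1-3) this]
  define y where "y = 1 - (real (I j) - 1 / 2) * mesh N"
  have "norm (g (1 - (y + mesh N)) + g (1 - \<bar>y - mesh N\<bar>) - 2 *\<^sub>R g (1 - y)) \<le> K * (mesh N)\<^sup>2"
    by (rule reflected_second_difference_le[OF _ _ _ reflect_derivative(1)[OF g1] reflect_derivative(2)[OF g2]])
       (use r z(2) bnd in \<open>auto simp: y_def\<close>)
  then show ?thesis using r unfolding y_def[symmetric] by simp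
qed

lemma stencil_consistent:
  assumes "2 \<le> N" "I \<in> grid N"
    "\<And>a. 1 \<le> a \<Longrightarrow> a \<le> N \<Longrightarrow> F (I(j := a)) = g ((real a - 1 / 2) * mesh N)"
    and g1: "\<And>s. s \<in> {0..1} \<Longrightarrow> (g has_vector_derivative g1 s) (at s within {0..1})"
    and g2: "\<And>s. s \<in> {0..1} \<Longrightarrow> (g1 has_vector_derivative g2 s) (at s within {0..1})"
    and g3: "\<And>s. s \<in> {0..1} \<Longrightarrow> (g2 has_vector_derivative g3 s) (at s within {0..1})"
    and g4: "\<And>s. s \<in> {0..1} \<Longrightarrow> (g3 has_vector_derivative g4 s) (at s within {0..1})"
    and z: "g1 0 = 0" "g1 1 = 0" "g3 0 = 0" "g3 1 = 0"
    and bnd: "\<And>s. s \<in> {0..1} \<Longrightarrow> norm (g4 s) \<le> K"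
  shows "norm (stencil N F j I - (mesh N)\<^sup>2 *\<^sub>R g2 ((real (I j) - 1 / 2) * mesh N)) \<le> K * mesh N ^ 4"
proof (cases "I j < N")
  case True
  note r = stencil_reflected(1)[of N I F j g, OF assms(1-3) True]
  show ?thesis
    using reflected_second_difference_consistent[OF _ _ _ g1 g2 g3 g4 z(1,3) bnd] r by simp
next
  case False
  then have "I j = N" using assms(2) by (auto simp: grid_def intro: antisym)
  note r = stencil_reflected(2)[of N I F j g, OF assms(1-3) this]
  define y where "y = 1 - (real (I j) - 1 / 2) * mesh N"
  have "norm (g (1 - (y + mesh N)) + g (1 - \<bar>y - mesh N\<bar>) - 2 *\<^sub>R g (1 - y) - (mesh N)\<^sup>2 *\<^sub>R g2 (1 - y))
      \<le> K * mesh N ^ 4"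
    by (rule reflected_second_difference_consistent[OF _ _ _ reflect_derivative(1)[OF g1] reflect_derivative(2)[OF g2]
        reflect_derivative(1)[OF g3] reflect_derivative(2)[OF g4]])
       (use r z(2,4) bnd in \<open>auto simp: y_def\<close>)
  moreover have "1 - y = (real (I j) - 1 / 2) * mesh N" by (simp add: y_def)
  moreover have "stencil N F j I = g (1 - (y + mesh N)) + g (1 - \<bar>y - mesh N\<bar>) - 2 *\<^sub>R g (1 - y)"
    using r unfolding y_def[symmetric] by blast
  ultimately show ?thesis by (simp only:)
qed

lemma cell_center_nth: "cell_center N I $ l = (real (I l) - 1 / 2) * mesh N"
  by (simp add: cell_center_def)

lemma cell_center_Omega:
  assumes "I \<in> grid N" shows "cell_center N I \<in> Omega"
  unfolding mem_Omega
proof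
  fix l
  have l: "1 \<le> I l" "I l \<le> N" using assms by (auto simp: grid_def)
  have h: "0 < mesh N" "real N * mesh N = 1" using l by (simp_all add: mesh_def)
  have "(real (I l) - 1 / 2) * mesh N < real N * mesh N"
    using l h by (intro mult_strict_right_mono) auto
  then show "0 < cell_center N I $ l \<and> cell_center N I $ l < 1"
    using l h by (simp add: cell_center_nth)
qed

lemma Omega_subset: "x \<in> Omega \<Longrightarrow> x \<in> Omega_bar"
  by (auto simp: mem_Omega mem_Omega_bar less_imp_le)

text \<open>Where the grid line through the cell in direction \<open>j\<close> starts. All other
  coordinates are those of a cell centre, so both ends of the line lie in relative interiors of
  faces and the Neumann condition applies to them.\<close>

definition foot :: "nat \<Rightarrow> ('d \<Rightarrow> nat) \<Rightarrow> 'd \<Rightarrow> real ^ 'd" where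
  "foot N I j = (\<chi> l. if l = j then 0 else cell_center N I $ l)"

lemma foot_facts:
  assumes "I \<in> grid N"
  shows "onface j 0 (foot N I j)" "onface j 1 (foot N I j + 1 *\<^sub>R axis j 1)" "foot N I j \<in> Omega_bar"
    "increments j (foot N I j) = {0..1}"
    "cell_center N (I(j := a)) = foot N I j + ((real a - 1 / 2) * mesh N) *\<^sub>R axis j 1"
proof -
  show 1: "onface j 0 (foot N I j)"
    using cell_center_Omega[OF assms] by (simp add: onface_def foot_def mem_Omega)
  then show "onface j 1 (foot N I j + 1 *\<^sub>R axis j 1)" unfolding onface_def line_nth by simp
  show 2: "foot N I j \<in> Omega_bar" using onface_Omega_bar[OF 1] by simp
  show "increments j (foot N I j) = {0..1}" unfolding increments_eq[OF 2] by (simp add: foot_def)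
  show "cell_center N (I(j := a)) = foot N I j + ((real a - 1 / 2) * mesh N) *\<^sub>R axis j 1"
    unfolding vec_eq_iff line_nth by (simp add: foot_def cell_center_nth)
qed

lemma foot_line:
  assumes "I \<in> grid N" "has_pd j g" "s \<in> {0..1}"
  shows "((\<lambda>s. g (foot N I j + s *\<^sub>R axis j 1)) has_vector_derivative pd j g (foot N I j + s *\<^sub>R axis j 1)) (at s within {0..1})"
    and "foot N I j + s *\<^sub>R axis j 1 \<in> Omega_bar"
proof -
  note inc = foot_facts(4)[OF assms(1), of j]
  show "((\<lambda>s. g (foot N I j + s *\<^sub>R axis j 1)) has_vector_derivative pd j g (foot N I j + s *\<^sub>R axis j 1)) (at s within {0..1})"
    using pd_line[OF assms(2) foot_facts(3)[OF assms(1)], of s j] assms(3) unfolding inc by blast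
  have "s \<in> increments j (foot N I j)" using assms(3) unfolding inc .
  then show "foot N I j + s *\<^sub>R axis j 1 \<in> Omega_bar" by (simp only: increments_def mem_Collect_eq)
qed

text \<open>A bound on second derivatives is enough for size. Besides the exact solution it is
  applied to the difference of two time levels, which satisfies the Neumann condition as
  well.\<close>

lemma dlaplacian_nodal_le:
  fixes f :: "real ^ 'd::finite \<Rightarrow> real ^ 3"
  assumes "2 \<le> N" and I: "I \<in> grid N" and f: "Ck 2 f" "neumann f"
    and bnd: "\<And>x j. x \<in> Omega_bar \<Longrightarrow> norm (pd j (pd j f) x) \<le> K"
  shows "norm (dlaplacian N (nodal_interp N f) I) \<le> real CARD('d) * K"
proof -
  have h: "0 < mesh N" using assms(1) by (simp add: mesh_def)
  have "norm (stencil N (nodal_interp N f) j I /\<^sub>R (mesh N)\<^sup>2) \<le> K" for j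
  proof -
    have pd: "has_pd j f" "has_pd j (pd j f)" using f(1) by (auto simp: numeral_2_eq_2)
    note ff = foot_facts[OF I, of j] and fl = foot_line[OF I, of j]
    have "norm (stencil N (nodal_interp N f) j I) \<le> K * (mesh N)\<^sup>2"
    proof (rule stencil_le[OF assms(1) I _ fl(1)[OF pd(1)] fl(1)[OF pd(2)]])
      show "nodal_interp N f (I(j := a)) = f (foot N I j + ((real a - 1 / 2) * mesh N) *\<^sub>R axis j 1)" for a
        by (simp only: nodal_interp_def ff(5))
      have "pd j f (foot N I j) = 0" "pd j f (foot N I j + 1 *\<^sub>R axis j 1) = 0"
        using f(2) ff(1,2) unfolding neumann_def by blast+
      then show "pd j f (foot N I j + 0 *\<^sub>R axis j 1) = 0" "pd j f (foot N I j + 1 *\<^sub>R axis j 1) = 0" by simp_all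
      show "norm (pd j (pd j f) (foot N I j + s *\<^sub>R axis j 1)) \<le> K" if "s \<in> {0..1}" for s
        by (rule bnd[OF fl(2)[OF pd(1) that]])
    qed auto
    then show ?thesis using h by (simp add: field_simps)
  qed
  then have "norm (dlaplacian N (nodal_interp N f) I) \<le> (\<Sum>j\<in>(UNIV::'d set). K)"
    unfolding dlaplacian_stencil by (intro order_trans[OF norm_sum] sum_mono)
  then show ?thesis by simp
qed

text \<open>A nonzero third normal derivative would put a kink into the second derivative of the
  even extension and leave an error of order \<open>h\<close> in the boundary cells;
  \<open>third\<close> excludes this.\<close>

lemma dlaplacian_nodal_consistent:
  fixes f :: "real ^ 'd::finite \<Rightarrow> real ^ 3"
  assumes "2 \<le> N" and I: "I \<in> grid N" and f: "Ck 4 f" "neumann f"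
    and third: "\<And>i c x. c \<in> {0, 1} \<Longrightarrow> onface i c x \<Longrightarrow> pd i (pd i (pd i f)) x = 0"
    and bnd: "\<And>x j. x \<in> Omega_bar \<Longrightarrow> norm (pd j (pd j (pd j (pd j f))) x) \<le> K"
  shows "norm (dlaplacian N (nodal_interp N f) I - laplacian f (cell_center N I)) \<le> real CARD('d) * K * (mesh N)\<^sup>2"
proof -
  have h: "0 < mesh N" using assms(1) by (simp add: mesh_def)
  have "norm (stencil N (nodal_interp N f) j I /\<^sub>R (mesh N)\<^sup>2 - pd j (pd j f) (cell_center N I)) \<le> K * (mesh N)\<^sup>2" for j
  proof -
    have pd: "has_pd j f" "has_pd j (pd j f)" "has_pd j (pd j (pd j f))" "has_pd j (pd j (pd j (pd j f)))"
      using f(1) by (auto simp: numeral_eq_Suc)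
    note ff = foot_facts[OF I, of j] and fl = foot_line[OF I, of j]
    have "norm (stencil N (nodal_interp N f) j I
        - (mesh N)\<^sup>2 *\<^sub>R pd j (pd j f) (foot N I j + ((real (I j) - 1 / 2) * mesh N) *\<^sub>R axis j 1)) \<le> K * mesh N ^ 4"
    proof (rule stencil_consistent[OF assms(1) I _ fl(1)[OF pd(1)] fl(1)[OF pd(2)] fl(1)[OF pd(3)] fl(1)[OF pd(4)]])
      show "nodal_interp N f (I(j := a)) = f (foot N I j + ((real a - 1 / 2) * mesh N) *\<^sub>R axis j 1)" for a
        by (simp only: nodal_interp_def ff(5))
      have "pd j f (foot N I j) = 0" "pd j f (foot N I j + 1 *\<^sub>R axis j 1) = 0"
        using f(2) ff(1,2) unfolding neumann_def by blast+
      then show "pd j f (foot N I j + 0 *\<^sub>R axis j 1) = 0" "pd j f (foot N I j + 1 *\<^sub>R axis j 1) = 0" by simp_all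
      have "pd j (pd j (pd j f)) (foot N I j) = 0" "pd j (pd j (pd j f)) (foot N I j + 1 *\<^sub>R axis j 1) = 0"
        using third[OF _ ff(1)] third[OF _ ff(2)] by simp_all
      then show "pd j (pd j (pd j f)) (foot N I j + 0 *\<^sub>R axis j 1) = 0" "pd j (pd j (pd j f)) (foot N I j + 1 *\<^sub>R axis j 1) = 0" by simp_all
      show "norm (pd j (pd j (pd j (pd j f))) (foot N I j + s *\<^sub>R axis j 1)) \<le> K" if "s \<in> {0..1}" for s
        by (rule bnd[OF fl(2)[OF pd(1) that]])
    qed auto
    moreover have "foot N I j + ((real (I j) - 1 / 2) * mesh N) *\<^sub>R axis j 1 = cell_center N I"
      using ff(5)[of "I j"] by simp
    ultimately have 1: "norm (stencil N (nodal_interp N f) j I - (mesh N)\<^sup>2 *\<^sub>R pd j (pd j f) (cell_center N I)) \<le> K * mesh N ^ 4"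
      by simp
    have "stencil N (nodal_interp N f) j I /\<^sub>R (mesh N)\<^sup>2 - pd j (pd j f) (cell_center N I)
      = (stencil N (nodal_interp N f) j I - (mesh N)\<^sup>2 *\<^sub>R pd j (pd j f) (cell_center N I)) /\<^sub>R (mesh N)\<^sup>2"
      using h by (simp add: scaleR_diff_right)
    then have "norm (stencil N (nodal_interp N f) j I /\<^sub>R (mesh N)\<^sup>2 - pd j (pd j f) (cell_center N I))
      = norm (stencil N (nodal_interp N f) j I - (mesh N)\<^sup>2 *\<^sub>R pd j (pd j f) (cell_center N I)) / (mesh N)\<^sup>2"
      by (simp add: divide_inverse_commute)
    also have "\<dots> \<le> K * mesh N ^ 4 / (mesh N)\<^sup>2" using 1 by (rule divide_right_mono) simp
    also have "\<dots> = K * (mesh N)\<^sup>2" using h by (simp add: power2_eq_square numeral_eq_Suc)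
    finally show ?thesis .
  qed
  then have "norm (dlaplacian N (nodal_interp N f) I - laplacian f (cell_center N I)) \<le> (\<Sum>j\<in>(UNIV::'d set). K * (mesh N)\<^sup>2)"
    unfolding dlaplacian_stencil laplacian_def sum_subtractf[symmetric] by (intro order_trans[OF norm_sum] sum_mono)
  then show ?thesis by simp
qed

lemma neighbour_lipschitz:
  assumes I: "I \<in> interior_faces N j" and pd: "has_pd j f"
    and bnd: "\<And>x. x \<in> Omega_bar \<Longrightarrow> norm (pd j f x) \<le> K"
  shows "norm (f (cell_center N (shift j I)) - f (cell_center N I)) \<le> K * mesh N"
proof -
  have Ig: "I \<in> grid N" "1 \<le> I j" "I j < N" using I by (auto simp: interior_faces_def grid_def)
  have h: "0 < mesh N" "real N * mesh N = 1" using Ig by (simp_all add: mesh_def)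
  let ?x = "(real (I j) - 1 / 2) * mesh N"
  have x: "0 \<le> ?x" using Ig h by simp
  have "?x + mesh N = (real (I j) + 1 / 2) * mesh N" by (simp add: algebra_simps)
  also have "\<dots> \<le> real N * mesh N" using Ig h by (intro mult_right_mono) auto
  finally have x1: "?x + mesh N \<le> 1" using h by simp
  have sub: "{?x..?x + mesh N} \<subseteq> {0..1}" using x x1 by auto
  have "norm (f (foot N I j + (?x + mesh N) *\<^sub>R axis j 1) - f (foot N I j + ?x *\<^sub>R axis j 1)) \<le> K * (?x + mesh N - ?x)"
  proof (rule increment_bound[where g' = "\<lambda>s. pd j f (foot N I j + s *\<^sub>R axis j 1)"])
    fix s assume s: "s \<in> {?x..?x + mesh N}"
    show "((\<lambda>s. f (foot N I j + s *\<^sub>R axis j 1)) has_vector_derivative pd j f (foot N I j + s *\<^sub>R axis j 1)) (at s within {?x..?x + mesh N})"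
      by (rule has_vector_derivative_within_subset[OF foot_line(1)[OF Ig(1) pd] sub]) (use s sub in auto)
    show "norm (pd j f (foot N I j + s *\<^sub>R axis j 1)) \<le> K"
      by (rule bnd[OF foot_line(2)[OF Ig(1) pd]]) (use s sub in auto)
  qed (use h in auto)
  moreover have "foot N I j + ?x *\<^sub>R axis j 1 = cell_center N I"
    using foot_facts(5)[OF Ig(1), of j "I j"] by simp
  moreover have "foot N I j + (?x + mesh N) *\<^sub>R axis j 1 = cell_center N (shift j I)"
    using foot_facts(5)[OF Ig(1), of j "I j + 1"] by (simp add: shift_def algebra_simps)
  ultimately show ?thesis by simp
qed

text \<open>A null set contains no nonempty open set, so the good times are dense in the interval; a
  continuous quantity then obeys the bound at every time. The bound is asked for at interior times
  only, because the differential equation is given there.\<close>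

lemma AE_le_closed:
  fixes \<phi> :: "real \<Rightarrow> real"
  assumes "0 < T" "AE t in lebesgue_on {0..T}. P t" "continuous_on {0..T} \<phi>"
    and le: "\<And>t. 0 < t \<Longrightarrow> t < T \<Longrightarrow> P t \<Longrightarrow> \<phi> t \<le> c" and t: "t \<in> {0..T}"
  shows "\<phi> t \<le> c"
proof -
  let ?S = "{t. 0 < t \<and> t < T \<and> P t}"
  have dense: "{0..T} \<subseteq> closure ?S"
  proof
    have "AE t in lebesgue. t \<in> {0..T} \<longrightarrow> P t"
      using assms(2) by (subst (asm) AE_restrict_space_iff) auto
    then obtain Z where Z: "Z \<in> null_sets lebesgue" "{t. \<not> (t \<in> {0..T} \<longrightarrow> P t)} \<subseteq> Z"
      by (auto simp: eventually_ae_filter)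
    fix t assume t: "t \<in> {0..T}"
    show "t \<in> closure ?S"
    proof (rule ccontr)
      assume "t \<notin> closure ?S"
      then have "open (- closure ?S)" "t \<in> - closure ?S" by auto
      moreover have "t \<in> closure {0<..<T}" using t assms(1) by (simp add: closure_greaterThanLessThan)
      ultimately have ne: "- closure ?S \<inter> {0<..<T} \<noteq> {}"
        using open_Int_closure_eq_empty[of "- closure ?S" "{0<..<T}"] by blast
      have "- closure ?S \<inter> {0<..<T} \<subseteq> Z"
      proof
        fix x assume x: "x \<in> - closure ?S \<inter> {0<..<T}"
        then have "x \<notin> ?S" using closure_subset[of ?S] by blast
        then have "x \<in> {t. \<not> (t \<in> {0..T} \<longrightarrow> P t)}" using x by simp
        then show "x \<in> Z" using Z(2) by blast
      qed
      moreover have "negligible Z" using Z(1) by (simp add: negligible_iff_null_sets)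
      ultimately have "negligible (- closure ?S \<inter> {0<..<T})" by (rule negligible_subset[rotated])
      moreover have "open (- closure ?S \<inter> {0<..<T})" by (intro open_Int) auto
      ultimately show False using open_not_negligible ne by blast
    qed
  qed
  have sub: "closure ?S \<subseteq> {0..T}" by (rule closure_minimal) auto
  show ?thesis
  proof (rule continuous_le_on_closure[where f = \<phi>])
    show "continuous_on (closure ?S) \<phi>" using assms(3) sub continuous_on_subset by blast
    show "t \<in> closure ?S" using dense t by blast
    show "\<phi> x \<le> c" if "x \<in> ?S" for x using le that by blast
  qed
qed

section \<open>Consistency of the scheme\<close>

lemma norm_quotient: "0 < c \<Longrightarrow> norm (x /\<^sub>R c) = norm x / c" for c :: real
  by (simp add: divide_inverse_commute)

lemma norm_quotient_le: "0 < c \<Longrightarrow> norm x \<le> R * c \<Longrightarrow> norm (x /\<^sub>R c) \<le> R" for c :: real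
  by (simp only: norm_quotient pos_divide_le_eq)

lemma dlaplacian_avg:
  "dlaplacian N (\<lambda>I. (f I + g I) /\<^sub>R 2) I = (dlaplacian N f I + dlaplacian N g I) /\<^sub>R 2"
proof -
  have s: "stencil N (\<lambda>I. (f I + g I) /\<^sub>R 2) j I = (stencil N f j I + stencil N g j I) /\<^sub>R 2" for j
  proof -
    have "(a + b) /\<^sub>R 2 - 2 *\<^sub>R ((c + d) /\<^sub>R 2) + (x + y) /\<^sub>R 2 = ((a - 2 *\<^sub>R c + x) + (b - 2 *\<^sub>R d + y)) /\<^sub>R 2"
      for a b c d x y :: "real ^ 3"
      by (simp add: scaleR_add_right scaleR_diff_right)
    then show ?thesis by (simp only: stencil_def ghost_ext_def)
  qed
  have "dlaplacian N (\<lambda>I. (f I + g I) /\<^sub>R 2) I = (\<Sum>j\<in>UNIV. ((stencil N f j I + stencil N g j I) /\<^sub>R 2) /\<^sub>R (mesh N)\<^sup>2)"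
    by (simp only: dlaplacian_stencil s)
  also have "\<dots> = (\<Sum>j\<in>UNIV. (stencil N f j I /\<^sub>R (mesh N)\<^sup>2 + stencil N g j I /\<^sub>R (mesh N)\<^sup>2) /\<^sub>R 2)"
    by (rule sum.cong) (simp_all add: scaleR_add_right)
  also have "\<dots> = (dlaplacian N f I + dlaplacian N g I) /\<^sub>R 2"
    by (simp only: dlaplacian_stencil sum.distrib scaleR_sum_right[symmetric])
  finally show ?thesis .
qed

text \<open>All that consistency uses about the exact solution, with \<open>v\<close>,
  \<open>w\<close>, \<open>z\<close> its first three time derivatives and a single constant.
  \<open>space\<close>, \<open>lipL\<close> and \<open>wsd\<close> are assumed as estimates instead
  of derivative bounds: the first two stem from bounds valid at almost every time, the last from the
  differential equation.\<close>

locale smooth_solution =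
  fixes \<alpha> \<tau> T K :: real and m v w z :: "real \<Rightarrow> real ^ 'd::finite \<Rightarrow> real ^ 3"
  assumes pos: "0 < \<alpha>" "0 < \<tau>" "0 < T" "0 \<le> K"
    and unit: "\<And>t x. t \<in> {0..T} \<Longrightarrow> x \<in> Omega_bar \<Longrightarrow> norm (m t x) = 1"
    and dm: "\<And>t x. t \<in> {0..T} \<Longrightarrow> x \<in> Omega_bar \<Longrightarrow> ((\<lambda>s. m s x) has_vector_derivative v t x) (at t within {0..T})"
    and dv: "\<And>t x. t \<in> {0..T} \<Longrightarrow> x \<in> Omega_bar \<Longrightarrow> ((\<lambda>s. v s x) has_vector_derivative w t x) (at t within {0..T})"
    and dw: "\<And>t x. t \<in> {0..T} \<Longrightarrow> x \<in> Omega_bar \<Longrightarrow> ((\<lambda>s. w s x) has_vector_derivative z t x) (at t within {0..T})"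
    and bv: "\<And>t x. t \<in> {0..T} \<Longrightarrow> x \<in> Omega_bar \<Longrightarrow> norm (v t x) \<le> K"
    and bw: "\<And>t x. t \<in> {0..T} \<Longrightarrow> x \<in> Omega_bar \<Longrightarrow> norm (w t x) \<le> K"
    and bz: "\<And>t x. t \<in> {0..T} \<Longrightarrow> x \<in> Omega_bar \<Longrightarrow> norm (z t x) \<le> K"
    and C2: "\<And>t. t \<in> {0..T} \<Longrightarrow> Ck 2 (m t)" "\<And>t. t \<in> {0..T} \<Longrightarrow> Ck 2 (v t)" "\<And>t. t \<in> {0..T} \<Longrightarrow> Ck 2 (w t)"
    and neu: "\<And>t. t \<in> {0..T} \<Longrightarrow> neumann (m t)"
    and bpd: "\<And>t x j. t \<in> {0..T} \<Longrightarrow> x \<in> Omega_bar \<Longrightarrow> norm (pd j (m t) x) \<le> K"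
      "\<And>t x j. t \<in> {0..T} \<Longrightarrow> x \<in> Omega_bar \<Longrightarrow> norm (pd j (v t) x) \<le> K"
      "\<And>t x j. t \<in> {0..T} \<Longrightarrow> x \<in> Omega_bar \<Longrightarrow> norm (pd j (w t) x) \<le> K"
    and bpd2: "\<And>t x j. t \<in> {0..T} \<Longrightarrow> x \<in> Omega_bar \<Longrightarrow> norm (pd j (pd j (m t)) x) \<le> K"
      "\<And>t x j. t \<in> {0..T} \<Longrightarrow> x \<in> Omega_bar \<Longrightarrow> norm (pd j (pd j (v t)) x) \<le> K"
    and dpd2: "\<And>t x j. t \<in> {0..T} \<Longrightarrow> x \<in> Omega_bar \<Longrightarrow>
      ((\<lambda>s. pd j (pd j (m s)) x) has_vector_derivative pd j (pd j (v t)) x) (at t within {0..T})"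
    and dL: "\<And>t x. t \<in> {0..T} \<Longrightarrow> x \<in> Omega_bar \<Longrightarrow>
      ((\<lambda>s. laplacian (m s) x) has_vector_derivative laplacian (v t) x) (at t within {0..T})"
      "\<And>t x. t \<in> {0..T} \<Longrightarrow> x \<in> Omega_bar \<Longrightarrow>
      ((\<lambda>s. laplacian (v s) x) has_vector_derivative laplacian (w t) x) (at t within {0..T})"
    and bL: "\<And>t x. t \<in> {0..T} \<Longrightarrow> x \<in> Omega_bar \<Longrightarrow> norm (laplacian (w t) x) \<le> K"
    and wsd: "\<And>t s x. x \<in> Omega \<Longrightarrow> 0 \<le> s \<Longrightarrow> 0 \<le> t - s \<Longrightarrow> t + s \<le> T \<Longrightarrow>
      norm (w (t + s) x + w (t - s) x - 2 *\<^sub>R w t x) \<le> K * s\<^sup>2"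
    and space: "\<And>t N I. t \<in> {0..T} \<Longrightarrow> 2 \<le> N \<Longrightarrow> I \<in> grid N \<Longrightarrow>
      norm (dlaplacian N (nodal_interp N (m t)) I - laplacian (m t) (cell_center N I)) \<le> K * (mesh N)\<^sup>2"
    and lipL: "\<And>t N I j. t \<in> {0..T} \<Longrightarrow> I \<in> interior_faces N j \<Longrightarrow>
      norm (laplacian (m t) (cell_center N (shift j I)) - laplacian (m t) (cell_center N I)) \<le> K * mesh N"
    and pde: "\<And>t x. 0 < t \<Longrightarrow> t < T \<Longrightarrow> x \<in> Omega \<Longrightarrow>
      v t x = - cross3 (m t x) (laplacian (m t) x) + \<alpha> *\<^sub>R cross3 (m t x) (v t x + \<tau> *\<^sub>R w t x)"
begin

abbreviation ex :: "nat \<Rightarrow> real \<Rightarrow> nat \<Rightarrow> 'd grid_fun" where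
  "ex N k n \<equiv> nodal_interp N (m (real n * k))"

definition bnd_d :: real where
  "bnd_d = \<alpha> * (K + \<tau> * K)"

definition bnd_q :: real where
  "bnd_q = bnd_d + real CARD('d) * K"

text \<open>Large enough for every requirement of \<open>consistent\<close>:
  \<open>2 * K + K * bnd_q + bnd_d\<close> for the truncation error, \<open>bnd_d + 3 * K\<close>
  for jumps of the field, \<open>bnd_q\<close> for its size and time increments, and 1 because
  convergence is stated for constants of at least 1.\<close>

definition bnd :: real where
  "bnd = 1 + 8 * K + 2 * bnd_d + bnd_q + K * bnd_q"

lemma bnd_facts: "0 \<le> bnd_d" "0 \<le> bnd_q" "0 \<le> K * bnd_q" "0 \<le> real CARD('d) * K" "1 \<le> bnd"
  using pos by (simp_all add: bnd_d_def bnd_q_def bnd_def)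

lemma sub_derivative:
  assumes "\<And>s. s \<in> {0..T} \<Longrightarrow> (g has_vector_derivative g' s) (at s within {0..T})"
    and "0 \<le> a" "b \<le> T" "s \<in> {a..b}"
  shows "(g has_vector_derivative g' s) (at s within {a..b})"
  by (rule has_vector_derivative_within_subset[OF assms(1)]) (use assms(2-) in auto)

lemma first_difference_le:
  fixes g g' :: "real \<Rightarrow> real ^ 3"
  assumes "0 < k" "0 \<le> t - k" "t + k \<le> T"
    and "\<And>s. s \<in> {0..T} \<Longrightarrow> (g has_vector_derivative g' s) (at s within {0..T})"
    and "\<And>s. s \<in> {t - k..t + k} \<Longrightarrow> norm (g' s) \<le> R"
  shows "norm ((g (t + k) - g (t - k)) /\<^sub>R (2 * k)) \<le> R"
proof -
  have "norm (g (t + k) - g (t - k)) \<le> R * (t + k - (t - k))"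
    by (rule increment_bound[OF _ sub_derivative[OF assms(4)] assms(5)]) (use assms(1-3) in auto)
  moreover have "t + k - (t - k) = 2 * k" by simp
  ultimately show ?thesis using assms(1) by (intro norm_quotient_le) simp_all
qed

lemma second_quotient_le:
  fixes g g' g'' :: "real \<Rightarrow> real ^ 3"
  assumes "0 < k" "0 \<le> t - k" "t + k \<le> T"
    and "\<And>s. s \<in> {0..T} \<Longrightarrow> (g has_vector_derivative g' s) (at s within {0..T})"
    and "\<And>s. s \<in> {0..T} \<Longrightarrow> (g' has_vector_derivative g'' s) (at s within {0..T})"
    and "\<And>s. s \<in> {t - k..t + k} \<Longrightarrow> norm (g'' s) \<le> R"
  shows "norm ((g (t + k) - 2 *\<^sub>R g t + g (t - k)) /\<^sub>R k\<^sup>2) \<le> R"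
proof -
  have "norm (g (t + k) + g (t - k) - 2 *\<^sub>R g t) \<le> R * k\<^sup>2"
    by (rule second_difference_le[OF _ sub_derivative[OF assms(4)] sub_derivative[OF assms(5)] assms(6)])
       (use assms(1-3) in auto)
  moreover have "g (t + k) + g (t - k) - 2 *\<^sub>R g t = g (t + k) - 2 *\<^sub>R g t + g (t - k)" by simp
  ultimately show ?thesis using assms(1) by (intro norm_quotient_le) simp_all
qed

lemma field_le:
  assumes "norm a \<le> R" "norm b \<le> R" "norm c \<le> S"
  shows "norm (\<alpha> *\<^sub>R (a + \<tau> *\<^sub>R b) - c) \<le> \<alpha> * (R + \<tau> * R) + S"
proof -
  have "norm (a + \<tau> *\<^sub>R b) \<le> R + \<tau> * R"
  proof -
    have "norm (\<tau> *\<^sub>R b) = \<tau> * norm b" using pos by simp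
    also have "\<tau> * norm b \<le> \<tau> * R" using assms pos by (intro mult_left_mono) auto
    finally show ?thesis using norm_triangle_mono[OF assms(1)] by blast
  qed
  then have "norm (\<alpha> *\<^sub>R (a + \<tau> *\<^sub>R b)) \<le> \<alpha> * (R + \<tau> * R)" using pos by simp
  then show ?thesis using norm_triangle_ineq4[of "\<alpha> *\<^sub>R (a + \<tau> *\<^sub>R b)" c] assms by linarith
qed

lemma average_le: "norm x \<le> R \<Longrightarrow> norm y \<le> R \<Longrightarrow> norm ((x + y) /\<^sub>R 2) \<le> R" for x y :: "real ^ 3"
  using norm_triangle_ineq[of x y] by simp

lemma consistent_exact:
  assumes N: "2 \<le> N" and k: "0 < k"
  shows "consistent \<alpha> \<tau> T N k bnd (ex N k)"
  unfolding consistent_def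
proof (intro allI impI)
  fix n :: nat
  assume n: "1 \<le> n" "real (n + 1) * k \<le> T"
  define t where "t = real n * k"
  have tp: "real (n + 1) * k = t + k" and tm: "real (n - 1) * k = t - k"
    using n by (simp_all add: t_def of_nat_diff algebra_simps)
  have t: "0 < t" "t < T" "0 \<le> t - k" "t + k \<le> T"
  proof -
    show "t + k \<le> T" using n tp by simp
    then show "t < T" using k by simp
    show "0 \<le> t - k" unfolding tm[symmetric] using k by simp
    then show "0 < t" using k by simp
  qed
  have tin: "t \<in> {0..T}" "t + k \<in> {0..T}" "t - k \<in> {0..T}" using t k by auto
  have sin: "s \<in> {0..T}" if "s \<in> {t - k..t + k}" for s using that t by auto
  have h: "0 < mesh N" "mesh N \<le> 1" using N by (simp_all add: mesh_def)
  have a: "avg (ex N k) n = (\<lambda>I. (nodal_interp N (m (t + k)) I + nodal_interp N (m (t - k)) I) /\<^sub>R 2)"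
    unfolding avg_def tp tm ..
  have aI: "avg (ex N k) n I = (m (t + k) (cell_center N I) + m (t - k) (cell_center N I)) /\<^sub>R 2" for I
    by (simp only: a) (simp only: nodal_interp_def)
  have d1: "diff1 k (ex N k) n I = (m (t + k) (cell_center N I) - m (t - k) (cell_center N I)) /\<^sub>R (2 * k)" for I
    unfolding diff1_def nodal_interp_def tp tm ..
  have d2: "diff2 k (ex N k) n I = (m (t + k) (cell_center N I) - 2 *\<^sub>R m t (cell_center N I)
      + m (t - k) (cell_center N I)) /\<^sub>R k\<^sup>2" for I
    unfolding diff2_def nodal_interp_def tp tm t_def[symmetric] ..
  have dl: "dlaplacian N (avg (ex N k) n) I = (dlaplacian N (nodal_interp N (m (t + k))) I
      + dlaplacian N (nodal_interp N (m (t - k))) I) /\<^sub>R 2" for I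
    unfolding a dlaplacian_avg ..
  have fq: "field \<alpha> \<tau> N k (ex N k) n I = \<alpha> *\<^sub>R (diff1 k (ex N k) n I + \<tau> *\<^sub>R diff2 k (ex N k) n I)
      - dlaplacian N (avg (ex N k) n) I" for I
    by (simp only: field_def)
  have size: "norm (diff1 k (ex N k) n I) \<le> K" "norm (diff2 k (ex N k) n I) \<le> K"
    "norm (field \<alpha> \<tau> N k (ex N k) n I) \<le> bnd_q" if I: "I \<in> grid N" for I
  proof -
    have x: "cell_center N I \<in> Omega_bar" by (rule Omega_subset[OF cell_center_Omega[OF I]])
    show 1: "norm (diff1 k (ex N k) n I) \<le> K"
      unfolding d1 by (rule first_difference_le[OF k t(3,4) dm[OF _ x] bv[OF sin x]])
    show 2: "norm (diff2 k (ex N k) n I) \<le> K"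
      unfolding d2 by (rule second_quotient_le[OF k t(3,4) dm[OF _ x] dv[OF _ x] bw[OF sin x]])
    have 3: "norm (dlaplacian N (avg (ex N k) n) I) \<le> real CARD('d) * K"
      unfolding dl by (intro average_le dlaplacian_nodal_le[OF N I] C2(1) neu bpd2(1) tin)
    show "norm (field \<alpha> \<tau> N k (ex N k) n I) \<le> bnd_q"
      unfolding fq bnd_q_def bnd_d_def by (rule field_le[OF 1 2 3])
  qed
  have trunc: "norm (diff1 k (ex N k) n I - cross3 (avg (ex N k) n I) (field \<alpha> \<tau> N k (ex N k) n I)) \<le> bnd * (k\<^sup>2 + (mesh N)\<^sup>2)"
    if I: "I \<in> grid N" for I
  proof -
    let ?x = "cell_center N I" and ?\<epsilon> = "k\<^sup>2 + (mesh N)\<^sup>2"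
    have xO: "?x \<in> Omega" by (rule cell_center_Omega[OF I])
    then have x: "?x \<in> Omega_bar" by (rule Omega_subset)
    have e: "k\<^sup>2 \<le> ?\<epsilon>" "0 \<le> ?\<epsilon>" "(mesh N)\<^sup>2 \<le> ?\<epsilon>" by auto
    have sub: "0 \<le> t - s" "t + s \<le> T" if "s \<in> {0..k}" for s using that t by auto
    have "norm (m (t + k) ?x - m (t - k) ?x - (2 * k) *\<^sub>R v t ?x) \<le> K * k ^ 3"
    proof (rule central_difference_consistent)
      fix s assume s: "s \<in> {0..k}"
      show "norm (v (t + s) ?x + v (t - s) ?x - 2 *\<^sub>R v t ?x) \<le> K * s\<^sup>2"
        by (rule second_difference_le[OF _ sub_derivative[OF dv[OF _ x]] sub_derivative[OF dw[OF _ x]] bz[OF _ x]])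
           (use s sub[OF s] in auto)
    next
      show "((\<lambda>s. m s ?x) has_vector_derivative v s ?x) (at s within {t - k..t + k})" if "s \<in> {t - k..t + k}" for s
        by (rule sub_derivative[OF dm[OF _ x]]) (use that t in auto)
    qed (use k pos in auto)
    moreover have "diff1 k (ex N k) n I - v t ?x = (m (t + k) ?x - m (t - k) ?x - (2 * k) *\<^sub>R v t ?x) /\<^sub>R (2 * k)"
      unfolding d1 using k by (simp add: scaleR_diff_right)
    ultimately have "norm (diff1 k (ex N k) n I - v t ?x) \<le> K * k ^ 3 / (2 * k)"
      using k by (simp only: norm_quotient mult_pos_pos zero_less_numeral) (rule divide_right_mono, auto)
    also have "\<dots> = (K * k\<^sup>2) / 2" using k by (simp add: power2_eq_square power3_eq_cube)
    also have "\<dots> \<le> K * k\<^sup>2" using pos by simp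
    also have "\<dots> \<le> K * ?\<epsilon>" using e pos by (intro mult_left_mono)
    finally have t1: "norm (diff1 k (ex N k) n I - v t ?x) \<le> K * ?\<epsilon>" .
    have "norm (m (t + k) ?x + m (t - k) ?x - 2 *\<^sub>R m t ?x - k\<^sup>2 *\<^sub>R w t ?x) \<le> K * k ^ 4"
    proof (rule second_difference_consistent)
      fix s assume s: "s \<in> {0..k}"
      show "norm (w (t + s) ?x + w (t - s) ?x - 2 *\<^sub>R w t ?x) \<le> K * s\<^sup>2"
        using wsd[OF xO] s sub[OF s] by auto
    next
      show "((\<lambda>s. m s ?x) has_vector_derivative v s ?x) (at s within {t - k..t + k})" if "s \<in> {t - k..t + k}" for s
        by (rule sub_derivative[OF dm[OF _ x]]) (use that t in auto)
      show "((\<lambda>s. v s ?x) has_vector_derivative w s ?x) (at s within {t - k..t + k})" if "s \<in> {t - k..t + k}" for s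
        by (rule sub_derivative[OF dv[OF _ x]]) (use that t in auto)
    qed (use k pos in auto)
    moreover have "diff2 k (ex N k) n I - w t ?x = (m (t + k) ?x + m (t - k) ?x - 2 *\<^sub>R m t ?x - k\<^sup>2 *\<^sub>R w t ?x) /\<^sub>R k\<^sup>2"
    proof -
      have "p - 2 *\<^sub>R q + r = p + r - 2 *\<^sub>R q" for p q r :: "real ^ 3" by simp
      then show ?thesis unfolding d2 using k by (simp add: scaleR_diff_right[of _ _ "k\<^sup>2 *\<^sub>R w t ?x"])
    qed
    ultimately have "norm (diff2 k (ex N k) n I - w t ?x) \<le> K * k ^ 4 / k\<^sup>2"
      using k by (simp only: norm_quotient zero_less_power) (rule divide_right_mono, auto)
    also have "\<dots> = K * k\<^sup>2" using k by (simp add: power2_eq_square numeral_eq_Suc)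
    also have "\<dots> \<le> K * ?\<epsilon>" using e pos by (intro mult_left_mono)
    finally have t2: "norm (diff2 k (ex N k) n I - w t ?x) \<le> K * ?\<epsilon>" .
    \<comment> \<open>The average minus the middle value is half a second difference.\<close>
    have half: "norm ((g (t + k) + g (t - k)) /\<^sub>R 2 - g t) \<le> K * k\<^sup>2"
      if "norm (g (t + k) + g (t - k) - 2 *\<^sub>R g t) \<le> K * k\<^sup>2" for g :: "real \<Rightarrow> real ^ 3"
    proof -
      have "(g (t + k) + g (t - k)) /\<^sub>R 2 - g t = (g (t + k) + g (t - k) - 2 *\<^sub>R g t) /\<^sub>R 2"
        by (simp add: scaleR_diff_right)
      then have "norm ((g (t + k) + g (t - k)) /\<^sub>R 2 - g t) = norm (g (t + k) + g (t - k) - 2 *\<^sub>R g t) / 2" by simp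
      moreover have "0 \<le> K * k\<^sup>2" using pos by simp
      ultimately show ?thesis using that by linarith
    qed
    have "norm (m (t + k) ?x + m (t - k) ?x - 2 *\<^sub>R m t ?x) \<le> K * k\<^sup>2"
      by (rule second_difference_le[OF _ sub_derivative[OF dm[OF _ x]] sub_derivative[OF dv[OF _ x]] bw[OF sin x]])
         (use k t in auto)
    from half[of "\<lambda>s. m s ?x", OF this] have "norm (avg (ex N k) n I - m t ?x) \<le> K * k\<^sup>2"
      unfolding aI .
    also have "\<dots> \<le> K * ?\<epsilon>" using e pos by (intro mult_left_mono)
    finally have t3: "norm (avg (ex N k) n I - m t ?x) \<le> K * ?\<epsilon>" .
    have "norm (laplacian (m (t + k)) ?x + laplacian (m (t - k)) ?x - 2 *\<^sub>R laplacian (m t) ?x) \<le> K * k\<^sup>2"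
      by (rule second_difference_le[OF _ sub_derivative[OF dL(1)[OF _ x]] sub_derivative[OF dL(2)[OF _ x]] bL[OF sin x]])
         (use k t in auto)
    from half[of "\<lambda>s. laplacian (m s) ?x", OF this]
    have l1: "norm ((laplacian (m (t + k)) ?x + laplacian (m (t - k)) ?x) /\<^sub>R 2 - laplacian (m t) ?x) \<le> K * k\<^sup>2" .
    have l2: "norm (((dlaplacian N (nodal_interp N (m (t + k))) I - laplacian (m (t + k)) ?x)
        + (dlaplacian N (nodal_interp N (m (t - k))) I - laplacian (m (t - k)) ?x)) /\<^sub>R 2) \<le> K * (mesh N)\<^sup>2"
      by (intro average_le space tin N I)
    \<comment> \<open>Spatial consistency is applied at the two outer levels, where the discrete
      Laplacian acts; averaging the exact Laplacians then costs a second difference in time.\<close>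
    have eq: "dlaplacian N (avg (ex N k) n) I - laplacian (m t) ?x
       = ((dlaplacian N (nodal_interp N (m (t + k))) I - laplacian (m (t + k)) ?x)
        + (dlaplacian N (nodal_interp N (m (t - k))) I - laplacian (m (t - k)) ?x)) /\<^sub>R 2
        + ((laplacian (m (t + k)) ?x + laplacian (m (t - k)) ?x) /\<^sub>R 2 - laplacian (m t) ?x)"
      unfolding dl by (simp add: scaleR_diff_right scaleR_add_right)
    have "norm (dlaplacian N (avg (ex N k) n) I - laplacian (m t) ?x) \<le> K * (mesh N)\<^sup>2 + K * k\<^sup>2"
      unfolding eq by (rule norm_triangle_mono[OF l2 l1])
    then have t4: "norm (dlaplacian N (avg (ex N k) n) I - laplacian (m t) ?x) \<le> K * ?\<epsilon>"
      by (simp add: distrib_left)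
    define q where "q = \<alpha> *\<^sub>R (v t ?x + \<tau> *\<^sub>R w t ?x) - laplacian (m t) ?x"
    let ?Q = "field \<alpha> \<tau> N k (ex N k) n I"
    have vq: "v t ?x = cross3 (m t ?x) q"
      using pde[OF t(1,2) xO] by (simp add: q_def Cross3.right_diff_distrib cross_mult_right)
    have "?Q - q = \<alpha> *\<^sub>R ((diff1 k (ex N k) n I - v t ?x) + \<tau> *\<^sub>R (diff2 k (ex N k) n I - w t ?x))
        - (dlaplacian N (avg (ex N k) n) I - laplacian (m t) ?x)"
      unfolding fq q_def by (simp add: scaleR_add_right scaleR_diff_right)
    then have dQ: "norm (?Q - q) \<le> \<alpha> * (K * ?\<epsilon> + \<tau> * (K * ?\<epsilon>)) + K * ?\<epsilon>"
      using field_le[OF t1 t2 t4] by simp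
    have eqn: "diff1 k (ex N k) n I - cross3 (avg (ex N k) n I) ?Q
      = (diff1 k (ex N k) n I - v t ?x) + (cross3 (m t ?x) q - cross3 (avg (ex N k) n I) ?Q)"
      using vq by simp
    have "norm (cross3 (avg (ex N k) n I) ?Q - cross3 (m t ?x) q)
       \<le> norm (avg (ex N k) n I - m t ?x) * norm ?Q + norm (m t ?x) * norm (?Q - q)"
      by (rule norm_cross3_diff_le)
    also have "\<dots> \<le> (K * ?\<epsilon>) * bnd_q + 1 * (\<alpha> * (K * ?\<epsilon> + \<tau> * (K * ?\<epsilon>)) + K * ?\<epsilon>)"
      using t3 size(3)[OF I] unit[OF tin(1) x] dQ pos e by (intro add_mono mult_mono) auto
    finally have "norm (cross3 (m t ?x) q - cross3 (avg (ex N k) n I) ?Q)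
        \<le> (K * ?\<epsilon>) * bnd_q + 1 * (\<alpha> * (K * ?\<epsilon> + \<tau> * (K * ?\<epsilon>)) + K * ?\<epsilon>)"
      by (simp only: norm_minus_commute)
    from norm_triangle_mono[OF t1 this]
    have "norm (diff1 k (ex N k) n I - cross3 (avg (ex N k) n I) ?Q)
      \<le> K * ?\<epsilon> + ((K * ?\<epsilon>) * bnd_q + 1 * (\<alpha> * (K * ?\<epsilon> + \<tau> * (K * ?\<epsilon>)) + K * ?\<epsilon>))"
      unfolding eqn .
    also have "\<dots> = (2 * K + K * bnd_q + bnd_d) * ?\<epsilon>" by (simp add: bnd_d_def algebra_simps)
    also have "\<dots> \<le> bnd * ?\<epsilon>"
      using bnd_facts pos e by (intro mult_right_mono) (auto simp: bnd_def)
    finally show ?thesis .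
  qed
  have jumps: "norm (jump j (avg (ex N k) n) I) \<le> K * mesh N" "norm (jump j (diff1 k (ex N k) n) I) \<le> K * mesh N"
    "norm (jump j (field \<alpha> \<tau> N k (ex N k) n) I) \<le> (bnd_d + 3 * K) * mesh N" if I: "I \<in> interior_faces N j" for j I
  proof -
    let ?x = "cell_center N I" and ?y = "cell_center N (shift j I)"
    have gr: "I \<in> grid N" "shift j I \<in> grid N" by (rule interior_faces_grid[OF I] shift_in_grid[OF I])+
    have x: "?x \<in> Omega_bar" "?y \<in> Omega_bar" by (rule Omega_subset[OF cell_center_Omega[OF gr(1)]] Omega_subset[OF cell_center_Omega[OF gr(2)]])+
    have pd: "has_pd j (m s)" "has_pd j (v s)" "has_pd j (w s)" if "s \<in> {0..T}" for s
      using C2[OF that] by (auto simp: numeral_2_eq_2)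
    have lm: "norm (m s ?y - m s ?x) \<le> K * mesh N" "norm (v s ?y - v s ?x) \<le> K * mesh N"
      "norm (w s ?y - w s ?x) \<le> K * mesh N" if s: "s \<in> {0..T}" for s
    proof -
      show "norm (m s ?y - m s ?x) \<le> K * mesh N" by (rule neighbour_lipschitz[OF I pd(1)[OF s]]) (rule bpd(1)[OF s])
      show "norm (v s ?y - v s ?x) \<le> K * mesh N" by (rule neighbour_lipschitz[OF I pd(2)[OF s]]) (rule bpd(2)[OF s])
      show "norm (w s ?y - w s ?x) \<le> K * mesh N" by (rule neighbour_lipschitz[OF I pd(3)[OF s]]) (rule bpd(3)[OF s])
    qed
    have "jump j (avg (ex N k) n) I = ((m (t + k) ?y - m (t + k) ?x) + (m (t - k) ?y - m (t - k) ?x)) /\<^sub>R 2"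
      unfolding jump_def aI scaleR_diff_right[symmetric] by (simp add: add_diff_add)
    then show "norm (jump j (avg (ex N k) n) I) \<le> K * mesh N"
      using average_le[OF lm(1)[OF tin(2)] lm(1)[OF tin(3)]] by simp
    have "jump j (diff1 k (ex N k) n) I = ((m (t + k) ?y - m (t + k) ?x) - (m (t - k) ?y - m (t - k) ?x)) /\<^sub>R (2 * k)"
      unfolding d1 jump_def scaleR_diff_right[symmetric] by (simp add: algebra_simps)
    moreover have "norm (((m (t + k) ?y - m (t + k) ?x) - (m (t - k) ?y - m (t - k) ?x)) /\<^sub>R (2 * k)) \<le> K * mesh N"
      by (rule first_difference_le[where g = "\<lambda>s. m s ?y - m s ?x" and g' = "\<lambda>s. v s ?y - v s ?x"])
         (use k t dm x lm(2) sin in \<open>auto intro!: has_vector_derivative_diff\<close>)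
    ultimately show j1: "norm (jump j (diff1 k (ex N k) n) I) \<le> K * mesh N" by simp
    have "jump j (diff2 k (ex N k) n) I = ((m (t + k) ?y - m (t + k) ?x) - 2 *\<^sub>R (m t ?y - m t ?x) + (m (t - k) ?y - m (t - k) ?x)) /\<^sub>R k\<^sup>2"
    proof -
      have "(a - 2 *\<^sub>R b + c) - (a' - 2 *\<^sub>R b' + c') = (a - a') - 2 *\<^sub>R (b - b') + (c - c')" for a b c a' b' c' :: "real ^ 3"
        by (simp add: scaleR_diff_right)
      from arg_cong[OF this, of "\<lambda>u. u /\<^sub>R k\<^sup>2"] show ?thesis
        unfolding jump_def d2 scaleR_diff_right[of "inverse (k\<^sup>2)" "_ - 2 *\<^sub>R _ + _" "_ - 2 *\<^sub>R _ + _"] .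
    qed
    moreover have "norm (((m (t + k) ?y - m (t + k) ?x) - 2 *\<^sub>R (m t ?y - m t ?x) + (m (t - k) ?y - m (t - k) ?x)) /\<^sub>R k\<^sup>2) \<le> K * mesh N"
      by (rule second_quotient_le[where g = "\<lambda>s. m s ?y - m s ?x" and g' = "\<lambda>s. v s ?y - v s ?x" and g'' = "\<lambda>s. w s ?y - w s ?x"])
         (use k t dm dv x lm(3) sin in \<open>auto intro!: has_vector_derivative_diff\<close>)
    ultimately have j2: "norm (jump j (diff2 k (ex N k) n) I) \<le> K * mesh N" by simp
    \<comment> \<open>A direct bound would be a third difference of \<open>m\<close> across the
      boundary. Instead the exact Laplacian is inserted at both cells: two consistency errors of
      order \<open>h\<^sup>2\<close>, below \<open>h\<close> since the mesh size is at most 1, and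
      one Lipschitz increment.\<close>
    have lj: "norm (jump j (dlaplacian N (nodal_interp N (m s))) I) \<le> 3 * K * mesh N" if s: "s \<in> {0..T}" for s
    proof -
      let ?D = "dlaplacian N (nodal_interp N (m s))" and ?L = "laplacian (m s)"
      have "jump j ?D I = (?D (shift j I) - ?L ?y) + (?L ?y - ?L ?x) - (?D I - ?L ?x)" by (simp add: jump_def)
      then have "norm (jump j ?D I) \<le> norm (?D (shift j I) - ?L ?y) + norm (?L ?y - ?L ?x) + norm (?D I - ?L ?x)"
        by (metis norm_triangle_ineq norm_triangle_le_diff add_right_mono)
      also have "\<dots> \<le> K * (mesh N)\<^sup>2 + K * mesh N + K * (mesh N)\<^sup>2"
        using space[OF s N gr(1)] space[OF s N gr(2)] lipL[OF s I] by linarith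
      also have "K * (mesh N)\<^sup>2 \<le> K * mesh N"
        using h pos by (intro mult_left_mono) (auto simp: power2_eq_square mult_left_le)
      finally show ?thesis by simp
    qed
    have "jump j (dlaplacian N (avg (ex N k) n)) I = (jump j (dlaplacian N (nodal_interp N (m (t + k)))) I
       + jump j (dlaplacian N (nodal_interp N (m (t - k)))) I) /\<^sub>R 2"
      unfolding jump_def dl scaleR_diff_right[symmetric] add_diff_add ..
    then have j3: "norm (jump j (dlaplacian N (avg (ex N k) n)) I) \<le> 3 * K * mesh N"
      using average_le[OF lj[OF tin(2)] lj[OF tin(3)]] by simp
    have "jump j (field \<alpha> \<tau> N k (ex N k) n) I = \<alpha> *\<^sub>R (jump j (diff1 k (ex N k) n) I + \<tau> *\<^sub>R jump j (diff2 k (ex N k) n) I)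
       - jump j (dlaplacian N (avg (ex N k) n)) I"
      unfolding jump_def fq by (simp add: scaleR_add_right scaleR_diff_right)
    then have "norm (jump j (field \<alpha> \<tau> N k (ex N k) n) I) \<le> \<alpha> * (K * mesh N + \<tau> * (K * mesh N)) + 3 * K * mesh N"
      using field_le[OF j1 j2 j3] by simp
    also have "\<dots> = (bnd_d + 3 * K) * mesh N" by (simp add: bnd_d_def algebra_simps)
    finally show "norm (jump j (field \<alpha> \<tau> N k (ex N k) n) I) \<le> (bnd_d + 3 * K) * mesh N" .
  qed
  have time: "norm (avg (ex N k) n I - avg (ex N k) (n - 1) I) \<le> K * k"
    "norm (diff1 k (ex N k) n I - diff1 k (ex N k) (n - 1) I) \<le> K * k"
    "norm (field \<alpha> \<tau> N k (ex N k) n I - field \<alpha> \<tau> N k (ex N k) (n - 1) I) \<le> bnd_q * k"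
    if n2: "2 \<le> n" and I: "I \<in> grid N" for I
  proof -
    let ?x = "cell_center N I"
    have x: "?x \<in> Omega_bar" by (rule Omega_subset[OF cell_center_Omega[OF I]])
    define r where "r = t - k"
    have rp: "real (n - 1 + 1) * k = r + k" and rn: "real (n - 1) * k = r" and rm: "real (n - 1 - 1) * k = r - k"
      using n2 by (simp_all add: r_def t_def of_nat_diff algebra_simps)
    have "0 \<le> r - k" unfolding rm[symmetric] using k by simp
    then have r: "0 \<le> r - k" "r + k \<le> T" "r + k + k \<le> T" using t k by (auto simp: r_def)
    have rin: "r \<in> {0..T}" "r + k \<in> {0..T}" "r - k \<in> {0..T}" "r + k + k \<in> {0..T}" "r - k + k \<in> {0..T}"
      using r k by auto
    have tr: "t = r + k" "t + k = r + k + k" "t - k = r - k + k" by (simp_all add: r_def)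
    have inc: "norm (g (s + k) - g s) \<le> K * k"
      if "\<And>s. s \<in> {0..T} \<Longrightarrow> (g has_vector_derivative g' s) (at s within {0..T})"
        "\<And>s. s \<in> {0..T} \<Longrightarrow> norm (g' s) \<le> K" "0 \<le> s" "s + k \<le> T" for g g' :: "real \<Rightarrow> real ^ 3" and s
    proof -
      have "norm (g (s + k) - g s) \<le> K * (s + k - s)"
        by (rule increment_bound[OF _ sub_derivative[OF that(1)] that(2)]) (use that(3,4) k in auto)
      then show ?thesis by simp
    qed
    \<comment> \<open>The increment of a difference quotient over one step is the same quotient of
      the function \<open>m (s + k) - m s\<close>, whose time derivatives are of order
      \<open>k\<close>. It lives on \<open>{0..T - k}\<close>.\<close>
    have sh: "((\<lambda>s. g (s + k) - g s) has_vector_derivative g' (s + k) - g' s) (at s within {0..T - k})"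
      if "\<And>s. s \<in> {0..T} \<Longrightarrow> (g has_vector_derivative g' s) (at s within {0..T})" "s \<in> {0..T - k}"
      for g g' :: "real \<Rightarrow> real ^ 3" and s
    proof (rule has_vector_derivative_diff)
      show "((\<lambda>s. g (s + k)) has_vector_derivative g' (s + k)) (at s within {0..T - k})"
        using has_vector_derivative_affine[OF that(1), of k 1 s "{0..T - k}"] that(2) k by (simp add: add.commute)
      show "(g has_vector_derivative g' s) (at s within {0..T - k})"
        by (rule sub_derivative[OF that(1)]) (use that(2) k in auto)
    qed
    have sub: "(g has_vector_derivative g') (at s within {r - k..r + k})"
      if "(g has_vector_derivative g') (at s within {0..T - k})" for g and g' :: "real ^ 3" and s
      by (rule has_vector_derivative_within_subset[OF that]) (use r in auto)
    have rs: "s \<in> {0..T - k}" if "s \<in> {r - k..r + k}" for s using that r by auto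
    have new: "avg (ex N k) n I = (m (r + k + k) ?x + m (r - k + k) ?x) /\<^sub>R 2"
      "diff1 k (ex N k) n I = (m (r + k + k) ?x - m (r - k + k) ?x) /\<^sub>R (2 * k)"
      "diff2 k (ex N k) n I = (m (r + k + k) ?x - 2 *\<^sub>R m (r + k) ?x + m (r - k + k) ?x) /\<^sub>R k\<^sup>2"
    proof -
      show "avg (ex N k) n I = (m (r + k + k) ?x + m (r - k + k) ?x) /\<^sub>R 2"
        "diff1 k (ex N k) n I = (m (r + k + k) ?x - m (r - k + k) ?x) /\<^sub>R (2 * k)"
        by (simp_all only: aI d1 tr(2,3))
      show "diff2 k (ex N k) n I = (m (r + k + k) ?x - 2 *\<^sub>R m (r + k) ?x + m (r - k + k) ?x) /\<^sub>R k\<^sup>2"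
        unfolding d2 tr(2,3) unfolding tr(1) ..
    qed
    have old: "avg (ex N k) (n - 1) I = (m (r + k) ?x + m (r - k) ?x) /\<^sub>R 2"
      "diff1 k (ex N k) (n - 1) I = (m (r + k) ?x - m (r - k) ?x) /\<^sub>R (2 * k)"
      "diff2 k (ex N k) (n - 1) I = (m (r + k) ?x - 2 *\<^sub>R m r ?x + m (r - k) ?x) /\<^sub>R k\<^sup>2"
      by (simp_all only: avg_def diff1_def diff2_def nodal_interp_def rp rm rn)
    have "avg (ex N k) n I - avg (ex N k) (n - 1) I = ((m (r + k + k) ?x - m (r + k) ?x) + (m (r - k + k) ?x - m (r - k) ?x)) /\<^sub>R 2"
      unfolding new old scaleR_diff_right[symmetric] add_diff_add ..
    then show "norm (avg (ex N k) n I - avg (ex N k) (n - 1) I) \<le> K * k"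
      using average_le[OF inc[of "\<lambda>s. m s ?x" "\<lambda>s. v s ?x" "r + k"] inc[of "\<lambda>s. m s ?x" "\<lambda>s. v s ?x" "r - k"]]
        dm[OF _ x] bv[OF _ x] r k by simp
    have p1: "diff1 k (ex N k) n I - diff1 k (ex N k) (n - 1) I
      = ((m (r + k + k) ?x - m (r + k) ?x) - (m (r - k + k) ?x - m (r - k) ?x)) /\<^sub>R (2 * k)"
    proof -
      have "(a - c) - (b - d) = (a - b) - (c - d)" for a b c d :: "real ^ 3" by simp
      from arg_cong[OF this, of "\<lambda>u. u /\<^sub>R (2 * k)"] show ?thesis
        unfolding new old scaleR_diff_right[symmetric] .
    qed
    have "norm ((m (r + k + k) ?x - m (r + k) ?x) - (m (r - k + k) ?x - m (r - k) ?x)) \<le> K * k * (r + k - (r - k))"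
    proof (rule increment_bound[where g = "\<lambda>s. m (s + k) ?x - m s ?x" and g' = "\<lambda>s. v (s + k) ?x - v s ?x"])
      fix s assume s: "s \<in> {r - k..r + k}"
      show "((\<lambda>s. m (s + k) ?x - m s ?x) has_vector_derivative v (s + k) ?x - v s ?x) (at s within {r - k..r + k})"
        by (rule sub[OF sh[OF dm[OF _ x] rs[OF s]]])
      show "norm (v (s + k) ?x - v s ?x) \<le> K * k"
        by (rule inc[OF dv[OF _ x] bw[OF _ x]]) (use rs[OF s] in auto)
    qed (use k in auto)
    moreover have "r + k - (r - k) = 2 * k" by simp
    ultimately show q1: "norm (diff1 k (ex N k) n I - diff1 k (ex N k) (n - 1) I) \<le> K * k"
      unfolding p1 using k by (intro norm_quotient_le) simp_all
    have p2: "diff2 k (ex N k) n I - diff2 k (ex N k) (n - 1) I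
      = ((m (r + k + k) ?x - m (r + k) ?x) + (m (r - k + k) ?x - m (r - k) ?x) - 2 *\<^sub>R (m (r + k) ?x - m r ?x)) /\<^sub>R k\<^sup>2"
    proof -
      have "(a - 2 *\<^sub>R b + c) - (b - 2 *\<^sub>R d + e) = (a - b) + (c - e) - 2 *\<^sub>R (b - d)" for a b c d e :: "real ^ 3"
        by (simp add: scaleR_diff_right)
      from arg_cong[OF this, of "\<lambda>u. u /\<^sub>R k\<^sup>2"] show ?thesis
        unfolding new old scaleR_diff_right[of "inverse (k\<^sup>2)" "_ - 2 *\<^sub>R _ + _" "_ - 2 *\<^sub>R _ + _"] .
    qed
    have "norm ((m (r + k + k) ?x - m (r + k) ?x) + (m (r - k + k) ?x - m (r - k) ?x) - 2 *\<^sub>R (m (r + k) ?x - m r ?x)) \<le> K * k * k\<^sup>2"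
    proof (rule second_difference_le[where g = "\<lambda>s. m (s + k) ?x - m s ?x" and g' = "\<lambda>s. v (s + k) ?x - v s ?x"
          and g'' = "\<lambda>s. w (s + k) ?x - w s ?x"])
      fix s assume s: "s \<in> {r - k..r + k}"
      show "((\<lambda>s. m (s + k) ?x - m s ?x) has_vector_derivative v (s + k) ?x - v s ?x) (at s within {r - k..r + k})"
        by (rule sub[OF sh[OF dm[OF _ x] rs[OF s]]])
      show "((\<lambda>s. v (s + k) ?x - v s ?x) has_vector_derivative w (s + k) ?x - w s ?x) (at s within {r - k..r + k})"
        by (rule sub[OF sh[OF dv[OF _ x] rs[OF s]]])
      show "norm (w (s + k) ?x - w s ?x) \<le> K * k"
        by (rule inc[OF dw[OF _ x] bz[OF _ x]]) (use rs[OF s] in auto)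
    qed (use k in auto)
    then have q2: "norm (diff2 k (ex N k) n I - diff2 k (ex N k) (n - 1) I) \<le> K * k"
      unfolding p2 using k by (intro norm_quotient_le) simp_all
    \<comment> \<open>The difference of two time levels is itself a Neumann field with second
      derivatives of order \<open>k\<close>, so the size bound for the discrete Laplacian applies to
      it.\<close>
    have ld: "norm (dlaplacian N (nodal_interp N (m (s + k))) I - dlaplacian N (nodal_interp N (m s)) I) \<le> real CARD('d) * (K * k)"
      if s: "0 \<le> s" "s + k \<le> T" for s
    proof -
      have si: "s \<in> {0..T}" "s + k \<in> {0..T}" using s k by auto
      let ?g = "\<lambda>y. 1 *\<^sub>R m (s + k) y + (-1) *\<^sub>R m s y"
      have pd: "has_pd j (m r)" "has_pd j (pd j (m r))" if "r \<in> {0..T}" for r j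
        using C2(1)[OF that] by (auto simp: numeral_2_eq_2)
      have g1: "pd j ?g y = 1 *\<^sub>R pd j (m (s + k)) y + (-1) *\<^sub>R pd j (m s) y" if "y \<in> Omega_bar" for j y
        by (rule pd_linear(2)[OF pd(1)[OF si(2)] pd(1)[OF si(1)] that])
      have g2: "pd j (pd j ?g) y = pd j (pd j (m (s + k))) y - pd j (pd j (m s)) y" if "y \<in> Omega_bar" for j y
        using pd_cong(1)[OF g1 that] pd_linear(2)[OF pd(2)[OF si(2)] pd(2)[OF si(1)] that, where a = 1 and b = "-1"] by simp
      have "norm (dlaplacian N (nodal_interp N ?g) I) \<le> real CARD('d) * (K * k)"
      proof (rule dlaplacian_nodal_le[OF N I])
        show "Ck 2 ?g" by (rule Ck_linear[OF C2(1)[OF si(2)] C2(1)[OF si(1)]])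
        show "neumann ?g"
          unfolding neumann_def
        proof (intro allI impI)
          fix i :: 'd and c y assume c: "c \<in> {0, 1::real}" and y: "onface i c y"
          have "pd i (m (s + k)) y = 0" "pd i (m s) y = 0"
            using neu[OF si(2)] neu[OF si(1)] c y unfolding neumann_def by blast+
          then show "pd i ?g y = 0"
            unfolding g1[OF onface_Omega_bar[OF y c]] by simp
        qed
        fix y :: "real ^ 'd" and j assume y: "y \<in> Omega_bar"
        show "norm (pd j (pd j ?g) y) \<le> K * k"
          unfolding g2[OF y]
          by (rule inc[where g = "\<lambda>s. pd j (pd j (m s)) y" and g' = "\<lambda>s. pd j (pd j (v s)) y"])
             (use dpd2[OF _ y] bpd2(2)[OF _ y] s in auto)
      qed
      moreover have "nodal_interp N ?g = (\<lambda>I. nodal_interp N (m (s + k)) I - nodal_interp N (m s) I)"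
        by (simp add: nodal_interp_def)
      ultimately show ?thesis by (simp only: dlaplacian_diff)
    qed
    have dln: "dlaplacian N (avg (ex N k) n) I = (dlaplacian N (nodal_interp N (m (r + k + k))) I
      + dlaplacian N (nodal_interp N (m (r - k + k))) I) /\<^sub>R 2"
      by (simp only: dl tr(2,3))
    have dlo: "dlaplacian N (avg (ex N k) (n - 1)) I = (dlaplacian N (nodal_interp N (m (r + k))) I
      + dlaplacian N (nodal_interp N (m (r - k))) I) /\<^sub>R 2"
      unfolding avg_def rp rm dlaplacian_avg ..
    have "dlaplacian N (avg (ex N k) n) I - dlaplacian N (avg (ex N k) (n - 1)) I
      = ((dlaplacian N (nodal_interp N (m (r + k + k))) I - dlaplacian N (nodal_interp N (m (r + k))) I)
       + (dlaplacian N (nodal_interp N (m (r - k + k))) I - dlaplacian N (nodal_interp N (m (r - k))) I)) /\<^sub>R 2"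
      unfolding dln dlo scaleR_diff_right[symmetric] add_diff_add ..
    then have q3: "norm (dlaplacian N (avg (ex N k) n) I - dlaplacian N (avg (ex N k) (n - 1)) I) \<le> real CARD('d) * (K * k)"
      using average_le[OF ld[of "r + k"] ld[of "r - k"]] r k by simp
    have "field \<alpha> \<tau> N k (ex N k) n I - field \<alpha> \<tau> N k (ex N k) (n - 1) I
      = \<alpha> *\<^sub>R ((diff1 k (ex N k) n I - diff1 k (ex N k) (n - 1) I) + \<tau> *\<^sub>R (diff2 k (ex N k) n I - diff2 k (ex N k) (n - 1) I))
        - (dlaplacian N (avg (ex N k) n) I - dlaplacian N (avg (ex N k) (n - 1)) I)"
      unfolding field_def by (simp add: scaleR_add_right scaleR_diff_right)
    then have "norm (field \<alpha> \<tau> N k (ex N k) n I - field \<alpha> \<tau> N k (ex N k) (n - 1) I) \<le> \<alpha> * (K * k + \<tau> * (K * k)) + real CARD('d) * (K * k)"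
      using field_le[OF q1 q2 q3] by simp
    also have "\<dots> = bnd_q * k" by (simp add: bnd_q_def bnd_d_def algebra_simps)
    finally show "norm (field \<alpha> \<tau> N k (ex N k) n I - field \<alpha> \<tau> N k (ex N k) (n - 1) I) \<le> bnd_q * k" .
  qed
  have K: "K \<le> bnd" "bnd_q \<le> bnd" "bnd_d + 3 * K \<le> bnd" using bnd_facts pos by (auto simp: bnd_def)
  have up: "x \<le> bnd * c" if "x \<le> R * c" "R \<le> bnd" "0 \<le> c" for x R c
    using that mult_right_mono order_trans by blast
  show "(\<forall>I\<in>grid N. norm (ex N k (n + 1) I) = 1 \<and> norm (ex N k (n - 1) I) = 1 \<and>
        norm (diff1 k (ex N k) n I) \<le> bnd \<and> norm (field \<alpha> \<tau> N k (ex N k) n I) \<le> bnd \<and>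
        norm (diff1 k (ex N k) n I - cross3 (avg (ex N k) n I) (field \<alpha> \<tau> N k (ex N k) n I)) \<le> bnd * (k\<^sup>2 + (mesh N)\<^sup>2)) \<and>
     (\<forall>j. \<forall>I\<in>interior_faces N j. norm (jump j (avg (ex N k) n) I) \<le> bnd * mesh N \<and>
        norm (jump j (diff1 k (ex N k) n) I) \<le> bnd * mesh N \<and>
        norm (jump j (field \<alpha> \<tau> N k (ex N k) n) I) \<le> bnd * mesh N) \<and>
     (2 \<le> n \<longrightarrow> (\<forall>I\<in>grid N. norm (avg (ex N k) n I - avg (ex N k) (n - 1) I) \<le> bnd * k \<and>
        norm (diff1 k (ex N k) n I - diff1 k (ex N k) (n - 1) I) \<le> bnd * k \<and>
        norm (field \<alpha> \<tau> N k (ex N k) n I - field \<alpha> \<tau> N k (ex N k) (n - 1) I) \<le> bnd * k))"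
  proof (intro conjI ballI allI impI)
    fix I :: "'d \<Rightarrow> nat" assume I: "I \<in> grid N"
    have x: "cell_center N I \<in> Omega_bar" by (rule Omega_subset[OF cell_center_Omega[OF I]])
    show "norm (ex N k (n + 1) I) = 1" "norm (ex N k (n - 1) I) = 1"
      unfolding nodal_interp_def tp tm by (rule unit[OF tin(2) x] unit[OF tin(3) x])+
    show "norm (diff1 k (ex N k) n I) \<le> bnd" "norm (field \<alpha> \<tau> N k (ex N k) n I) \<le> bnd"
      using size[OF I] K by linarith+
    show "norm (diff1 k (ex N k) n I - cross3 (avg (ex N k) n I) (field \<alpha> \<tau> N k (ex N k) n I)) \<le> bnd * (k\<^sup>2 + (mesh N)\<^sup>2)"
      by (rule trunc[OF I])
  next
    fix j and I :: "'d \<Rightarrow> nat" assume I: "I \<in> interior_faces N j"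
    show "norm (jump j (avg (ex N k) n) I) \<le> bnd * mesh N" "norm (jump j (diff1 k (ex N k) n) I) \<le> bnd * mesh N"
      "norm (jump j (field \<alpha> \<tau> N k (ex N k) n) I) \<le> bnd * mesh N"
      by (rule up[OF jumps(1)[OF I] K(1)] up[OF jumps(2)[OF I] K(1)] up[OF jumps(3)[OF I] K(3)]; simp)+
  next
    fix I :: "'d \<Rightarrow> nat" assume n2: "2 \<le> n" and I: "I \<in> grid N"
    show "norm (avg (ex N k) n I - avg (ex N k) (n - 1) I) \<le> bnd * k"
      "norm (diff1 k (ex N k) n I - diff1 k (ex N k) (n - 1) I) \<le> bnd * k"
      "norm (field \<alpha> \<tau> N k (ex N k) n I - field \<alpha> \<tau> N k (ex N k) (n - 1) I) \<le> bnd * k"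
      by (rule up[OF time(1)[OF n2 I] K(1) less_imp_le[OF k]] up[OF time(2)[OF n2 I] K(1) less_imp_le[OF k]]
          up[OF time(3)[OF n2 I] K(2) less_imp_le[OF k]])+
  qed
qed

end

section \<open>Regularity of the exact solution\<close>

definition twice_diff_with ::
  "real \<Rightarrow> 'x set \<Rightarrow> (real \<Rightarrow> 'x \<Rightarrow> 'a::real_normed_vector) \<Rightarrow> (real \<Rightarrow> 'x \<Rightarrow> 'a) \<Rightarrow> (real \<Rightarrow> 'x \<Rightarrow> 'a) \<Rightarrow> real \<Rightarrow> bool" where
  "twice_diff_with T X g g' g'' C \<longleftrightarrow> (\<forall>t\<in>{0..T}. \<forall>x\<in>X.
     ((\<lambda>s. g s x) has_vector_derivative g' t x) (at t within {0..T}) \<and>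
     ((\<lambda>s. g' s x) has_vector_derivative g'' t x) (at t within {0..T}) \<and>
     norm (g t x) \<le> C \<and> norm (g' t x) \<le> C \<and> norm (g'' t x) \<le> C)"

text \<open>The derivatives and the bound are hidden so that the class can be closed under linear
  and bilinear operations; the long expression for the second time derivative is then assembled from
  its factors without computing its derivatives.\<close>

definition twice_diff :: "real \<Rightarrow> 'x set \<Rightarrow> (real \<Rightarrow> 'x \<Rightarrow> 'a::real_normed_vector) \<Rightarrow> bool" where
  "twice_diff T X g \<longleftrightarrow> (\<exists>g' g'' C. twice_diff_with T X g g' g'' C)"

lemma twice_diffI:
  assumes "\<And>t x. t \<in> {0..T} \<Longrightarrow> x \<in> X \<Longrightarrow> ((\<lambda>s. g s x) has_vector_derivative g' t x) (at t within {0..T})"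
    and "\<And>t x. t \<in> {0..T} \<Longrightarrow> x \<in> X \<Longrightarrow> ((\<lambda>s. g' s x) has_vector_derivative g'' t x) (at t within {0..T})"
    and "\<And>t x. t \<in> {0..T} \<Longrightarrow> x \<in> X \<Longrightarrow> norm (g t x) \<le> C"
    and "\<And>t x. t \<in> {0..T} \<Longrightarrow> x \<in> X \<Longrightarrow> norm (g' t x) \<le> C"
    and "\<And>t x. t \<in> {0..T} \<Longrightarrow> x \<in> X \<Longrightarrow> norm (g'' t x) \<le> C"
  shows "twice_diff T X g"
  unfolding twice_diff_def twice_diff_with_def using assms
  by (intro exI[of _ g'] exI[of _ g''] exI[of _ C] ballI conjI)

lemma twice_diff_withD:
  assumes "twice_diff_with T X g g' g'' C" "t \<in> {0..T}" "x \<in> X"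
  shows "((\<lambda>s. g s x) has_vector_derivative g' t x) (at t within {0..T})"
    and "((\<lambda>s. g' s x) has_vector_derivative g'' t x) (at t within {0..T})"
    and "norm (g t x) \<le> C" "norm (g' t x) \<le> C" "norm (g'' t x) \<le> C"
  using assms unfolding twice_diff_with_def by simp_all

lemma twice_diff_linear:
  assumes "bounded_linear h" "twice_diff T X g"
  shows "twice_diff T X (\<lambda>t x. h (g t x))"
proof -
  obtain g' g'' C where "twice_diff_with T X g g' g'' C"
    using assms(2) by (auto simp: twice_diff_def)
  note g = twice_diff_withD[OF this]
  obtain K where K: "0 \<le> K" "\<And>x. norm (h x) \<le> norm x * K"
    using bounded_linear.nonneg_bounded[OF assms(1)] by blast
  have bnd: "norm (h y) \<le> C * K" if "norm y \<le> C" for y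
    using K(2)[of y] mult_right_mono[OF that K(1)] by linarith
  show ?thesis
    by (rule twice_diffI[where g' = "\<lambda>t x. h (g' t x)" and g'' = "\<lambda>t x. h (g'' t x)" and C = "C * K"])
       (intro bounded_linear.has_vector_derivative[OF assms(1)] g bnd; assumption)+
qed

lemma twice_diff_diff:
  assumes "twice_diff T X f" "twice_diff T X g"
  shows "twice_diff T X (\<lambda>t x. f t x - g t x)"
proof -
  obtain f' f'' C where "twice_diff_with T X f f' f'' C"
    using assms(1) by (auto simp: twice_diff_def)
  note f = twice_diff_withD[OF this]
  obtain g' g'' D where "twice_diff_with T X g g' g'' D"
    using assms(2) by (auto simp: twice_diff_def)
  note g = twice_diff_withD[OF this]
  have bnd: "norm (a - b) \<le> C + D" if "norm a \<le> C" "norm b \<le> D" for a b :: 'b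
    using norm_triangle_ineq4[of a b] that by linarith
  show ?thesis
    by (rule twice_diffI[where g' = "\<lambda>t x. f' t x - g' t x" and g'' = "\<lambda>t x. f'' t x - g'' t x" and C = "C + D"])
       (intro has_vector_derivative_diff f g bnd; assumption)+
qed

lemma twice_diff_bilinear:
  assumes "bounded_bilinear h" "twice_diff T X f" "twice_diff T X g"
  shows "twice_diff T X (\<lambda>t x. h (f t x) (g t x))"
proof -
  interpret h: bounded_bilinear h by fact
  obtain f' f'' C0 where "twice_diff_with T X f f' f'' C0"
    using assms(2) by (auto simp: twice_diff_def)
  note f = twice_diff_withD[OF this]
  obtain g' g'' D0 where "twice_diff_with T X g g' g'' D0"
    using assms(3) by (auto simp: twice_diff_def)
  note g = twice_diff_withD[OF this]
  \<comment> \<open>If \<open>X\<close> or the time interval is empty, the bounds hold vacuously and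
    may be negative; the absolute values restore a sign.\<close>
  define C where "C = \<bar>C0\<bar>"
  define D where "D = \<bar>D0\<bar>"
  obtain K where K: "0 \<le> K" "\<And>a b. norm (h a b) \<le> norm a * norm b * K"
    using h.nonneg_bounded by blast
  have CDK: "0 \<le> C * D * K" using K by (simp add: C_def D_def)
  have bnd: "norm (h a b) \<le> C * D * K" if "norm a \<le> C0" "norm b \<le> D0" for a b
  proof -
    have "norm a * norm b * K \<le> C * D * K"
      using that K by (intro mult_right_mono mult_mono) (auto simp: C_def D_def)
    then show ?thesis using K(2)[of a b] by linarith
  qed
  let ?E = "C * D * K + C * D * K + (C * D * K + C * D * K)"
  show ?thesis
  proof (rule twice_diffI[where g' = "\<lambda>t x. h (f t x) (g' t x) + h (f' t x) (g t x)"
        and g'' = "\<lambda>t x. (h (f t x) (g'' t x) + h (f' t x) (g' t x)) + (h (f' t x) (g' t x) + h (f'' t x) (g t x))" and C = ?E])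
    fix t x assume t: "t \<in> {0..T}" and x: "x \<in> X"
    note fx = f[OF t x] and gx = g[OF t x]
    show "((\<lambda>s. h (f s x) (g s x)) has_vector_derivative h (f t x) (g' t x) + h (f' t x) (g t x)) (at t within {0..T})"
      by (rule h.has_vector_derivative[OF fx(1) gx(1)])
    show "((\<lambda>s. h (f s x) (g' s x) + h (f' s x) (g s x)) has_vector_derivative
      (h (f t x) (g'' t x) + h (f' t x) (g' t x)) + (h (f' t x) (g' t x) + h (f'' t x) (g t x))) (at t within {0..T})"
      by (intro has_vector_derivative_add h.has_vector_derivative[OF fx(1) gx(2)] h.has_vector_derivative[OF fx(2) gx(1)])
    show "norm (h (f t x) (g t x)) \<le> ?E"
      using bnd[OF fx(3) gx(3)] CDK by linarith
    show "norm (h (f t x) (g' t x) + h (f' t x) (g t x)) \<le> ?E"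
      using norm_triangle_mono[OF bnd[OF fx(3) gx(4)] bnd[OF fx(4) gx(3)]] CDK by linarith
    show "norm ((h (f t x) (g'' t x) + h (f' t x) (g' t x)) + (h (f' t x) (g' t x) + h (f'' t x) (g t x))) \<le> ?E"
      by (intro norm_triangle_mono bnd fx gx)
  qed
qed

lemma bounded_bilinear_cross3: "bounded_bilinear cross3"
  using bilinear_cross bilinear_conv_bounded_bilinear by blast

lemma time_derivative_unique:
  fixes g :: "real \<Rightarrow> 'a::real_normed_vector"
  assumes "0 < T" "t \<in> {0..T}" "(g has_vector_derivative a) (at t within {0..T})" "(g has_vector_derivative b) (at t within {0..T})"
  shows "a = b"
  using vector_derivative_unique_within_closed_interval[of 0 T t g a b] assms by simp

lemma derivative_of_constant:
  fixes g :: "real \<Rightarrow> 'a::real_normed_vector"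
  assumes "0 < T" "t \<in> {0..T}" "(g has_vector_derivative a) (at t within {0..T})" "\<And>s. s \<in> {0..T} \<Longrightarrow> g s = c"
  shows "a = 0"
proof (rule time_derivative_unique[OF assms(1-3)])
  show "(g has_vector_derivative 0) (at t within {0..T})"
    by (rule has_vector_derivative_transform[OF assms(2,4)]) auto
qed

lemma uniform_bound:
  assumes "\<And>j. \<exists>M. \<forall>t\<in>{0..T}. \<forall>x\<in>X. norm (f j t x) \<le> M"
  obtains M where "\<And>j t x. t \<in> {0..T} \<Longrightarrow> x \<in> X \<Longrightarrow> norm (f (j :: 'd::finite) t x) \<le> M"
proof -
  obtain M where M: "\<And>j t x. t \<in> {0..T} \<Longrightarrow> x \<in> X \<Longrightarrow> norm (f j t x) \<le> M j" using assms by metis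
  show ?thesis
  proof (rule that[of "\<Sum>j\<in>UNIV. \<bar>M j\<bar>"])
    fix j t x assume "t \<in> {0..T}" "x \<in> X"
    then have "norm (f j t x) \<le> M j" by (rule M)
    also have "\<dots> \<le> \<bar>M j\<bar>" by simp
    also have "\<dots> \<le> (\<Sum>j\<in>UNIV. \<bar>M j\<bar>)" by (rule member_le_sum) auto
    finally show "norm (f j t x) \<le> (\<Sum>j\<in>UNIV. \<bar>M j\<bar>)" .
  qed
qed

lemma fourth_derivative_bounds:
  assumes "Ck 4 f" "Ck_norm 4 f \<le> M" "x \<in> Omega_bar"
  shows "norm (pd i (pd j (pd l (pd n f))) x) \<le> M" "norm (pd i (pd j (pd l f)) x) \<le> M"
proof -
  have 4: "(4::nat) = Suc (Suc (Suc (Suc 0)))" by simp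
  have C: "Ck 4 f" "Ck (Suc (Suc (Suc 0))) (pd a f)" "Ck (Suc (Suc 0)) (pd b (pd a f))"
    "Ck (Suc 0) (pd c (pd b (pd a f)))" "Ck 0 (pd d (pd c (pd b (pd a f))))" for a b c d
    using assms(1) unfolding 4 by simp_all
  have N: "Ck_norm (Suc (Suc (Suc 0))) (pd a f) \<le> M" "Ck_norm (Suc (Suc 0)) (pd b (pd a f)) \<le> M"
    "Ck_norm (Suc 0) (pd c (pd b (pd a f))) \<le> M" "Ck_norm 0 (pd d (pd c (pd b (pd a f)))) \<le> M" for a b c d
  proof -
    show 1: "Ck_norm (Suc (Suc (Suc 0))) (pd a f) \<le> M"
      using Ck_norm_pd_le[OF C(1)[unfolded 4], of a] assms(2) unfolding 4 by (rule order_trans)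
    show 2: "Ck_norm (Suc (Suc 0)) (pd b (pd a f)) \<le> M"
      using Ck_norm_pd_le[OF C(2)] 1 by (rule order_trans)
    show 3: "Ck_norm (Suc 0) (pd c (pd b (pd a f))) \<le> M"
      using Ck_norm_pd_le[OF C(3)] 2 by (rule order_trans)
    show "Ck_norm 0 (pd d (pd c (pd b (pd a f)))) \<le> M"
      using Ck_norm_pd_le[OF C(4)] 3 by (rule order_trans)
  qed
  show "norm (pd i (pd j (pd l (pd n f))) x) \<le> M"
    using norm_le_Ck_norm[OF C(5) assms(3)] N(4) by (rule order_trans)
  show "norm (pd i (pd j (pd l f)) x) \<le> M"
    using norm_le_Ck_norm[OF C(4) assms(3)] N(3) by (rule order_trans)
qed

lemma continuous_on_dlaplacian:
  assumes I: "I \<in> grid N" and c: "\<And>J. J \<in> grid N \<Longrightarrow> continuous_on S (\<lambda>t. F t J)"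
  shows "continuous_on S (\<lambda>t. dlaplacian N (F t) I)"
proof -
  have "continuous_on S (\<lambda>t. ghost_ext N (F t) (I(j := I j + 1)))" for j
  proof (cases "I j < N")
    case True
    then have "shift j I \<in> grid N" using I by (intro shift_in_grid) (simp add: interior_faces_def)
    then show ?thesis using True c by (simp only: ghost_ext_upper[OF I] if_True)
  qed (use c[OF I] in \<open>simp only: ghost_ext_upper[OF I] if_False\<close>)
  moreover have "continuous_on S (\<lambda>t. ghost_ext N (F t) (I(j := I j - 1)))" for j
  proof (cases "1 < I j")
    case True
    then have "I(j := I j - 1) \<in> grid N"
      using I by (auto simp: grid_def intro: diff_le_self[THEN order_trans])
    then show ?thesis using True c by (simp only: ghost_ext_lower[OF I] if_True)
  qed (use c[OF I] in \<open>simp only: ghost_ext_lower[OF I] if_False\<close>)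
  ultimately show ?thesis
    unfolding dlaplacian_def using c[OF I] by (intro continuous_intros)
qed

lemma smooth_solution_exists:
  fixes me :: "real \<Rightarrow> real ^ 'd::finite \<Rightarrow> real ^ 3"
  assumes pos: "0 < \<alpha>" "0 < \<tau>" "0 < T"
    and sol: "iLLG_solution \<alpha> \<tau> T m0 me"
    and C3: "C_time T 3 0 me" and C2: "C_time T 2 2 me" and Linf: "Linf_time T 4 me"
  obtains K v w z where "smooth_solution \<alpha> \<tau> T K me v w z"
proof -
  have "C_time T (Suc (Suc 0)) 2 me" using C2 by (simp only: numeral_2_eq_2)
  then obtain v w where tc: "time_continuous T 2 me" "time_continuous T 2 v" "time_continuous T 2 w"
    and td: "time_derivative T 2 me v" "time_derivative T 2 v w" by auto
  have "C_time T (Suc (Suc (Suc 0))) 0 me" using C3 by (simp only: numeral_3_eq_3)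
  then obtain v1 w1 z where tc0: "time_continuous T 0 me" "time_continuous T 0 v1" "time_continuous T 0 w1" "time_continuous T 0 z"
    and td0: "time_derivative T 0 me v1" "time_derivative T 0 v1 w1" "time_derivative T 0 w1 z" by auto
  have Ck: "Ck 2 (me t)" "Ck 2 (v t)" "Ck 2 (w t)" if "t \<in> {0..T}" for t
    using tc that by (simp_all only: time_continuous_def)
  have Ck0: "Ck 0 (me t)" "Ck 0 (v1 t)" "Ck 0 (w1 t)" if "t \<in> {0..T}" for t
    using tc0 that by (simp_all only: time_continuous_def)
  have dm: "((\<lambda>s. me s x) has_vector_derivative v t x) (at t within {0..T})"
    and dv: "((\<lambda>s. v s x) has_vector_derivative w t x) (at t within {0..T})" if "t \<in> {0..T}" "x \<in> Omega_bar" for t x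
    by (rule time_derivative_pointwise[OF Ck(1) td(1) that] time_derivative_pointwise[OF Ck(2) td(2) that]; assumption)+
  \<comment> \<open>The two regularity assumptions supply separate time derivatives. Uniqueness
    identifies them on the cube, so that \<open>z\<close> becomes the derivative of the very
    \<open>w\<close> that has spatial regularity.\<close>
  have v1: "v1 t x = v t x" if "t \<in> {0..T}" "x \<in> Omega_bar" for t x
    by (rule time_derivative_unique[OF pos(3) that(1) time_derivative_pointwise[OF Ck0(1) td0(1) that] dm[OF that]])
  have w1: "w1 t x = w t x" if "t \<in> {0..T}" "x \<in> Omega_bar" for t x
  proof (rule time_derivative_unique[OF pos(3) that(1) _ dv[OF that]])
    show "((\<lambda>s. v s x) has_vector_derivative w1 t x) (at t within {0..T})"
      by (rule has_vector_derivative_transform[OF that(1) _ time_derivative_pointwise[OF Ck0(2) td0(2) that]])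
         (use v1 that in auto)
  qed
  have dw: "((\<lambda>s. w s x) has_vector_derivative z t x) (at t within {0..T})" if "t \<in> {0..T}" "x \<in> Omega_bar" for t x
    by (rule has_vector_derivative_transform[OF that(1) _ time_derivative_pointwise[OF Ck0(3) td0(3) that]])
       (use w1 that in auto)
  have unit: "norm (me t x) = 1" if "t \<in> {0..T}" "x \<in> Omega_bar" for t x
    using sol that unfolding iLLG_solution_def by blast
  have dt1: "dt T me t x = v t x" if "t \<in> {0..T}" "x \<in> Omega_bar" for t x
    unfolding dt_def by (rule vector_derivative_within_closed_interval[OF pos(3) that(1) dm[OF that]])
  have dt2: "dt T (dt T me) t x = w t x" if "t \<in> {0..T}" "x \<in> Omega_bar" for t x
  proof -
    have "((\<lambda>s. dt T me s x) has_vector_derivative w t x) (at t within {0..T})"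
      by (rule has_vector_derivative_transform[OF that(1) _ dv[OF that]]) (use dt1 that in auto)
    then show ?thesis
      unfolding dt_def[of T "dt T me"] by (rule vector_derivative_within_closed_interval[OF pos(3) that(1)])
  qed
  have pde: "v t x = - cross3 (me t x) (laplacian (me t) x) + \<alpha> *\<^sub>R cross3 (me t x) (v t x + \<tau> *\<^sub>R w t x)"
    if "0 < t" "t < T" "x \<in> Omega" for t x
  proof -
    have t: "t \<in> {0..T}" "t \<in> {0<..<T}" and x: "x \<in> Omega_bar" using that Omega_subset by auto
    have "dt T me t x = - cross3 (me t x) (laplacian (me t) x)
       + \<alpha> *\<^sub>R cross3 (me t x) (dt T me t x + \<tau> *\<^sub>R dt T (dt T me) t x)"
      using sol t(2) that(3) unfolding iLLG_solution_def by blast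
    then show ?thesis by (simp only: dt1[OF t(1) x] dt2[OF t(1) x])
  qed
  have neu: "neumann (me t)" if "t \<in> {0..T}" for t
    by (rule neumannI) (use sol that in \<open>unfold iLLG_solution_def, blast\<close>)
  have 2: "(2::nat) = Suc (Suc 0)" by simp
  have tcp: "time_continuous T (Suc 0) (\<lambda>t. pd j (u t))" "time_continuous T 0 (\<lambda>t. pd i (pd j (u t)))"
    if "time_continuous T 2 u" for u :: "real \<Rightarrow> real ^ 'd \<Rightarrow> real ^ 3" and i j
  proof -
    show 1: "time_continuous T (Suc 0) (\<lambda>t. pd j (u t))" using that unfolding 2 by (rule time_continuous_pd)
    show "time_continuous T 0 (\<lambda>t. pd i (pd j (u t)))" using 1 by (rule time_continuous_pd)
  qed
  have dpd: "((\<lambda>s. pd j (f s) x) has_vector_derivative pd j (g t) x) (at t within {0..T})"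
    "((\<lambda>s. pd i (pd j (f s)) x) has_vector_derivative pd i (pd j (g t)) x) (at t within {0..T})"
    if C: "\<And>t. t \<in> {0..T} \<Longrightarrow> Ck 2 (f t)" and d: "time_derivative T 2 f g" and t: "t \<in> {0..T}" and x: "x \<in> Omega_bar"
    for f g :: "real \<Rightarrow> real ^ 'd \<Rightarrow> real ^ 3" and i j t x
  proof -
    have C1: "Ck (Suc 0) (pd j (f t))" "Ck 0 (pd i (pd j (f t)))" if "t \<in> {0..T}" for t
      using C[OF that] unfolding 2 by auto
    have d1: "time_derivative T (Suc 0) (\<lambda>t. pd j (f t)) (\<lambda>t. pd j (g t))"
      by (rule time_derivative_pd[OF C[unfolded 2] d[unfolded 2]])
    show "((\<lambda>s. pd j (f s) x) has_vector_derivative pd j (g t) x) (at t within {0..T})"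
      by (rule time_derivative_pointwise[OF C1(1) d1 t x])
    have d2: "time_derivative T 0 (\<lambda>t. pd i (pd j (f t))) (\<lambda>t. pd i (pd j (g t)))"
      by (rule time_derivative_pd[OF C1(1) d1])
    show "((\<lambda>s. pd i (pd j (f s)) x) has_vector_derivative pd i (pd j (g t)) x) (at t within {0..T})"
      by (rule time_derivative_pointwise[OF C1(2) d2 t x])
  qed
  have dL: "((\<lambda>s. laplacian (me s) x) has_vector_derivative laplacian (v t) x) (at t within {0..T})"
    "((\<lambda>s. laplacian (v s) x) has_vector_derivative laplacian (w t) x) (at t within {0..T})"
    if "t \<in> {0..T}" "x \<in> Omega_bar" for t x
    unfolding laplacian_def
    by (rule has_vector_derivative_sum, rule dpd(2)[OF Ck(1) td(1) that], assumption)
       (rule has_vector_derivative_sum, rule dpd(2)[OF Ck(2) td(2) that], assumption)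
  \<comment> \<open>The normal derivative of \<open>me\<close> is zero at all times, and its time
    derivative is the normal derivative of \<open>v\<close>; the same argument leads from
    \<open>v\<close> to \<open>w\<close>.\<close>
  have neuv: "neumann (v t)" "neumann (w t)" if t: "t \<in> {0..T}" for t
  proof -
    have z: "pd i (g t) x = 0" if "\<And>t. t \<in> {0..T} \<Longrightarrow> neumann (f t)" "\<And>t. t \<in> {0..T} \<Longrightarrow> Ck 2 (f t)" "time_derivative T 2 f g"
      "t \<in> {0..T}" "c \<in> {0, 1}" "onface i c x" for f g :: "real \<Rightarrow> real ^ 'd \<Rightarrow> real ^ 3" and i c x t
      by (rule derivative_of_constant[OF pos(3) that(4) dpd(1)[OF that(2,3,4) onface_Omega_bar[OF that(6,5)]]])
         (use that in \<open>auto simp: neumann_def\<close>)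
    have nv: "neumann (v t)" if "t \<in> {0..T}" for t
      unfolding neumann_def using z[OF neu Ck(1) td(1) that] by blast
    then show "neumann (v t)" using t .
    show "neumann (w t)"
      unfolding neumann_def using z[OF nv Ck(2) td(2) t] by blast
  qed
  have bd: "\<exists>M. \<forall>t\<in>{0..T}. \<forall>x\<in>Omega_bar. norm (u t x) \<le> M" if "time_continuous T k u"
    for k and u :: "real \<Rightarrow> real ^ 'd \<Rightarrow> real ^ 3"
    using time_continuous_bounded[OF that] by metis
  obtain M1 where M1: "\<And>t x. t \<in> {0..T} \<Longrightarrow> x \<in> Omega_bar \<Longrightarrow> norm (v t x) \<le> M1" using bd[OF tc(2)] by blast
  obtain M2 where M2: "\<And>t x. t \<in> {0..T} \<Longrightarrow> x \<in> Omega_bar \<Longrightarrow> norm (w t x) \<le> M2" using bd[OF tc(3)] by blast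
  obtain M3 where M3: "\<And>t x. t \<in> {0..T} \<Longrightarrow> x \<in> Omega_bar \<Longrightarrow> norm (z t x) \<le> M3" using bd[OF tc0(4)] by blast
  obtain M4 where M4: "\<And>j t x. t \<in> {0..T} \<Longrightarrow> x \<in> Omega_bar \<Longrightarrow> norm (pd j (me t) x) \<le> M4"
    using uniform_bound[of T Omega_bar "\<lambda>j t x. pd j (me t) x", OF bd[OF tcp(1)[OF tc(1)]]] by blast
  obtain M5 where M5: "\<And>j t x. t \<in> {0..T} \<Longrightarrow> x \<in> Omega_bar \<Longrightarrow> norm (pd j (v t) x) \<le> M5"
    using uniform_bound[of T Omega_bar "\<lambda>j t x. pd j (v t) x", OF bd[OF tcp(1)[OF tc(2)]]] by blast
  obtain M6 where M6: "\<And>j t x. t \<in> {0..T} \<Longrightarrow> x \<in> Omega_bar \<Longrightarrow> norm (pd j (w t) x) \<le> M6"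
    using uniform_bound[of T Omega_bar "\<lambda>j t x. pd j (w t) x", OF bd[OF tcp(1)[OF tc(3)]]] by blast
  obtain M7 where M7: "\<And>j t x. t \<in> {0..T} \<Longrightarrow> x \<in> Omega_bar \<Longrightarrow> norm (pd j (pd j (me t)) x) \<le> M7"
    using uniform_bound[of T Omega_bar "\<lambda>j t x. pd j (pd j (me t)) x", OF bd[OF tcp(2)[OF tc(1)]]] by blast
  obtain M8 where M8: "\<And>j t x. t \<in> {0..T} \<Longrightarrow> x \<in> Omega_bar \<Longrightarrow> norm (pd j (pd j (v t)) x) \<le> M8"
    using uniform_bound[of T Omega_bar "\<lambda>j t x. pd j (pd j (v t)) x", OF bd[OF tcp(2)[OF tc(2)]]] by blast
  obtain M9 where M9: "\<And>j t x. t \<in> {0..T} \<Longrightarrow> x \<in> Omega_bar \<Longrightarrow> norm (pd j (pd j (w t)) x) \<le> M9"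
    using uniform_bound[of T Omega_bar "\<lambda>j t x. pd j (pd j (w t)) x", OF bd[OF tcp(2)[OF tc(3)]]] by blast
  have lap: "norm (laplacian f x) \<le> real CARD('d) * M" if "\<And>j. norm (pd j (pd j f) x) \<le> M" for f and x :: "real ^ 'd" and M
  proof -
    have "norm (laplacian f x) \<le> (\<Sum>j\<in>(UNIV::'d set). M)"
      unfolding laplacian_def by (intro order_trans[OF norm_sum] sum_mono that)
    then show ?thesis by simp
  qed
  \<comment> \<open>Differentiating the unit length twice in time gives the component of
    \<open>w\<close> along \<open>me\<close>, which the crossed equation cannot see.\<close>
  have inner: "me t x \<bullet> w t x = - (v t x \<bullet> v t x)" if t: "t \<in> {0..T}" and x: "x \<in> Omega_bar" for t x
  proof -
    have mm: "me s x \<bullet> me s x = 1" if "s \<in> {0..T}" for s using unit[OF that x] by (simp add: norm_eq_1)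
    have "me s x \<bullet> v s x + v s x \<bullet> me s x = 0" if s: "s \<in> {0..T}" for s
      by (rule derivative_of_constant[OF pos(3) s bounded_bilinear.has_vector_derivative[OF bounded_bilinear_inner dm[OF s x] dm[OF s x]] mm])
    then have mv: "me s x \<bullet> v s x = 0" if "s \<in> {0..T}" for s using that by (simp add: inner_commute)
    have "me t x \<bullet> w t x + v t x \<bullet> v t x = 0"
      by (rule derivative_of_constant[OF pos(3) t bounded_bilinear.has_vector_derivative[OF bounded_bilinear_inner dm[OF t x] dv[OF t x]] mv])
    then show ?thesis by linarith
  qed
  text \<open>Crossing the equation with \<open>me\<close> expresses \<open>w\<close>, the second time derivative, by \<open>me\<close>, \<open>v\<close> and
    \<open>laplacian me\<close>, which are twice differentiable in time. This is where the fourth order in time,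
    needed for the consistency of the second difference, comes from.\<close>
  define F where "F t x = (- (1 / (\<alpha> * \<tau>))) *\<^sub>R (cross3 (me t x) (v t x)
      - (\<alpha> *\<^sub>R cross3 (me t x) (cross3 (me t x) (v t x)) - cross3 (me t x) (cross3 (me t x) (laplacian (me t) x))))
      - (v t x \<bullet> v t x) *\<^sub>R me t x" for t x
  have F: "twice_diff T Omega F"
  proof -
    define CC where "CC = Max {1, M1, M2, M3, real CARD('d) * M7, real CARD('d) * M8, real CARD('d) * M9}"
    have CC: "1 \<le> CC" "M1 \<le> CC" "M2 \<le> CC" "M3 \<le> CC" "real CARD('d) * M7 \<le> CC" "real CARD('d) * M8 \<le> CC"
      "real CARD('d) * M9 \<le> CC"
      unfolding CC_def by (rule Max_ge; simp)+
    have m: "twice_diff T Omega me"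
    proof (rule twice_diffI[where g' = "v" and g'' = "w" and C = CC])
      fix t x assume t: "t \<in> {0..T}" and "x \<in> (Omega :: (real ^ 'd) set)"
      then have x: "x \<in> Omega_bar" by (simp only: Omega_subset)
      show "((\<lambda>s. me s x) has_vector_derivative v t x) (at t within {0..T})" by (rule dm[OF t x])
      show "((\<lambda>s. v s x) has_vector_derivative w t x) (at t within {0..T})" by (rule dv[OF t x])
      show "norm (me t x) \<le> CC" "norm (v t x) \<le> CC" "norm (w t x) \<le> CC"
        using unit[OF t x] M1[OF t x] M2[OF t x] CC by - linarith+
    qed
    have v: "twice_diff T Omega v"
    proof (rule twice_diffI[where g' = "w" and g'' = "z" and C = CC])
      fix t x assume t: "t \<in> {0..T}" and "x \<in> (Omega :: (real ^ 'd) set)"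
      then have x: "x \<in> Omega_bar" by (simp only: Omega_subset)
      show "((\<lambda>s. v s x) has_vector_derivative w t x) (at t within {0..T})" by (rule dv[OF t x])
      show "((\<lambda>s. w s x) has_vector_derivative z t x) (at t within {0..T})" by (rule dw[OF t x])
      show "norm (v t x) \<le> CC" "norm (w t x) \<le> CC" "norm (z t x) \<le> CC"
        using M1[OF t x] M2[OF t x] M3[OF t x] CC by - linarith+
    qed
    have L: "twice_diff T Omega (\<lambda>t. laplacian (me t))"
    proof (rule twice_diffI[where g' = "\<lambda>t. laplacian (v t)" and g'' = "\<lambda>t. laplacian (w t)" and C = CC])
      fix t x assume t: "t \<in> {0..T}" and "x \<in> (Omega :: (real ^ 'd) set)"
      then have x: "x \<in> Omega_bar" by (simp only: Omega_subset)
      show "((\<lambda>s. laplacian (me s) x) has_vector_derivative laplacian (v t) x) (at t within {0..T})" by (rule dL(1)[OF t x])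
      show "((\<lambda>s. laplacian (v s) x) has_vector_derivative laplacian (w t) x) (at t within {0..T})" by (rule dL(2)[OF t x])
      show "norm (laplacian (me t) x) \<le> CC" "norm (laplacian (v t) x) \<le> CC" "norm (laplacian (w t) x) \<le> CC"
        using lap[of "me t" x M7, OF M7[OF t x]] lap[of "v t" x M8, OF M8[OF t x]] lap[of "w t" x M9, OF M9[OF t x]] CC by - linarith+
    qed
    note cross = twice_diff_bilinear[OF bounded_bilinear_cross3]
    have mmv: "twice_diff T Omega (\<lambda>t x. cross3 (me t x) (cross3 (me t x) (v t x)))"
      and mmL: "twice_diff T Omega (\<lambda>t x. cross3 (me t x) (cross3 (me t x) (laplacian (me t) x)))"
      by (rule cross[OF m cross[OF m v]] cross[OF m cross[OF m L]])+
    have "twice_diff T Omega (\<lambda>t x. \<alpha> *\<^sub>R cross3 (me t x) (cross3 (me t x) (v t x)))"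
      by (rule twice_diff_linear[OF bounded_linear_scaleR_right mmv])
    from twice_diff_diff[OF cross[OF m v] twice_diff_diff[OF this mmL]]
    have "twice_diff T Omega (\<lambda>t x. (- (1 / (\<alpha> * \<tau>))) *\<^sub>R (cross3 (me t x) (v t x)
      - (\<alpha> *\<^sub>R cross3 (me t x) (cross3 (me t x) (v t x)) - cross3 (me t x) (cross3 (me t x) (laplacian (me t) x)))))"
      by (rule twice_diff_linear[OF bounded_linear_scaleR_right])
    from twice_diff_diff[OF this twice_diff_bilinear[OF bounded_bilinear_scaleR twice_diff_bilinear[OF bounded_bilinear_inner v v] m]]
    show ?thesis unfolding F_def[abs_def] .
  qed
  obtain F' F'' CF where "twice_diff_with T Omega F F' F'' CF"
    using F by (auto simp: twice_diff_def)
  note dF = twice_diff_withD[OF this]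
  have wF: "w t x = F t x" if t: "t \<in> {0..T}" and x: "x \<in> Omega" for t x
  proof -
    have xb: "x \<in> Omega_bar" using x by (rule Omega_subset)
    have op: "w t x = F t x" if t: "0 < t" "t < T" for t
    proof -
      have ti: "t \<in> {0..T}" using t by simp
      let ?m = "me t x" and ?v = "v t x" and ?w = "w t x" and ?L = "laplacian (me t) x"
      have mm: "?m \<bullet> ?m = 1" using unit[OF ti xb] by (simp add: norm_eq_1)
      have "cross3 ?m ?v = cross3 ?m (- cross3 ?m ?L + \<alpha> *\<^sub>R cross3 ?m (?v + \<tau> *\<^sub>R ?w))"
        using pde[OF t x] by simp
      also have "\<dots> = - cross3 ?m (cross3 ?m ?L) + \<alpha> *\<^sub>R cross3 ?m (cross3 ?m ?v) + (\<alpha> * \<tau>) *\<^sub>R cross3 ?m (cross3 ?m ?w)"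
        by (simp add: cross_add_right cross_mult_right scaleR_add_right Cross3.right_diff_distrib)
      also have "cross3 ?m (cross3 ?m ?w) = - (?v \<bullet> ?v) *\<^sub>R ?m - ?w"
        unfolding Lagrange mm inner[OF ti xb] by simp
      finally have e: "cross3 ?m ?v = - cross3 ?m (cross3 ?m ?L) + \<alpha> *\<^sub>R cross3 ?m (cross3 ?m ?v)
          + (\<alpha> * \<tau>) *\<^sub>R (- (?v \<bullet> ?v) *\<^sub>R ?m - ?w)" .
      have "a = - c + b + d \<Longrightarrow> a - (b - c) = d" for a b c d :: "real ^ 3" by simp
      from this[OF e] have "cross3 ?m ?v - (\<alpha> *\<^sub>R cross3 ?m (cross3 ?m ?v) - cross3 ?m (cross3 ?m ?L))
        = (\<alpha> * \<tau>) *\<^sub>R (- (?v \<bullet> ?v) *\<^sub>R ?m - ?w)" .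
      then show ?thesis unfolding F_def using pos by simp
    qed
    \<comment> \<open>The equation holds in the open time interval only; continuity of both sides
      covers the end points.\<close>
    have "norm (w t x - F t x) \<le> 0"
    proof (rule continuous_le_on_closure[where f = "\<lambda>t. norm (w t x - F t x)" and S = "{0<..<T}"])
      have cl: "closure {0<..<T} = {0..T}" using pos by (simp add: closure_greaterThanLessThan)
      then show "t \<in> closure {0<..<T}" using t by simp
      have "continuous_on {0..T} (\<lambda>t. w t x)" "continuous_on {0..T} (\<lambda>t. F t x)"
        using dw[OF _ xb] dF(1)[OF _ x] by (meson continuous_on_eq_continuous_within has_vector_derivative_continuous)+
      then show "continuous_on (closure {0<..<T}) (\<lambda>t. norm (w t x - F t x))"
        unfolding cl by (intro continuous_intros)
      show "norm (w t x - F t x) \<le> 0" if "t \<in> {0<..<T}" for t using op[of t] that by simp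
    qed
    then show ?thesis by simp
  qed
  have wsd: "norm (w (t + s) x + w (t - s) x - 2 *\<^sub>R w t x) \<le> CF * s\<^sup>2"
    if x: "x \<in> Omega" and s: "0 \<le> s" "0 \<le> t - s" "t + s \<le> T" for t s x
  proof -
    have "norm (F (t + s) x + F (t - s) x - 2 *\<^sub>R F t x) \<le> CF * s\<^sup>2"
    proof (rule second_difference_le[where g = "\<lambda>t. F t x" and g' = "\<lambda>t. F' t x" and g'' = "\<lambda>t. F'' t x"])
      fix r assume r: "r \<in> {t - s..t + s}"
      then have rT: "r \<in> {0..T}" and sub: "{t - s..t + s} \<subseteq> {0..T}" using s by auto
      show "((\<lambda>t. F t x) has_vector_derivative F' r x) (at r within {t - s..t + s})"
        by (rule has_vector_derivative_within_subset[OF dF(1)[OF rT x] sub])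
      show "((\<lambda>t. F' t x) has_vector_derivative F'' r x) (at r within {t - s..t + s})"
        by (rule has_vector_derivative_within_subset[OF dF(2)[OF rT x] sub])
      show "norm (F'' r x) \<le> CF" by (rule dF(5)[OF rT x])
    qed (rule s)
    moreover have "w (t + s) x = F (t + s) x" "w (t - s) x = F (t - s) x" "w t x = F t x"
      using s by (auto intro!: wF x)
    ultimately show ?thesis by (simp only:)
  qed
  obtain M where M: "AE t in lebesgue_on {0..T}. Ck_norm 4 (me t) \<le> M"
    and S4: "AE t in lebesgue_on {0..T}. Ck 4 (me t)"
    using Linf unfolding Linf_time_def by (auto elim: AE_mp)
  have AE: "AE t in lebesgue_on {0..T}. Ck 4 (me t) \<and> Ck_norm 4 (me t) \<le> M"
    using M S4 by eventually_elim simp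
  have cm: "continuous_on {0..T} (\<lambda>t. me t x)" and cL: "continuous_on {0..T} (\<lambda>t. laplacian (me t) x)" if "x \<in> Omega_bar" for x
    using dm[OF _ that] dL(1)[OF _ that] by (meson continuous_on_eq_continuous_within has_vector_derivative_continuous)+
  \<comment> \<open>The fourth derivatives are bounded at almost every time. The estimate itself
    contains only point values and the Laplacian, both continuous in time, and hence extends to
    every time.\<close>
  have space: "norm (dlaplacian N (nodal_interp N (me t)) I - laplacian (me t) (cell_center N I)) \<le> real CARD('d) * M * (mesh N)\<^sup>2"
    if t: "t \<in> {0..T}" and N: "2 \<le> N" and I: "I \<in> grid N" for t N I
  proof (rule AE_le_closed[OF pos(3) AE _ _ t])
    have cell: "cell_center N J \<in> Omega_bar" if "J \<in> grid N" for J :: "'d \<Rightarrow> nat"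
      by (rule Omega_subset[OF cell_center_Omega[OF that]])
    have "continuous_on {0..T} (\<lambda>t. dlaplacian N (nodal_interp N (me t)) I)"
      by (rule continuous_on_dlaplacian[OF I]) (use cm cell in \<open>simp only: nodal_interp_def\<close>)
    then show "continuous_on {0..T} (\<lambda>t. norm (dlaplacian N (nodal_interp N (me t)) I - laplacian (me t) (cell_center N I)))"
      using cL[OF cell[OF I]] by (intro continuous_intros)
    fix t assume t: "0 < t" "t < T" and P: "Ck 4 (me t) \<and> Ck_norm 4 (me t) \<le> M"
    have ti: "t \<in> {0..T}" using t by simp
    show "norm (dlaplacian N (nodal_interp N (me t)) I - laplacian (me t) (cell_center N I)) \<le> real CARD('d) * M * (mesh N)\<^sup>2"
    proof (rule dlaplacian_nodal_consistent[OF N I _ neu[OF ti]])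
      show "Ck 4 (me t)" using P by simp
      have C1: "Ck 1 (v t)" "Ck 1 (w t)"
        using Ck(2,3)[OF ti] unfolding 2 One_nat_def by (auto intro: Ck_Suc_imp)
      show "pd i (pd i (pd i (me t))) x = 0" if "c \<in> {0, 1}" "onface i c x" for i c x
        by (rule third_normal_derivative_zero[OF _ neu[OF ti] C1(1) neuv(1)[OF ti] C1(2) neuv(2)[OF ti] unit[OF ti] pde[OF t] that])
           (use P in auto)
      show "norm (pd j (pd j (pd j (pd j (me t)))) x) \<le> M" if "x \<in> Omega_bar" for x j
        using fourth_derivative_bounds(1)[OF _ _ that] P by blast
    qed
  qed
  have lipL: "norm (laplacian (me t) (cell_center N (shift j I)) - laplacian (me t) (cell_center N I)) \<le> real CARD('d) * M * mesh N"
    if t: "t \<in> {0..T}" and I: "I \<in> interior_faces N j" for t N I j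
  proof (rule AE_le_closed[OF pos(3) AE _ _ t])
    have cell: "cell_center N J \<in> Omega_bar" if "J \<in> grid N" for J :: "'d \<Rightarrow> nat"
      by (rule Omega_subset[OF cell_center_Omega[OF that]])
    show "continuous_on {0..T} (\<lambda>t. norm (laplacian (me t) (cell_center N (shift j I)) - laplacian (me t) (cell_center N I)))"
      using cL[OF cell[OF shift_in_grid[OF I]]] cL[OF cell[OF interior_faces_grid[OF I]]] by (intro continuous_intros)
    fix t assume t: "0 < t" "t < T" and P: "Ck 4 (me t) \<and> Ck_norm 4 (me t) \<le> M"
    have "norm (pd i (pd i (me t)) (cell_center N (shift j I)) - pd i (pd i (me t)) (cell_center N I)) \<le> M * mesh N" for i
    proof (rule neighbour_lipschitz[OF I])
      show "has_pd j (pd i (pd i (me t)))" using P by (auto simp: numeral_eq_Suc)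
      show "norm (pd j (pd i (pd i (me t))) x) \<le> M" if "x \<in> Omega_bar" for x
        using fourth_derivative_bounds(2)[OF _ _ that] P by blast
    qed
    then have "norm (laplacian (me t) (cell_center N (shift j I)) - laplacian (me t) (cell_center N I)) \<le> (\<Sum>i\<in>(UNIV::'d set). M * mesh N)"
      unfolding laplacian_def sum_subtractf[symmetric] by (intro order_trans[OF norm_sum] sum_mono)
    then show "norm (laplacian (me t) (cell_center N (shift j I)) - laplacian (me t) (cell_center N I)) \<le> real CARD('d) * M * mesh N" by simp
  qed
  define K where "K = Max {0, M1, M2, M3, M4, M5, M6, M7, M8, real CARD('d) * M9, CF, real CARD('d) * M}"
  have K: "0 \<le> K" "M1 \<le> K" "M2 \<le> K" "M3 \<le> K" "M4 \<le> K" "M5 \<le> K" "M6 \<le> K" "M7 \<le> K" "M8 \<le> K"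
    "real CARD('d) * M9 \<le> K" "CF \<le> K" "real CARD('d) * M \<le> K"
    unfolding K_def by (rule Max_ge; simp)+
  have up: "a \<le> K * c" if "a \<le> b * c" "b \<le> K" "0 \<le> c" for a b c
    using that mult_right_mono order_trans by blast
  have "smooth_solution \<alpha> \<tau> T K me v w z"
  proof
    show "0 < \<alpha>" "0 < \<tau>" "0 < T" "0 \<le> K" using pos K by auto
    fix t x assume t: "t \<in> {0..T}" and x: "x \<in> (Omega_bar :: (real ^ 'd) set)"
    show "norm (me t x) = 1" by (rule unit[OF t x])
    show "((\<lambda>s. me s x) has_vector_derivative v t x) (at t within {0..T})" by (rule dm[OF t x])
    show "((\<lambda>s. v s x) has_vector_derivative w t x) (at t within {0..T})" by (rule dv[OF t x])
    show "((\<lambda>s. w s x) has_vector_derivative z t x) (at t within {0..T})" by (rule dw[OF t x])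
    show "norm (v t x) \<le> K" "norm (w t x) \<le> K" "norm (z t x) \<le> K"
      using M1[OF t x] M2[OF t x] M3[OF t x] K by linarith+
    show "norm (pd j (me t) x) \<le> K" "norm (pd j (v t) x) \<le> K" "norm (pd j (w t) x) \<le> K"
      "norm (pd j (pd j (me t)) x) \<le> K" "norm (pd j (pd j (v t)) x) \<le> K" for j
      using M4[OF t x, of j] M5[OF t x, of j] M6[OF t x, of j] M7[OF t x, of j] M8[OF t x, of j] K by linarith+
    show "((\<lambda>s. pd j (pd j (me s)) x) has_vector_derivative pd j (pd j (v t)) x) (at t within {0..T})" for j
      by (rule dpd(2)[OF Ck(1) td(1) t x])
    show "((\<lambda>s. laplacian (me s) x) has_vector_derivative laplacian (v t) x) (at t within {0..T})"
      "((\<lambda>s. laplacian (v s) x) has_vector_derivative laplacian (w t) x) (at t within {0..T})"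
      by (rule dL[OF t x])+
    show "norm (laplacian (w t) x) \<le> K"
      using lap[of "w t" x M9, OF M9[OF t x]] K by linarith
  next
    fix t assume t: "t \<in> {0..T}"
    show "Ck 2 (me t)" "Ck 2 (v t)" "Ck 2 (w t)" "neumann (me t)" by (rule Ck[OF t] neu[OF t])+
  next
    fix t s x assume "x \<in> (Omega :: (real ^ 'd) set)" "0 \<le> s" "0 \<le> t - s" "t + s \<le> T"
    then show "norm (w (t + s) x + w (t - s) x - 2 *\<^sub>R w t x) \<le> K * s\<^sup>2"
      by (intro up[OF wsd K(11)]) auto
  next
    fix t N and I :: "'d \<Rightarrow> nat" assume "t \<in> {0..T}" "2 \<le> N" "I \<in> grid N"
    then show "norm (dlaplacian N (nodal_interp N (me t)) I - laplacian (me t) (cell_center N I)) \<le> K * (mesh N)\<^sup>2"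
      by (intro up[OF space K(12)]) auto
  next
    fix t N and I :: "'d \<Rightarrow> nat" and j assume "t \<in> {0..T}" "I \<in> interior_faces N j"
    then show "norm (laplacian (me t) (cell_center N (shift j I)) - laplacian (me t) (cell_center N I)) \<le> K * mesh N"
      by (intro up[OF lipL K(12)]) auto
  next
    fix t x assume "0 < t" "t < T" "x \<in> (Omega :: (real ^ 'd) set)"
    then show "v t x = - cross3 (me t x) (laplacian (me t) x) + \<alpha> *\<^sub>R cross3 (me t x) (v t x + \<tau> *\<^sub>R w t x)"
      by (rule pde)
  qed
  then show thesis by (rule that)
qed

theorem theorem3p1:
  fixes \<alpha> \<tau> T B :: real
    and m0 :: "real ^ 'd::finite \<Rightarrow> real ^ 3"
    and me :: "real \<Rightarrow> real ^ 'd \<Rightarrow> real ^ 3"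
  assumes "\<alpha> > 0" "\<tau> > 0" "T > 0"
    and "CARD('d) \<in> {1, 2, 3}"
    and "iLLG_solution \<alpha> \<tau> T m0 me"
    and "C_time T 3 0 me" "C_time T 2 2 me" "Linf_time T 4 me"
  shows "\<exists>C>0. \<exists>h0>0. \<exists>k0>0.
    \<forall>(N::nat) (k::real) (mh :: nat \<Rightarrow> 'd grid_fun).
      0 < N \<and> mesh N < h0 \<and> 0 < k \<and> k < k0 \<and>
      implicit_scheme \<alpha> \<tau> T N k mh \<and> initial_errors_bounded B me N k mh \<longrightarrow>
      (\<forall>n. 2 \<le> n \<and> int n \<le> \<lfloor>T / k\<rfloor> \<longrightarrow>
        dnorm N (error me N k mh n) + dgrad_norm N (error me N k mh n)
          \<le> C * (k\<^sup>2 + (mesh N)\<^sup>2))"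
proof -
  obtain K v w z where "smooth_solution \<alpha> \<tau> T K me v w z"
    using smooth_solution_exists[OF assms(1-3,5-8)] by blast
  then interpret smooth_solution \<alpha> \<tau> T K me v w z .
  obtain C k0 where C: "0 < C" "0 < k0" and conv:
    "\<And>N k (m :: nat \<Rightarrow> 'd::finite grid_fun) mh n.
      \<lbrakk>0 < N; 0 < k; k < k0; consistent \<alpha> \<tau> T N k bnd m; implicit_scheme \<alpha> \<tau> T N k mh;
       dnorm N (\<lambda>I. m 1 I - mh 1 I) + dgrad_norm N (\<lambda>I. m 1 I - mh 1 I) \<le> B * (k\<^sup>2 + (mesh N)\<^sup>2);
       dnorm N (\<lambda>I. m 2 I - mh 2 I) + dgrad_norm N (\<lambda>I. m 2 I - mh 2 I) \<le> B * (k\<^sup>2 + (mesh N)\<^sup>2);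
       dnorm N (\<lambda>I. (m 2 I - mh 2 I - (m 1 I - mh 1 I)) /\<^sub>R k) \<le> B * (k\<^sup>2 + (mesh N)\<^sup>2);
       2 \<le> n; real n * k \<le> T\<rbrakk>
      \<Longrightarrow> dnorm N (\<lambda>I. m n I - mh n I) + dgrad_norm N (\<lambda>I. m n I - mh n I) \<le> C * (k\<^sup>2 + (mesh N)\<^sup>2)"
    using convergence_of_consistent[OF assms(1-3) bnd_facts(5), of B, where ?'d = 'd] by blast
  show ?thesis
  \<comment> \<open>The threshold 1 for the mesh size excludes \<open>N = 1\<close>, where a single
    cell would touch both ends of every grid line.\<close>
  proof (rule exI[of _ C], rule conjI, rule C(1), rule exI[of _ 1], rule conjI, rule zero_less_one,
      rule exI[of _ k0], rule conjI, rule C(2), intro allI impI)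
    fix N k n and mh :: "nat \<Rightarrow> 'd grid_fun"
    assume a: "0 < N \<and> mesh N < 1 \<and> 0 < k \<and> k < k0 \<and>
      implicit_scheme \<alpha> \<tau> T N k mh \<and> initial_errors_bounded B me N k mh"
      and n: "2 \<le> n \<and> int n \<le> \<lfloor>T / k\<rfloor>"
    have N: "2 \<le> N"
    proof (rule ccontr)
      assume "\<not> 2 \<le> N"
      then have "N = 1" using a by auto
      then show False using a by (simp add: mesh_def)
    qed
    have "real n \<le> T / k" using n by (simp add: le_floor_iff)
    then have nk: "real n * k \<le> T" using a by (simp add: pos_le_divide_eq)
    have i: "dnorm N (error me N k mh p) + dgrad_norm N (error me N k mh p) \<le> B * (k\<^sup>2 + (mesh N)\<^sup>2)" if "p \<in> {0, 1, 2}" for p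
      using a that unfolding initial_errors_bounded_def by blast
    have j: "dnorm N (\<lambda>I. (error me N k mh (1 + 1) I - error me N k mh 1 I) /\<^sub>R k) \<le> B * (k\<^sup>2 + (mesh N)\<^sup>2)"
      using a unfolding initial_errors_bounded_def by blast
    show "dnorm N (error me N k mh n) + dgrad_norm N (error me N k mh n) \<le> C * (k\<^sup>2 + (mesh N)\<^sup>2)"
      unfolding error_def
      by (rule conv[OF _ _ _ consistent_exact])
         (use a n N nk i[of 1] i[of 2] j in \<open>auto simp only: error_def one_add_one\<close>)
  qed
qed

end
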